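(* Let $\Omega\subseteq\mathbb{C}^n$ be open and let $u$ be a subharmonic function in $\Omega$. Let $$E_1:=\{z\in\Omega:\ \nabla u(z)\text{ exists finitely and }\nabla u(z)=0\},\qquad E_2:=\{z\in\Omega:\ \nabla u(z)\text{ does not exist finitely}\},$$ let $E_3$ be an arbitrary subset of $\Omega$ of zero Lebesgue measure which is disjoint from $E_1\cup E_2$ (not necessarily Borel), and put $E:=E_1\cup E_2\cup E_3$. If $u$ is plurisubharmonic in some open neighborhood of $\Omega\setminus E$ (that is, in some open set $\Omega'$ with $\Omega\setminus E\subseteq\Omega'\subseteq\Omega$), then $u$ is plurisubharmonic in the whole of $\Omega$.
   Context: $\mathbb{C}^n$ is identified with $\mathbb{R}^{2n}$; subharmonicity, the gradient $\nabla u$ and Lebesgue measure are taken with respect to the $2n$ real variables. Subharmonic functions are upper semicontinuous with values in $[-\infty,\infty)$ and are not identically $-\infty$ on any connected component. "$\nabla u(z)$ exists finitely" means that all first order (real) partial derivatives of $u$ at $z$ exist as finite limits of difference quotients (differentiability at $z$ is not required); in particular $u(z)$ is finite there, and all points where $u=-\infty$ belong to $E_2$. *)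

theory Defs
  imports "HOL-Analysis.Analysis"
begin

definition usc_on :: "'a::topological_space set \<Rightarrow> ('a \<Rightarrow> ereal) \<Rightarrow> bool" where
  "usc_on S u \<longleftrightarrow> (\<forall>x\<in>S. Limsup (at x within S) u \<le> u x)"

text \<open>
  Lebesgue integral of an extended-real function as the integral of the positive part minus the
  integral of the negative part. The function \<^const>\<open>e2ennreal\<close> sends negative arguments to 0.
  Below, \<open>u\<close> is upper semicontinuous and \<open>< \<infinity>\<close> on the compact set \<open>A\<close>, so the first term is
  finite and the difference is a well-defined element of \<open>[-\<infinity>, \<infinity>)\<close>.
\<close>

definition ereal_integral :: "'a::euclidean_space set \<Rightarrow> ('a \<Rightarrow> ereal) \<Rightarrow> ereal" where
  "ereal_integral A u =
     enn2ereal (\<integral>\<^sup>+x\<in>A. e2ennreal (u x) \<partial>lborel) - enn2ereal (\<integral>\<^sup>+x\<in>A. e2ennreal (- u x) \<partial>lborel)"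

definition ball_mean :: "('a::euclidean_space \<Rightarrow> ereal) \<Rightarrow> 'a \<Rightarrow> real \<Rightarrow> ereal" where
  "ball_mean u x r = ereal_integral (cball x r) u / ereal (measure lborel (cball x r))"

definition subharmonic_on :: "('a::euclidean_space \<Rightarrow> ereal) \<Rightarrow> 'a set \<Rightarrow> bool"
    (infixl "(subharmonic'_on)" 50) where
  "u subharmonic_on S \<longleftrightarrow>
     open S \<and> (\<forall>x\<in>S. u x < \<infinity>) \<and> usc_on S u \<and>
     (\<forall>C\<in>components S. \<exists>x\<in>C. u x \<noteq> -\<infinity>) \<and>
     (\<forall>x r. 0 < r \<longrightarrow> cball x r \<subseteq> S \<longrightarrow> u x \<le> ball_mean u x r)"

text \<open>
  On a connected component of the intersection of the domain with a complex line, the restriction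
  is subharmonic or identically \<open>-\<infinity>\<close>; a plurisubharmonic function itself is, like a subharmonic
  one, not identically \<open>-\<infinity>\<close> on any component of its domain.
\<close>

definition plurisubharmonic_on :: "(complex^'n \<Rightarrow> ereal) \<Rightarrow> (complex^'n) set \<Rightarrow> bool"
    (infixl "(plurisubharmonic'_on)" 50) where
  "u plurisubharmonic_on S \<longleftrightarrow>
     open S \<and> (\<forall>z\<in>S. u z < \<infinity>) \<and> usc_on S u \<and>
     (\<forall>C\<in>components S. \<exists>z\<in>C. u z \<noteq> -\<infinity>) \<and>
     (\<forall>a b. \<forall>C\<in>components {\<zeta>. a + \<zeta> *s b \<in> S}.
        (\<forall>\<zeta>\<in>C. u (a + \<zeta> *s b) = -\<infinity>) \<or> (\<lambda>\<zeta>. u (a + \<zeta> *s b)) subharmonic_on C)"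

text \<open>
  All first order partial derivatives of \<open>u\<close> at \<open>z\<close> exist as finite limits of difference quotients
  and \<open>g\<close> is the vector of these; differentiability is not required. On \<open>complex^'n\<close> the set
  \<^const>\<open>Basis\<close> consists of the directions of the \<open>2n\<close> real coordinates. Finiteness of \<open>u z\<close>
  is demanded explicitly because \<open>\<infinity> - \<infinity>\<close> has a value in \<^typ>\<open>ereal\<close>.
\<close>

definition has_gradient :: "('a::euclidean_space \<Rightarrow> ereal) \<Rightarrow> 'a \<Rightarrow> 'a \<Rightarrow> bool" where
  "has_gradient u z g \<longleftrightarrow>
     \<bar>u z\<bar> \<noteq> \<infinity> \<and>
     (\<forall>b\<in>Basis. ((\<lambda>t::real. (u (z + t *\<^sub>R b) - u z) / ereal t) \<longlongrightarrow> ereal (g \<bullet> b)) (at 0))"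

end

theory Submission
  imports Defs
begin

text \<open>
  Plurisubharmonicity is tested by paraboloids: it suffices that a paraboloid with quadratic part
  \<open>B\<close> touching \<open>u\<close> from above never has \<open>B b b + B (\<i>b) (\<i>b) < 0\<close>. Suppose one does, strictly,
  at \<open>z0\<close>. Tilting it by small linear functions gives a set \<open>K\<close> of contact points near \<open>z0\<close>. The
  sub-mean value inequality makes the slope at the contact point a Lipschitz function on \<open>K\<close>, and
  its image contains a ball, so \<open>K\<close> is not negligible. At a contact point near which \<open>u\<close> is
  plurisubharmonic the trace of \<open>B\<close> on the line is nonnegative, so \<open>K\<close> lies in the exceptional set.
  Almost every point of \<open>K\<close> has a gradient, which then is the slope of the paraboloid there. If the
  slope vanishes at \<open>x, y \<in> K\<close>, adding the two touching inequalities gives \<open>B (x - y) (x - y) \<ge> 0\<close>;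
  as \<open>B\<close> has a negative direction, this confines such points to a null set. Hence \<open>K\<close> is negligible,
  a contradiction.
\<close>

section \<open>Averages over balls\<close>

text \<open>The delicate claim is that almost every contact point has a gradient. Contact bounds the
  increments of \<open>u\<close> from above, so a partial derivative can fail only through drops of
  \<open>u\<close> below the paraboloid on arbitrarily short segments in a coordinate direction.
  That the set of low values has small measure says nothing about its shadow in that direction, and
  it is the shadow that has to be small. Potential theory controls it: the gap between paraboloid
  and \<open>u\<close> is nearly superharmonic and vanishes at the contact point, and a strictly
  subharmonic kernel whose singularity is integrable over hyperplanes turns a large shadow into a
  gap that is too large on average. Sampling the shadow by finitely many separated points replaces
  surface integrals by finite sums. The way back from paraboloids to sub-mean values on discs needs
  harmonic majorants. Real parts of complex polynomials play the part of Poisson integrals: on a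
  circle every real polynomial is one, and averaging over roots of unity reads off its central
  value.\<close>

abbreviation ball_integrable :: "'a::euclidean_space \<Rightarrow> real \<Rightarrow> ('a \<Rightarrow> real) \<Rightarrow> bool" where
  "ball_integrable x r g \<equiv> set_integrable lborel (cball x r) g"

definition avg :: "('a::euclidean_space \<Rightarrow> real) \<Rightarrow> 'a \<Rightarrow> real \<Rightarrow> real" where
  "avg g x r = (LINT y:cball x r|lborel. g y) / measure lborel (cball x r)"

text \<open>
  Comparing \<open>u\<close> only with integrable majorants \<open>g\<close> keeps the extended-real integral of \<open>u\<close> itself
  out of the later arguments.
\<close>

definition submean_on :: "('a::euclidean_space \<Rightarrow> ereal) \<Rightarrow> 'a set \<Rightarrow> bool" where
  "submean_on u S \<longleftrightarrow> (\<forall>x r g. 0 < r \<longrightarrow> cball x r \<subseteq> S \<longrightarrow> ball_integrable x r g \<longrightarrow>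
     (\<forall>y\<in>cball x r. u y \<le> ereal (g y)) \<longrightarrow> u x \<le> ereal (avg g x r))"

lemma submean_onD:
  assumes "submean_on u S" "0 < r" "cball x r \<subseteq> S" "ball_integrable x r g"
    and "\<And>y. y \<in> cball x r \<Longrightarrow> u y \<le> ereal (g y)"
  shows "u x \<le> ereal (avg g x r)"
  using assms unfolding submean_on_def by blast

lemma ereal_integral_eq:
  assumes "set_integrable lborel A g"
  shows "ereal_integral A (\<lambda>x. ereal (g x)) = ereal (LINT x:A|lborel. g x)"
proof -
  let ?f = "\<lambda>x. indicator A x *\<^sub>R g x"
  have i: "integrable lborel ?f"
    using assms unfolding set_integrable_def .
  have e: "(\<integral>\<^sup>+x. ennreal (?f x) \<partial>lborel) = (\<integral>\<^sup>+x\<in>A. e2ennreal (ereal (g x)) \<partial>lborel)"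
    "(\<integral>\<^sup>+x. ennreal (- ?f x) \<partial>lborel) = (\<integral>\<^sup>+x\<in>A. e2ennreal (- ereal (g x)) \<partial>lborel)"
    by (auto intro!: nn_integral_cong simp: indicator_def)
  have fin: "(\<integral>\<^sup>+x. ennreal (?f x) \<partial>lborel) \<noteq> \<infinity>" "(\<integral>\<^sup>+x. ennreal (- ?f x) \<partial>lborel) \<noteq> \<infinity>"
    using i by (auto simp: real_integrable_def)
  have *: "enn2ereal a = ereal (enn2real a)" if "a \<noteq> \<infinity>" for a
    using that by (cases a) auto
  have "(LINT x:A|lborel. g x) = enn2real (\<integral>\<^sup>+x. ennreal (?f x) \<partial>lborel) - enn2real (\<integral>\<^sup>+x. ennreal (- ?f x) \<partial>lborel)"
    unfolding set_lebesgue_integral_def by (rule real_lebesgue_integral_def[OF i])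
  then show ?thesis
    unfolding ereal_integral_def e[symmetric] *[OF fin(1)] *[OF fin(2)] by simp
qed

lemma ereal_integral_mono:
  assumes "\<And>x. x \<in> A \<Longrightarrow> u x \<le> v x"
  shows "ereal_integral A u \<le> ereal_integral A v"
  unfolding ereal_integral_def
proof (rule ereal_minus_mono)
  show "enn2ereal (\<integral>\<^sup>+x\<in>A. e2ennreal (u x) \<partial>lborel) \<le> enn2ereal (\<integral>\<^sup>+x\<in>A. e2ennreal (v x) \<partial>lborel)"
    unfolding less_eq_ennreal.rep_eq[symmetric]
    by (intro nn_integral_mono) (auto simp: indicator_def intro!: e2ennreal_mono assms)
  show "enn2ereal (\<integral>\<^sup>+x\<in>A. e2ennreal (- v x) \<partial>lborel) \<le> enn2ereal (\<integral>\<^sup>+x\<in>A. e2ennreal (- u x) \<partial>lborel)"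
    unfolding less_eq_ennreal.rep_eq[symmetric]
    by (intro nn_integral_mono) (auto simp: indicator_def intro!: e2ennreal_mono assms)
qed

lemma ball_mean_eq_avg:
  assumes "0 < r" "ball_integrable x r g"
  shows "ball_mean (\<lambda>y. ereal (g y)) x r = ereal (avg g x r)"
  unfolding ball_mean_def avg_def using assms by (simp add: ereal_integral_eq)

lemma ball_mean_mono:
  assumes "0 < r" "\<And>y. y \<in> cball x r \<Longrightarrow> u y \<le> v y"
  shows "ball_mean u x r \<le> ball_mean v x r"
  unfolding ball_mean_def using assms
  by (intro ereal_divide_right_mono ereal_integral_mono) auto

lemma subharmonic_imp_submean:
  assumes "u subharmonic_on S"
  shows "submean_on u S"
  unfolding submean_on_def
proof (intro allI impI)
  fix x r and g :: "'a \<Rightarrow> real"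
  assume r: "0 < r" "cball x r \<subseteq> S" and g: "ball_integrable x r g"
    and le: "\<forall>y\<in>cball x r. u y \<le> ereal (g y)"
  have "u x \<le> ball_mean u x r" using assms r unfolding subharmonic_on_def by blast
  also have "\<dots> \<le> ball_mean (\<lambda>y. ereal (g y)) x r"
    by (rule ball_mean_mono) (use r le in auto)
  finally show "u x \<le> ereal (avg g x r)" using ball_mean_eq_avg[OF r(1) g] by simp
qed

lemma set_integrable_cball_cont:
  fixes g :: "'a::euclidean_space \<Rightarrow> real"
  assumes "continuous_on (cball x r) g"
  shows "ball_integrable x r g"
  unfolding set_integrable_def by (rule borel_integrable_compact[OF compact_cball assms])

lemma avg_add:
  assumes "ball_integrable x r f" "ball_integrable x r g"
  shows "avg (\<lambda>y. f y + g y) x r = avg f x r + avg g x r"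
  unfolding avg_def using set_integral_add(2)[OF assms] by (simp add: add_divide_distrib)

lemma avg_diff:
  assumes "ball_integrable x r f" "ball_integrable x r g"
  shows "avg (\<lambda>y. f y - g y) x r = avg f x r - avg g x r"
  unfolding avg_def using set_integral_diff(2)[OF assms] by (simp add: diff_divide_distrib)

lemma avg_cmult: "avg (\<lambda>y. c * f y) x r = c * avg f x r"
  unfolding avg_def by simp

lemma avg_mono:
  assumes "0 < r" "ball_integrable x r f" "ball_integrable x r g"
    and "\<And>y. y \<in> cball x r \<Longrightarrow> f y \<le> g y"
  shows "avg f x r \<le> avg g x r"
  unfolding avg_def by (intro divide_right_mono set_integral_mono assms) auto

lemma measure_cball_pos: "0 < r \<Longrightarrow> 0 < measure lborel (cball (x::'a::euclidean_space) r)"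
  by simp

lemma avg_const: "0 < r \<Longrightarrow> avg (\<lambda>y. c) x r = c"
  using measure_cball_pos[of r x] emeasure_lborel_cball_finite[of x r]
  unfolding avg_def set_lebesgue_integral_def by (simp add: less_top[symmetric])

lemma avg_trans:
  assumes "ball_integrable x r g"
  shows "avg g x r = avg (\<lambda>y. g (x + y)) 0 r"
proof -
  have m: "(\<lambda>y. indicator (cball x r) y *\<^sub>R g y) \<in> borel_measurable borel"
    using assms unfolding set_integrable_def by simp
  have "(LINT y:cball x r|lborel. g y) = (\<integral>y. indicator (cball x r) y *\<^sub>R g y \<partial>distr lborel borel ((+) x))"
    unfolding set_lebesgue_integral_def lborel_distr_plus ..
  also have "\<dots> = (\<integral>y. indicator (cball x r) (x + y) *\<^sub>R g (x + y) \<partial>lborel)"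
    by (subst integral_distr) (use m in auto)
  also have "\<dots> = (LINT y:cball 0 r|lborel. g (x + y))"
    unfolding set_lebesgue_integral_def by (intro Bochner_Integration.integral_cong) (auto simp: indicator_def dist_norm)
  \<comment> \<open>For \<open>r < 0\<close> both balls are empty, so both averages are 0.\<close>
  finally show ?thesis unfolding avg_def using content_cball[of r] by (cases "0 \<le> r") (auto simp: content_cball)
qed

section \<open>Measure-preserving symmetries and the second moments of balls\<close>

lemma avg_inv:
  fixes T :: "'a::euclidean_space \<Rightarrow> 'a"
  assumes T: "T \<in> borel_measurable borel" "distr lborel borel T = lborel" "\<And>y. norm (T y) = norm y"
    and g: "continuous_on UNIV g"
  shows "avg (\<lambda>y. g (T y)) 0 r = avg g 0 r"
proof -
  have m: "g \<in> borel_measurable borel" using g by (simp add: borel_measurable_continuous_onI)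
  have m': "(\<lambda>y. indicator (cball 0 r) y *\<^sub>R g y) \<in> borel_measurable borel"
    by (rule borel_measurable_scaleR[OF borel_measurable_indicator m]) simp
  have "(LINT y:cball 0 r|lborel. g y) = (\<integral>y. indicator (cball 0 r) y *\<^sub>R g y \<partial>distr lborel borel T)"
    unfolding set_lebesgue_integral_def assms(2) ..
  also have "\<dots> = (\<integral>y. indicator (cball 0 r) (T y) *\<^sub>R g (T y) \<partial>lborel)"
    by (subst integral_distr) (use m' T in auto)
  also have "\<dots> = (LINT y:cball 0 r|lborel. g (T y))"
    unfolding set_lebesgue_integral_def
    by (intro Bochner_Integration.integral_cong) (auto simp: indicator_def T)
  finally show ?thesis unfolding avg_def by simp
qed

text \<open>As \<open>i - j\<close> has squared norm 2, \<open>T\<close> is the reflection in its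
  orthogonal hyperplane. It exchanges two coordinates, so it permutes the side lengths of boxes and
  keeps their measure.\<close>

lemma swap_distr:
  fixes i j :: "'a::euclidean_space"
  assumes ij: "i \<in> Basis" "j \<in> Basis" "i \<noteq> j"
  defines "T \<equiv> \<lambda>x. x - (x \<bullet> (i - j)) *\<^sub>R (i - j)"
  shows "T \<in> borel_measurable borel" "distr lborel borel T = lborel" "norm (T y) = norm y"
    "T y \<bullet> i = y \<bullet> j"
proof -
  show meas: "T \<in> borel_measurable borel" unfolding T_def by measurable
  have c: "T y \<bullet> k = y \<bullet> Transposition.transpose i j k" if "k \<in> Basis" for y k
    using that ij by (auto simp: T_def inner_simps inner_Basis Transposition.transpose_def)
  show "T y \<bullet> i = y \<bullet> j" using c[OF ij(1)] by (simp add: Transposition.transpose_def)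
  show "norm (T y) = norm y"
  proof -
    have "(i - j) \<bullet> (i - j) = 2" using ij by (simp add: inner_simps inner_Basis)
    moreover have "(y - c *\<^sub>R d) \<bullet> (y - c *\<^sub>R d) = y \<bullet> y - 2 * c * (y \<bullet> d) + c * c * (d \<bullet> d)" for c and d :: 'a
      by (simp add: inner_diff_left inner_diff_right inner_commute[of d y] algebra_simps)
    ultimately have "T y \<bullet> T y = y \<bullet> y" unfolding T_def by simp
    then show ?thesis by (simp add: norm_eq_sqrt_inner)
  qed
  have bij: "bij_betw (Transposition.transpose i j) Basis Basis"
    by (rule bij_betw_byWitness[where f'="Transposition.transpose i j"]) (use ij in \<open>auto simp: Transposition.transpose_def\<close>)
  show "distr lborel borel T = lborel"
  proof (rule lborel_eqI[symmetric])
    fix l u :: 'a assume le: "\<And>b. b \<in> Basis \<Longrightarrow> l \<bullet> b \<le> u \<bullet> b"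
    have "x \<in> T -` box l u \<longleftrightarrow> x \<in> box (T l) (T u)" for x
    proof -
      have "x \<in> T -` box l u \<longleftrightarrow> (\<forall>k\<in>Basis. l \<bullet> k < x \<bullet> Transposition.transpose i j k \<and> x \<bullet> Transposition.transpose i j k < u \<bullet> k)"
        by (auto simp: mem_box c)
      also have "\<dots> \<longleftrightarrow> (\<forall>k\<in>Basis. l \<bullet> Transposition.transpose i j k < x \<bullet> k \<and> x \<bullet> k < u \<bullet> Transposition.transpose i j k)"
      proof safe
        fix k :: 'a assume "k \<in> Basis"
        then have k: "Transposition.transpose i j k \<in> Basis" using bij_betw_apply[OF bij] by blast
        { assume "\<forall>k\<in>Basis. l \<bullet> k < x \<bullet> Transposition.transpose i j k \<and> x \<bullet> Transposition.transpose i j k < u \<bullet> k"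
          from bspec[OF this k] show "l \<bullet> Transposition.transpose i j k < x \<bullet> k" "x \<bullet> k < u \<bullet> Transposition.transpose i j k" by simp_all }
        { assume "\<forall>k\<in>Basis. l \<bullet> Transposition.transpose i j k < x \<bullet> k \<and> x \<bullet> k < u \<bullet> Transposition.transpose i j k"
          from bspec[OF this k] show "l \<bullet> k < x \<bullet> Transposition.transpose i j k" "x \<bullet> Transposition.transpose i j k < u \<bullet> k" by simp_all }
      qed
      finally show ?thesis by (auto simp: mem_box c)
    qed
    then have eq: "T -` box l u = box (T l) (T u)" by blast
    have le': "T l \<bullet> b \<le> T u \<bullet> b" if "b \<in> Basis" for b
      using that le c bij_betw_apply[OF bij] by simp
    have "emeasure (distr lborel borel T) (box l u) = emeasure lborel (box (T l) (T u))"
      using meas by (subst emeasure_distr) (auto simp: eq)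
    also have "\<dots> = ennreal (\<Prod>b\<in>Basis. (T u - T l) \<bullet> b)"
      using le' by (subst emeasure_lborel_box) auto
    also have "(\<Prod>b\<in>Basis. (T u - T l) \<bullet> b) = (\<Prod>b\<in>Basis. (u - l) \<bullet> Transposition.transpose i j b)"
      by (intro prod.cong) (auto simp: inner_diff_left c)
    also have "\<dots> = (\<Prod>b\<in>Basis. (u - l) \<bullet> b)"
      by (rule prod.reindex_bij_betw[OF bij])
    finally show "emeasure (distr lborel borel T) (box l u) = ennreal (\<Prod>b\<in>Basis. (u - l) \<bullet> b)"
      by simp
  qed simp
qed

text \<open>The sign change of one coordinate. It preserves Lebesgue measure because its diagonal
  entries have modulus 1, and it makes all moments odd in that coordinate vanish.\<close>

lemma reflect_distr:
  fixes i :: "'a::euclidean_space"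
  assumes i: "i \<in> Basis"
  defines "T \<equiv> \<lambda>x. x - (2 * (x \<bullet> i)) *\<^sub>R i"
  shows "T \<in> borel_measurable borel" "distr lborel borel T = lborel" "norm (T y) = norm y"
    "T y \<bullet> i = - (y \<bullet> i)" "j \<in> Basis \<Longrightarrow> j \<noteq> i \<Longrightarrow> T y \<bullet> j = y \<bullet> j"
proof -
  show meas: "T \<in> borel_measurable borel" unfolding T_def by measurable
  show "T y \<bullet> i = - (y \<bullet> i)" "j \<in> Basis \<Longrightarrow> j \<noteq> i \<Longrightarrow> T y \<bullet> j = y \<bullet> j"
    using i by (auto simp: T_def inner_simps inner_Basis)
  have "(y - c *\<^sub>R d) \<bullet> (y - c *\<^sub>R d) = y \<bullet> y - 2 * c * (y \<bullet> d) + c * c * (d \<bullet> d)" for c and d :: 'a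
    by (simp add: inner_diff_left inner_diff_right inner_commute[of d y] algebra_simps)
  then have "T y \<bullet> T y = y \<bullet> y" unfolding T_def using i by simp
  then show "norm (T y) = norm y" by (simp add: norm_eq_sqrt_inner)
  let ?c = "\<lambda>j. if j = i then - 1 else (1::real)"
  have "T x = 0 + (\<Sum>j\<in>Basis. (?c j * (x \<bullet> j)) *\<^sub>R j)" for x
    by (rule euclidean_eqI)
      (use i in \<open>auto simp: T_def inner_simps inner_Basis inner_sum_left if_distrib sum.delta cong: if_cong\<close>)
  then have "lborel = density (distr lborel borel T) (\<lambda>_. (\<Prod>j\<in>Basis. \<bar>?c j\<bar>))"
    using lborel_affine_euclidean[of ?c 0] by (simp add: fun_eq_iff[symmetric] cong: distr_cong)
  also have "(\<Prod>j\<in>(Basis::'a set). \<bar>?c j\<bar>) = 1" by (intro prod.neutral) auto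
  finally show "distr lborel borel T = lborel" by (simp add: density_1)
qed

text \<open>The mean square of a single coordinate over a ball of radius \<open>s\<close>. In
  dimension \<open>N\<close> its exact value is \<open>s\<^sup>2 / (N + 2)\<close>; bounds of the
  order of \<open>s\<^sup>2\<close> are enough later on.\<close>

definition msq :: "'a::euclidean_space itself \<Rightarrow> real \<Rightarrow> real" where
  "msq _ s = avg (\<lambda>y::'a. (norm y)\<^sup>2) 0 s / DIM('a)"

lemma integrable_cball_UNIV:
  fixes g :: "'a::euclidean_space \<Rightarrow> real"
  assumes "continuous_on UNIV g"
  shows "ball_integrable x r g"
  using assms continuous_on_subset by (blast intro: set_integrable_cball_cont)

lemma set_integrable_sum:
  fixes g :: "'b \<Rightarrow> 'a::euclidean_space \<Rightarrow> real"
  assumes "\<And>i. i \<in> I \<Longrightarrow> set_integrable lborel A (g i)"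
  shows "set_integrable lborel A (\<lambda>y. \<Sum>i\<in>I. g i y)"
  using assms unfolding set_integrable_def by (simp add: sum_distrib_left)

lemma avg_sum_integrable:
  fixes g :: "'b \<Rightarrow> 'a::euclidean_space \<Rightarrow> real"
  assumes "finite I" "\<And>i. i \<in> I \<Longrightarrow> ball_integrable x r (g i)" "0 < r"
  shows "avg (\<lambda>y. \<Sum>i\<in>I. g i y) x r = (\<Sum>i\<in>I. avg (g i) x r)"
  using assms(1,2)
proof (induction I)
  case empty then show ?case using avg_const[OF assms(3), of 0] by simp
next
  case (insert a I)
  have "avg (\<lambda>y. g a y + (\<Sum>i\<in>I. g i y)) x r = avg (g a) x r + avg (\<lambda>y. \<Sum>i\<in>I. g i y) x r"
    by (intro avg_add set_integrable_sum) (use insert in auto)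
  then show ?case using insert by simp
qed

lemma avg_sum:
  fixes g :: "'b \<Rightarrow> 'a::euclidean_space \<Rightarrow> real"
  assumes "finite I" "\<And>i. i \<in> I \<Longrightarrow> continuous_on UNIV (g i)" "0 < r"
  shows "avg (\<lambda>y. \<Sum>i\<in>I. g i y) x r = (\<Sum>i\<in>I. avg (g i) x r)"
  using assms by (intro avg_sum_integrable integrable_cball_UNIV) auto

lemma avg_coord_sq:
  fixes i :: "'a::euclidean_space"
  assumes "i \<in> Basis" "0 < s"
  shows "avg (\<lambda>y::'a. (y \<bullet> i) * (y \<bullet> i)) 0 s = msq TYPE('a) s"
proof -
  have eq: "avg (\<lambda>y::'a. (y \<bullet> j) * (y \<bullet> j)) 0 s = avg (\<lambda>y::'a. (y \<bullet> i) * (y \<bullet> i)) 0 s" if "j \<in> Basis" for j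
  proof (cases "i = j")
    case False
    note T = swap_distr[OF assms(1) that False]
    show ?thesis using avg_inv[OF T(1-3), of "\<lambda>y. (y \<bullet> i) * (y \<bullet> i)" s]
      unfolding T(4) by (simp add: continuous_intros)
  qed simp
  have "avg (\<lambda>y::'a. (norm y)\<^sup>2) 0 s = avg (\<lambda>y::'a. \<Sum>j\<in>Basis. (y \<bullet> j) * (y \<bullet> j)) 0 s"
    by (simp add: power2_norm_eq_inner) (subst euclidean_inner, rule refl)
  also have "\<dots> = (\<Sum>j\<in>(Basis::'a set). avg (\<lambda>y::'a. (y \<bullet> j) * (y \<bullet> j)) 0 s)"
    by (intro avg_sum) (auto intro!: continuous_intros assms)
  also have "\<dots> = DIM('a) * avg (\<lambda>y::'a. (y \<bullet> i) * (y \<bullet> i)) 0 s" using eq by simp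
  finally show ?thesis unfolding msq_def by simp
qed

lemma avg_coord_cross:
  fixes i :: "'a::euclidean_space"
  assumes "i \<in> Basis" "j \<in> Basis" "i \<noteq> j"
  shows "avg (\<lambda>y::'a. (y \<bullet> i) * (y \<bullet> j)) 0 s = 0"
proof -
  note T = reflect_distr[OF assms(1)]
  have "avg (\<lambda>y::'a. - 1 * ((y \<bullet> i) * (y \<bullet> j))) 0 s = avg (\<lambda>y::'a. (y \<bullet> i) * (y \<bullet> j)) 0 s"
    using avg_inv[OF T(1-3), of "\<lambda>y. (y \<bullet> i) * (y \<bullet> j)" s] assms
    unfolding T(4) by (simp add: T(5) continuous_intros)
  then show ?thesis unfolding avg_cmult by simp
qed

lemma avg_coord:
  fixes i :: "'a::euclidean_space"
  assumes "i \<in> Basis"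
  shows "avg (\<lambda>y::'a. y \<bullet> i) 0 s = 0"
proof -
  note T = reflect_distr[OF assms(1)]
  have "avg (\<lambda>y::'a. - 1 * (y \<bullet> i)) 0 s = avg (\<lambda>y::'a. y \<bullet> i) 0 s"
    using avg_inv[OF T(1-3), of "\<lambda>y. y \<bullet> i" s] assms
    unfolding T(4) by (simp add: continuous_intros)
  then show ?thesis unfolding avg_cmult by simp
qed

lemma avg_inner:
  fixes a :: "'a::euclidean_space"
  assumes "0 < s"
  shows "avg (\<lambda>y::'a. a \<bullet> y) 0 s = 0"
proof -
  have "avg (\<lambda>y::'a. a \<bullet> y) 0 s = avg (\<lambda>y::'a. \<Sum>i\<in>Basis. (a \<bullet> i) * (y \<bullet> i)) 0 s"
    by (subst euclidean_inner, rule refl)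
  also have "\<dots> = (\<Sum>i\<in>Basis. avg (\<lambda>y::'a. (a \<bullet> i) * (y \<bullet> i)) 0 s)"
    by (intro avg_sum) (auto intro!: continuous_intros assms)
  also have "\<dots> = 0" by (simp add: avg_cmult avg_coord)
  finally show ?thesis .
qed

text \<open>Reflections kill the mixed moments and swaps make the pure ones equal, so only the trace
  of the form survives. This is the substitute for the Laplacian throughout.\<close>

lemma avg_quadratic:
  fixes B :: "'a::euclidean_space \<Rightarrow> 'a \<Rightarrow> real"
  assumes "bounded_bilinear B" "0 < s"
  shows "avg (\<lambda>y. B y y) 0 s = msq TYPE('a) s * (\<Sum>i\<in>Basis. B i i)"
proof -
  interpret bounded_bilinear B by fact
  have "B y y = (\<Sum>i\<in>Basis. \<Sum>j\<in>Basis. B i j * ((y \<bullet> i) * (y \<bullet> j)))" for y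
  proof -
    have "B y y = B (\<Sum>i\<in>Basis. (y \<bullet> i) *\<^sub>R i) (\<Sum>j\<in>Basis. (y \<bullet> j) *\<^sub>R j)"
      by (simp add: euclidean_representation)
    also have "\<dots> = (\<Sum>i\<in>Basis. \<Sum>j\<in>Basis. B i j * ((y \<bullet> i) * (y \<bullet> j)))"
      by (simp only: sum_left) (simp only: sum_right scaleR_left scaleR_right real_scaleR_def mult_ac)
    finally show ?thesis .
  qed
  then have "avg (\<lambda>y. B y y) 0 s = avg (\<lambda>y. \<Sum>i\<in>Basis. \<Sum>j\<in>Basis. B i j * ((y \<bullet> i) * (y \<bullet> j))) 0 s"
    by simp
  also have "\<dots> = (\<Sum>i\<in>Basis. avg (\<lambda>y. \<Sum>j\<in>Basis. B i j * ((y \<bullet> i) * (y \<bullet> j))) 0 s)"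
    by (intro avg_sum) (auto intro!: continuous_intros assms)
  also have "\<dots> = (\<Sum>i\<in>Basis. \<Sum>j\<in>Basis. avg (\<lambda>y. B i j * ((y \<bullet> i) * (y \<bullet> j))) 0 s)"
    by (intro sum.cong avg_sum) (auto intro!: continuous_intros assms)
  also have "\<dots> = (\<Sum>i\<in>Basis. \<Sum>j\<in>Basis. if i = j then B i i * msq TYPE('a) s else 0)"
    unfolding avg_cmult by (intro sum.cong) (auto simp: avg_coord_sq avg_coord_cross assms)
  also have "\<dots> = msq TYPE('a) s * (\<Sum>i\<in>Basis. B i i)"
    by (simp add: sum_distrib_left mult.commute)
  finally show ?thesis .
qed

lemma msq_upper: "0 < s \<Longrightarrow> msq TYPE('a::euclidean_space) s \<le> s\<^sup>2"
proof -
  assume s: "0 < s"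
  have "avg (\<lambda>y::'a. (norm y)\<^sup>2) 0 s \<le> avg (\<lambda>y::'a. s\<^sup>2) 0 s"
    by (intro avg_mono set_integrable_cball_cont continuous_intros s) (auto intro!: power_mono)
  also have "\<dots> = s\<^sup>2" by (rule avg_const[OF s])
  finally have "avg (\<lambda>y::'a. (norm y)\<^sup>2) 0 s \<le> s\<^sup>2" .
  moreover have "0 \<le> s\<^sup>2" "1 \<le> real DIM('a)" by auto
  ultimately show ?thesis unfolding msq_def
    by (smt (verit, best) divide_le_eq mult_le_cancel_left1)
qed

lemma avg_indicator_ball:
  fixes c x :: "'a::euclidean_space"
  assumes "0 < s" "0 < t" "cball c t \<subseteq> cball x s"
  shows "avg (indicator (cball c t)) x s = (t / s) ^ DIM('a)"
    "ball_integrable x s (indicator (cball c t) :: 'a \<Rightarrow> real)"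
proof -
  have e: "(\<lambda>y. indicator (cball x s) y *\<^sub>R (indicator (cball c t) y :: real)) = indicator (cball c t)"
    using assms(3) by (auto simp: indicator_def fun_eq_iff)
  show "ball_integrable x s (indicator (cball c t) :: 'a \<Rightarrow> real)"
    unfolding set_integrable_def e
    by (rule integrable_real_indicator) (use emeasure_lborel_cball_finite[of c t] in auto)
  have "unit_ball_vol (DIM('a)) > 0" by simp
  then show "avg (indicator (cball c t)) x s = (t / s) ^ DIM('a)"
    unfolding avg_def set_lebesgue_integral_def e
    using assms by (simp add: content_cball power_divide less_imp_neq[THEN not_sym])
qed

text \<open>The inner half ball fills at most half of the volume, and outside it
  \<open>(norm y)\<^sup>2\<close> is at least \<open>s\<^sup>2 / 4\<close>.\<close>

lemma msq_lower: "0 < s \<Longrightarrow> s\<^sup>2 / (8 * DIM('a)) \<le> msq TYPE('a::euclidean_space) s"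
proof -
  assume s: "0 < s"
  let ?h = "\<lambda>y::'a. s\<^sup>2 / 4 * (1 - indicator (cball 0 (s/2)) y)"
  have sub: "cball 0 (s/2) \<subseteq> cball (0::'a) s" using s by auto
  note I = avg_indicator_ball[OF s _ sub]
  have i1: "ball_integrable (0::'a) s (\<lambda>y. 1::real)"
    by (intro set_integrable_cball_cont continuous_intros)
  have "avg ?h 0 s = s\<^sup>2 / 4 * (1 - (1/2) ^ DIM('a))"
    unfolding avg_cmult using s
    by (subst avg_diff[OF i1 I(2)]) (auto simp: avg_const I(1))
  moreover have "(1/2::real) ^ DIM('a) \<le> (1/2)^1"
    by (rule power_decreasing) auto
  moreover from this have "s\<^sup>2/4 * (1/2) \<le> s\<^sup>2/4 * (1 - (1/2::real) ^ DIM('a))"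
    by (intro mult_left_mono) auto
  ultimately have "s\<^sup>2 / 8 \<le> avg ?h 0 s" by linarith
  also have "\<dots> \<le> avg (\<lambda>y::'a. (norm y)\<^sup>2) 0 s"
  proof (intro avg_mono s)
    show "ball_integrable 0 s ?h"
      using set_integral_diff(1)[OF i1 I(2)] s by (intro set_integrable_mult_right) auto
    show "ball_integrable (0::'a) s (\<lambda>y. (norm y)\<^sup>2)"
      by (intro set_integrable_cball_cont continuous_intros)
    fix y :: 'a
    show "?h y \<le> (norm y)\<^sup>2"
    proof (cases "norm y \<le> s/2")
      case True then show ?thesis by simp
    next
      case False
      then have "(s/2)\<^sup>2 \<le> (norm y)\<^sup>2" using s by (intro power_mono) auto
      then show ?thesis using False by (simp add: power2_eq_square)
    qed
  qed
  finally show ?thesis unfolding msq_def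
    by (simp add: field_simps)
qed

lemma msq_pos: "0 < s \<Longrightarrow> 0 < msq TYPE('a::euclidean_space) s"
  using msq_lower[where 'a='a, of s] by (rule less_le_trans[rotated]) simp_all

section \<open>Semicontinuous functions\<close>

lemma usc_on_iff:
  "usc_on S u \<longleftrightarrow> (\<forall>x\<in>S. \<forall>c. u x < c \<longrightarrow> (\<forall>\<^sub>F y in at x within S. u y < c))"
  unfolding usc_on_def by (simp add: Limsup_le_iff)

lemma usc_onD: "usc_on S u \<Longrightarrow> x \<in> S \<Longrightarrow> u x < c \<Longrightarrow> \<forall>\<^sub>F y in at x within S. u y < c"
  unfolding usc_on_iff by blast

lemma usc_onD':
  fixes u :: "'a::metric_space \<Rightarrow> ereal"
  assumes "usc_on S u" "x \<in> S" "u x < c"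
  shows "\<exists>d>0. \<forall>y\<in>S. dist y x < d \<longrightarrow> u y < c"
  using usc_onD[OF assms] assms(3) unfolding eventually_at by metis

lemma usc_on_subset: "usc_on S u \<Longrightarrow> T \<subseteq> S \<Longrightarrow> usc_on T u"
  unfolding usc_on_iff by (meson eventually_at_filter at_le filter_leD subsetD)

lemma usc_on_add:
  fixes u :: "'a::topological_space \<Rightarrow> ereal" and h :: "'a \<Rightarrow> real"
  assumes u: "usc_on S u" and h: "continuous_on S h"
  shows "usc_on S (\<lambda>y. u y + ereal (h y))"
  unfolding usc_on_iff
proof (intro ballI allI impI)
  fix x c assume x: "x \<in> S" and c: "u x + ereal (h x) < c"
  obtain c' where c': "u x + ereal (h x) < ereal c'" "ereal c' < c"
    using ereal_dense2[OF c] by blast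
  have "u x < ereal (c' - h x)" using c'(1) by (cases "u x") auto
  then obtain d where d: "u x < ereal d" "ereal d < ereal (c' - h x)"
    using ereal_dense2 by blast
  have "\<forall>\<^sub>F y in at x within S. u y < ereal d" by (rule usc_onD[OF u x d(1)])
  moreover have "\<forall>\<^sub>F y in at x within S. h y < c' - d"
    using h x d(2) by (intro order_tendstoD(2)[of h "h x"]) (auto simp: continuous_on_def)
  ultimately show "\<forall>\<^sub>F y in at x within S. u y + ereal (h y) < c"
  proof eventually_elim
    case (elim y)
    have "u y + ereal (h y) < ereal c'" using elim by (cases "u y") auto
    then show ?case using c'(2) by order
  qed
qed

lemma usc_on_closed_superlevel:
  fixes u :: "'a::metric_space \<Rightarrow> ereal"
  assumes "usc_on S u" "closed S"
  shows "closed {x\<in>S. c \<le> u x}"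
  unfolding closed_sequential_limits
proof (intro allI impI, elim conjE)
  fix X l assume X: "\<forall>n. X n \<in> {x\<in>S. c \<le> u x}" and l: "X \<longlonglongrightarrow> l"
  have lS: "l \<in> S" using X l assms(2) closed_sequentially by blast
  have "\<not> u l < c"
  proof
    assume "u l < c"
    then obtain d where d: "d > 0" "\<forall>y\<in>S. dist y l < d \<longrightarrow> u y < c"
      using usc_onD'[OF assms(1) lS] by blast
    obtain n where "dist (X n) l < d" using metric_LIMSEQ_D[OF l d(1)] by blast
    then show False using d(2) X by (metis (mono_tags, lifting) leD mem_Collect_eq)
  qed
  then show "l \<in> {x\<in>S. c \<le> u x}" using lS by auto
qed

lemma usc_on_open_sublevel:
  fixes u :: "'a::metric_space \<Rightarrow> ereal"
  assumes u: "usc_on S u" and S: "open S"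
  shows "open {x\<in>S. u x < c}"
proof (subst open_dist, intro ballI)
  fix x assume "x \<in> {x\<in>S. u x < c}"
  then have x: "x \<in> S" "u x < c" by auto
  obtain d1 where d1: "d1 > 0" "\<forall>y\<in>S. dist y x < d1 \<longrightarrow> u y < c" using usc_onD'[OF u x] by blast
  obtain d2 where d2: "d2 > 0" "\<forall>y. dist y x < d2 \<longrightarrow> y \<in> S" using S x(1) unfolding open_dist by blast
  show "\<exists>e>0. \<forall>y. dist y x < e \<longrightarrow> y \<in> {x\<in>S. u x < c}"
    using d1 d2 by (intro exI[of _ "min d1 d2"]) auto
qed

lemma usc_on_compose:
  fixes u :: "'b::metric_space \<Rightarrow> ereal" and f :: "'a::metric_space \<Rightarrow> 'b"
  assumes u: "usc_on T u" and f: "continuous_on S f" "\<And>x. x \<in> S \<Longrightarrow> f x \<in> T"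
  shows "usc_on S (\<lambda>x. u (f x))"
  unfolding usc_on_iff
proof (intro ballI allI impI)
  fix x c assume x: "x \<in> S" and c: "u (f x) < c"
  obtain d where d: "d > 0" "\<forall>y\<in>T. dist y (f x) < d \<longrightarrow> u y < c" using usc_onD'[OF u f(2)[OF x] c] by blast
  have "\<forall>\<^sub>F y in at x within S. dist (f y) (f x) < d"
    using f(1) x d(1) by (intro tendstoD) (auto simp: continuous_on_def)
  moreover have "\<forall>\<^sub>F y in at x within S. y \<in> S" by (simp add: eventually_at_filter)
  ultimately show "\<forall>\<^sub>F y in at x within S. u (f y) < c"
    by eventually_elim (use d(2) f(2) in blast)
qed

text \<open>The superlevel sets at attained values are closed and have the finite intersection
  property; a common point is a maximum point.\<close>

lemma usc_attains_max:
  fixes u :: "'a::metric_space \<Rightarrow> ereal"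
  assumes "usc_on S u" "compact S" "S \<noteq> {}"
  shows "\<exists>x\<in>S. \<forall>y\<in>S. u y \<le> u x"
proof -
  have "S \<inter> \<Inter> ((\<lambda>c. {x\<in>S. c \<le> u x}) ` {u y | y. y \<in> S}) \<noteq> {}"
  proof (rule compact_imp_fip_image[OF assms(2)])
    fix c assume "c \<in> {u y | y. y \<in> S}"
    show "closed {x\<in>S. c \<le> u x}"
      by (rule usc_on_closed_superlevel[OF assms(1) compact_imp_closed[OF assms(2)]])
  next
    fix I assume I: "finite I" "I \<subseteq> {u y | y. y \<in> S}"
    show "S \<inter> \<Inter> ((\<lambda>c. {x\<in>S. c \<le> u x}) ` I) \<noteq> {}"
    proof (cases "I = {}")
      case False
      then obtain y where "y \<in> S" "Max I = u y" using Max_in[OF I(1)] I(2) by blast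
      then have "y \<in> S \<inter> \<Inter> ((\<lambda>c. {x\<in>S. c \<le> u x}) ` I)" using I(1) Max_ge by fastforce
      then show ?thesis by blast
    qed (use assms in auto)
  qed
  then show ?thesis by blast
qed

text \<open>The contact point maximizes \<open>u - h\<close>. The point \<open>z\<close> keeps this
  maximum from being -\<infinity>.\<close>

lemma usc_touch:
  fixes u :: "'a::metric_space \<Rightarrow> ereal" and h :: "'a \<Rightarrow> real"
  assumes "usc_on S u" "compact S" "continuous_on S h" "z \<in> S" "u z \<noteq> - \<infinity>"
    and "\<And>y. y \<in> S \<Longrightarrow> u y < \<infinity>"
  shows "\<exists>x\<in>S. \<bar>u x\<bar> \<noteq> \<infinity> \<and> (\<forall>y\<in>S. u y \<le> u x + ereal (h y - h x))"
proof -
  have "\<exists>x\<in>S. \<forall>y\<in>S. u y + ereal (- h y) \<le> u x + ereal (- h x)"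
    by (rule usc_attains_max[OF usc_on_add]) (use assms in \<open>auto intro!: continuous_intros\<close>)
  then obtain x where x: "x \<in> S" "\<forall>y\<in>S. u y + ereal (- h y) \<le> u x + ereal (- h x)" by blast
  have ux: "\<bar>u x\<bar> \<noteq> \<infinity>"
    using x(2)[rule_format, OF assms(4)] assms(5) assms(6)[OF x(1)] assms(6)[OF assms(4)]
    by (cases "u x"; cases "u z") auto
  have "u y \<le> u x + ereal (h y - h x)" if "y \<in> S" for y
    using x(2)[rule_format, OF that] ux by (cases "u x"; cases "u y") auto
  then show ?thesis using x(1) ux by (intro bexI[of _ x]) auto
qed

section \<open>Contact with paraboloids\<close>

lemma submean_on_subset: "submean_on u S \<Longrightarrow> T \<subseteq> S \<Longrightarrow> submean_on u T"
  unfolding submean_on_def by blast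

locale quad =
  fixes B :: "'a::euclidean_space \<Rightarrow> 'a \<Rightarrow> real"
  assumes bilinear: "bounded_bilinear B" and sym: "B x y = B y x"
begin

sublocale B: bounded_bilinear B by (rule bilinear)

definition tr :: real where "tr = (\<Sum>i\<in>Basis. B i i)"

text \<open>The matrix of \<open>B\<close> applied to \<open>x\<close>, so that
  \<open>2 *\<^sub>R bv x\<close> is the gradient of the quadratic form at \<open>x\<close>.\<close>

definition bv :: "'a \<Rightarrow> 'a" where "bv x = (\<Sum>i\<in>Basis. B i x *\<^sub>R i)"

lemma inner_bv: "h \<bullet> bv x = B h x"
proof -
  have "B h x = B (\<Sum>i\<in>Basis. (h \<bullet> i) *\<^sub>R i) x" by (simp add: euclidean_representation)
  also have "\<dots> = h \<bullet> bv x"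
    by (simp only: B.sum_left) (simp add: bv_def inner_sum_right B.scaleR_left mult.commute)
  finally show ?thesis by simp
qed

lemma bv_diff: "bv (x - y) = bv x - bv y"
  by (simp add: bv_def B.diff_right scaleR_diff_left sum_subtractf)

lemma quad_add: "B (x + y) (x + y) = B x x + 2 * B x y + B y y"
  by (simp add: B.add_left B.add_right sym[of y x])

lemma quad_diff: "B (x - y) (x - y) = B x x - 2 * B x y + B y y"
  by (simp add: B.diff_left B.diff_right sym[of y x])

lemma continuous_quad [continuous_intros]:
  "continuous_on S f \<Longrightarrow> continuous_on S g \<Longrightarrow> continuous_on S (\<lambda>y. B (f y) (g y))"
  by (rule B.continuous_on)

lemma avg_quad:
  assumes "0 < s"
  shows "avg (\<lambda>y. c + g \<bullet> (y - x) + B (y - x) (y - x)) x s = c + msq TYPE('a) s * tr"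
proof -
  have i: "ball_integrable x s f" if "continuous_on UNIV f" for f :: "'a \<Rightarrow> real" and x
    using that by (rule integrable_cball_UNIV)
  have "avg (\<lambda>y. c + g \<bullet> (y - x) + B (y - x) (y - x)) x s = avg (\<lambda>y. (c + g \<bullet> y) + B y y) 0 s"
    by (subst avg_trans) (auto intro!: i continuous_intros)
  also have "\<dots> = (avg (\<lambda>y::'a. c) 0 s + avg (\<lambda>y. g \<bullet> y) 0 s) + avg (\<lambda>y. B y y) 0 s"
    by (simp add: avg_add i continuous_intros)
  finally show ?thesis using avg_quadratic[OF bilinear assms] assms
    by (simp add: avg_const avg_inner tr_def)
qed

lemma msq_tr: "0 < s \<Longrightarrow> msq TYPE('a) s * tr \<le> \<bar>tr\<bar> * s\<^sup>2"
proof -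
  assume s: "0 < s"
  have "0 \<le> msq TYPE('a) s" using msq_lower[OF s, where 'a='a]
    by (smt (verit) divide_nonneg_nonneg mult_nonneg_nonneg of_nat_0_le_iff zero_le_power2)
  then have "msq TYPE('a) s * tr \<le> msq TYPE('a) s * \<bar>tr\<bar>" by (intro mult_left_mono) auto
  also have "\<dots> \<le> s\<^sup>2 * \<bar>tr\<bar>" using msq_upper[OF s, where 'a='a] by (intro mult_right_mono) auto
  finally show ?thesis by (simp add: mult.commute)
qed

end

section \<open>Contact points and their slopes\<close>

locale contact = quad +
  fixes u :: "'a \<Rightarrow> ereal" and z0 :: 'a and R :: real
  assumes submean: "submean_on u (cball z0 R)"
    and usc: "usc_on (cball z0 R) u"
    and lt_top: "y \<in> cball z0 R \<Longrightarrow> u y < \<infinity>"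
    and R: "0 < R"
begin

text \<open>The default value of \<open>real_of_ereal\<close> at infinite arguments does no harm:
  \<open>x\<close> is always a contact point, where \<open>u\<close> is finite.\<close>

abbreviation par :: "'a \<Rightarrow> 'a \<Rightarrow> 'a \<Rightarrow> real" where
  "par x g y \<equiv> real_of_ereal (u x) + g \<bullet> (y - x) + B (y - x) (y - x)"

definition touches :: "'a \<Rightarrow> 'a \<Rightarrow> bool" where
  "touches x g \<longleftrightarrow> \<bar>u x\<bar> \<noteq> \<infinity> \<and> (\<forall>y\<in>cball z0 R. u y \<le> u x + ereal (g \<bullet> (y - x) + B (y - x) (y - x)))"

text \<open>The radius \<open>R/8\<close> leaves room for the balls around contact points used
  later, whose radius is at most \<open>R/2\<close>.\<close>

definition K :: "'a set" where
  "K = {x \<in> cball z0 (R/8). \<exists>g. touches x g}"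

lemma touches_le:
  assumes "touches x g" "y \<in> cball z0 R"
  shows "u y \<le> ereal (par x g y)"
  using assms unfolding touches_def by (cases "u x") (auto simp: add.assoc)

text \<open>Lowering the paraboloid by \<open>a\<close> on the small ball still gives a majorant of
  \<open>u\<close>. Its mean must not fall below \<open>u x\<close>, whereas the mean of the
  paraboloid exceeds \<open>u x\<close> by at most \<bar>tr\<bar> \<open>s\<^sup>2\<close>.\<close>

lemma touches_avg:
  assumes c: "touches x g" and s: "0 < s" "cball x s \<subseteq> cball z0 R" and t: "0 < t" "cball d t \<subseteq> cball x s"
    and le: "\<And>y. y \<in> cball d t \<Longrightarrow>
      u y \<le> ereal (par x g y - a)"
  shows "a * (t / s) ^ DIM('a) \<le> \<bar>tr\<bar> * s\<^sup>2"
proof -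
  let ?q = "\<lambda>y. par x g y"
  have q: "ball_integrable x s ?q"
    by (intro integrable_cball_UNIV continuous_intros)
  note I = avg_indicator_ball[OF s(1) t]
  have i: "ball_integrable x s (\<lambda>y. a * indicator (cball d t) y)"
    using I(2) by (intro set_integrable_mult_right) auto
  have "u x \<le> ereal (avg (\<lambda>y. ?q y - a * indicator (cball d t) y) x s)"
  proof (rule submean_onD[OF submean s])
    show "ball_integrable x s (\<lambda>y. ?q y - a * indicator (cball d t) y)"
      by (rule set_integral_diff[OF q i])
    fix y assume "y \<in> cball x s"
    then show "u y \<le> ereal (?q y - a * indicator (cball d t) y)"
      using touches_le[OF c, of y] le[of y] s(2) by (cases "y \<in> cball d t") auto
  qed
  also have "avg (\<lambda>y. ?q y - a * indicator (cball d t) y) x s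
      = real_of_ereal (u x) + msq TYPE('a) s * tr - a * (t / s) ^ DIM('a)"
    by (subst avg_diff[OF q i]) (simp add: avg_quad[OF s(1)] avg_cmult I(1))
  finally have "a * (t / s) ^ DIM('a) \<le> msq TYPE('a) s * tr"
    using c unfolding touches_def by (cases "u x") auto
  then show ?thesis using msq_tr[OF s(1)] by linarith
qed

text \<open>The volume ratio of balls of radii \<open>r/4\<close> and \<open>2*r\<close> gives
  \<open>8 ^ DIM('a)\<close>; the factor 16 collects \<open>(2*r)\<^sup>2\<close> and the quarter in
  the drop \<open>norm d * r / 4\<close>.\<close>

definition lip_const :: real where "lip_const = 16 * 8 ^ DIM('a) * \<bar>tr\<bar>"

lemma lip_const_nonneg: "0 \<le> lip_const" unfolding lip_const_def by simp

text \<open>The two paraboloids share their quadratic part, so their difference is affine with slope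
  \<open>d\<close>, and it is nonnegative at \<open>x'\<close>, where \<open>u\<close> meets the
  second one. Going from \<open>x'\<close> a distance \<open>r/2\<close> in the direction of
  \<open>d\<close>, one finds a ball on which \<open>u\<close> lies below the first paraboloid by
  \<open>norm d * r / 4\<close>, and \<open>touches_avg\<close> limits such a drop. Keeping
  \<open>r\<close> apart from \<open>dist x x'\<close> admits \<open>x = x'\<close>.\<close>

lemma touches_lipschitz_aux:
  assumes c: "touches x g" "touches x' g'" and x: "x \<in> cball z0 (R/8)" "x' \<in> cball z0 (R/8)"
    and r: "0 < r" "dist x x' \<le> r" "r \<le> R/4"
  shows "norm ((g - 2 *\<^sub>R bv x) - (g' - 2 *\<^sub>R bv x')) \<le> lip_const * r"
proof -
  define d where "d = (g - 2 *\<^sub>R bv x) - (g' - 2 *\<^sub>R bv x')"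
  show ?thesis unfolding d_def[symmetric]
  proof (cases "d = 0")
    case True then show "norm d \<le> lip_const * r" using lip_const_nonneg r by simp
  next
    case False
    define e where "e = (1 / norm d) *\<^sub>R d"
    have e: "norm e = 1" "d \<bullet> e = norm d" using False by (auto simp: e_def power2_norm_eq_inner[symmetric] power2_eq_square)
    define D where "D = cball (x' + (r/2) *\<^sub>R e) (r/4)"
    have h: "norm d * r / 4 \<le> d \<bullet> (y - x')" "dist x' y \<le> r" if "y \<in> D" for y
    proof -
      define k where "k = y - (x' + (r/2) *\<^sub>R e)"
      have k: "norm k \<le> r/4" using that unfolding D_def k_def by (simp add: dist_norm norm_minus_commute)
      have yk: "y - x' = (r/2) *\<^sub>R e + k" by (simp add: k_def)
      have "- (norm d * (r/4)) \<le> d \<bullet> k"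
        using Cauchy_Schwarz_ineq2[of d k] mult_left_mono[OF k, of "norm d"] by auto
      then show "norm d * r / 4 \<le> d \<bullet> (y - x')" unfolding yk by (simp add: inner_add_right e field_simps)
      have "norm (y - x') \<le> norm ((r/2) *\<^sub>R e) + norm k" unfolding yk by (rule norm_triangle_ineq)
      then show "dist x' y \<le> r" using k e r by (simp add: dist_norm norm_minus_commute)
    qed
    have sub: "cball x (2*r) \<subseteq> cball z0 R"
    proof
      fix y assume "y \<in> cball x (2*r)"
      then show "y \<in> cball z0 R" using x r dist_triangle[of z0 y x] by auto
    qed
    have Dsub: "D \<subseteq> cball x (2*r)"
    proof
      fix y assume "y \<in> D"
      then show "y \<in> cball x (2*r)" using h(2)[of y] r dist_triangle[of x y x'] by auto
    qed
    have "(norm d * r / 4) * ((r/4) / (2*r)) ^ DIM('a) \<le> \<bar>tr\<bar> * (2*r)\<^sup>2"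
    proof (rule touches_avg[OF c(1) _ sub _ Dsub[unfolded D_def]])
      fix y assume "y \<in> cball (x' + (r/2) *\<^sub>R e) (r/4)"
      then have y: "y \<in> D" by (simp add: D_def)
      have yz: "y \<in> cball z0 R" using y Dsub sub by blast
      have x'z: "x' \<in> cball z0 R" using x R by auto
      obtain a where a: "u x = ereal a" using c(1) unfolding touches_def by (cases "u x") auto
      obtain a' where a': "u x' = ereal a'" using c(2) unfolding touches_def by (cases "u x'") auto
      have 1: "u y \<le> ereal (a' + g' \<bullet> (y - x') + B (y - x') (y - x'))"
        using touches_le[OF c(2) yz] a' by simp
      have 2: "a' \<le> a + g \<bullet> (x' - x) + B (x' - x) (x' - x)"
        using touches_le[OF c(1) x'z] a a' by simp
      have 3: "B (y - x) (y - x) = B (y - x') (y - x') + 2 * B (y - x') (x' - x) + B (x' - x) (x' - x)"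
        using quad_add[of "y - x'" "x' - x"] by simp
      have 4: "B (y - x') (x' - x) = (y - x') \<bullet> bv x' - (y - x') \<bullet> bv x"
        by (simp add: inner_bv B.diff_right)
      have 5: "norm d * r / 4 \<le> g \<bullet> (y - x') - g' \<bullet> (y - x') - 2 * ((y - x') \<bullet> bv x) + 2 * ((y - x') \<bullet> bv x')"
        using h(1)[OF y] unfolding d_def by (simp add: inner_diff_left inner_diff_right inner_commute[of _ "bv _"] algebra_simps)
      have 6: "g \<bullet> (y - x) = g \<bullet> (y - x') + g \<bullet> (x' - x)" by (simp add: inner_diff_right)
      have "a' + g' \<bullet> (y - x') + B (y - x') (y - x') \<le> a + g \<bullet> (y - x) + B (y - x) (y - x) - norm d * r / 4"
        using 2 3 4 5 6 by linarith
      then show "u y \<le> ereal (par x g y - norm d * r / 4)"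
        using 1 a by (auto intro: order_trans)
    qed (use r in auto)
    moreover have r8: "(r/4) / (2*r) = 1/8" using r by simp
    ultimately have "(norm d * r / 4) * (1 / 8 ^ DIM('a)) \<le> \<bar>tr\<bar> * (2*r)\<^sup>2"
      unfolding r8 power_one_over by simp
    then have "norm d * r \<le> (lip_const * r) * r" unfolding lip_const_def by (simp add: field_simps power2_eq_square)
    then show "norm d \<le> lip_const * r" using r by simp
  qed
qed

text \<open>The case \<open>x = x'\<close> of the preceding estimate holds for every small
  \<open>r > 0\<close>, so the difference of the slopes is 0.\<close>

lemma touches_unique:
  assumes "touches x g" "touches x g'" "x \<in> cball z0 (R/8)"
  shows "g = g'"
proof (rule ccontr)
  assume "g \<noteq> g'"
  then have n: "norm (g - g') > 0" by simp
  define r where "r = min (R/4) (norm (g - g') / (2 * (lip_const + 1)))"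
  have r: "0 < r" using n lip_const_nonneg R unfolding r_def by simp
  moreover have "r \<le> R/4" unfolding r_def by (rule min.cobounded1)
  ultimately have r: "0 < r" "r \<le> R/4" .
  have "norm (g - g') \<le> lip_const * r"
    using touches_lipschitz_aux[OF assms(1,2) assms(3) assms(3), of r] r by simp
  also have "\<dots> \<le> (lip_const + 1) * (norm (g - g') / (2 * (lip_const + 1)))"
    using lip_const_nonneg r by (intro mult_mono) (auto simp: r_def)
  also have "\<dots> = norm (g - g') / 2" using lip_const_nonneg by (simp add: divide_simps)
  finally show False using n by simp
qed

lemma touches_lipschitz:
  assumes "touches x g" "touches x' g'" "x \<in> cball z0 (R/8)" "x' \<in> cball z0 (R/8)"
  shows "norm ((g - 2 *\<^sub>R bv x) - (g' - 2 *\<^sub>R bv x')) \<le> lip_const * dist x x'"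
proof (cases "x = x'")
  case True then show ?thesis using touches_unique assms by auto
next
  case False
  have "dist x x' \<le> R/4" using assms(3,4) dist_triangle3[of x x' z0] by auto
  then show ?thesis using touches_lipschitz_aux[OF assms, of "dist x x'"] False by auto
qed

lemma K_not_negligible:
  assumes fin: "\<bar>u z0\<bar> \<noteq> \<infinity>" and \<eta>: "\<eta> > 0"
    and le: "\<And>y. y \<in> cball z0 R \<Longrightarrow>
      u y \<le> u z0 + ereal (l \<bullet> (y - z0) + B (y - z0) (y - z0) - \<eta> * (norm (y - z0))\<^sup>2)"
  shows "\<not> negligible K"
proof
  assume neg: "negligible K"
  define G where "G x = (SOME g. touches x g)" for x
  have G: "touches x (G x)" if "x \<in> K" for x
    using that unfolding K_def G_def by (auto intro: someI_ex)
  \<comment> \<open>The linear coefficient of the touching paraboloid written as a polynomial in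
    \<open>y\<close>, which no longer refers to the contact point; it measures the tilt.\<close>
  define T where "T x = G x - 2 *\<^sub>R bv x" for x
  have lip: "norm (T x - T y) \<le> lip_const * norm (x - y)" if "x \<in> K" "y \<in> K" for x y
    using touches_lipschitz[OF G[OF that(1)] G[OF that(2)]] that
    unfolding T_def K_def by (auto simp: dist_norm)
  have "negligible (T ` K)"
  proof (rule negligible_locally_Lipschitz_image[OF order_refl neg])
    fix x assume "x \<in> K"
    then show "\<exists>V C. open V \<and> x \<in> V \<and> (\<forall>y\<in>K \<inter> V. norm (T y - T x) \<le> C * norm (y - x))"
      using lip by (intro exI[of _ UNIV] exI[of _ lip_const]) auto
  qed
  moreover have "cball (l - 2 *\<^sub>R bv z0) (\<eta> * R / 16) \<subseteq> T ` K"
  proof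
    fix v assume v: "v \<in> cball (l - 2 *\<^sub>R bv z0) (\<eta> * R / 16)"
    define p where "p = v - (l - 2 *\<^sub>R bv z0)"
    have p: "norm p \<le> \<eta> * R / 16" using v unfolding p_def by (simp add: dist_norm norm_minus_commute)
    \<comment> \<open>The given paraboloid tilted by \<open>p\<close>. Its contact point will be the
      preimage of \<open>v\<close> under \<open>T\<close>.\<close>
    let ?h = "\<lambda>y. (l + p) \<bullet> (y - z0) + B (y - z0) (y - z0)"
    have "\<exists>x\<in>cball z0 R. \<bar>u x\<bar> \<noteq> \<infinity> \<and> (\<forall>y\<in>cball z0 R. u y \<le> u x + ereal (?h y - ?h x))"
      using fin R by (intro usc_touch[OF usc compact_cball, of _ z0]) (use lt_top in \<open>auto intro!: continuous_intros simp: less_top[symmetric]\<close>)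
    then obtain x where x: "x \<in> cball z0 R" "\<bar>u x\<bar> \<noteq> \<infinity>"
      and "\<forall>y\<in>cball z0 R. u y \<le> u x + ereal (?h y - ?h x)" by (elim bexE conjE)
    then have touch: "u y \<le> u x + ereal (?h y - ?h x)" if "y \<in> cball z0 R" for y using that by blast
    have ctx: "touches x (l + p + 2 *\<^sub>R bv (x - z0))"
      unfolding touches_def
    proof (intro conjI ballI x(2))
      fix y assume y: "y \<in> cball z0 R"
      have "B (y - z0) (y - z0) = B (y - x) (y - x) + 2 * ((y - x) \<bullet> bv (x - z0)) + B (x - z0) (x - z0)"
        using quad_add[of "y - x" "x - z0"] by (simp add: inner_bv)
      then have "?h y - ?h x = (l + p + 2 *\<^sub>R bv (x - z0)) \<bullet> (y - x) + B (y - x) (y - x)"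
        by (simp add: inner_add_left inner_diff_right inner_commute[of _ "bv (x - z0)"])
      then show "u y \<le> u x + ereal ((l + p + 2 *\<^sub>R bv (x - z0)) \<bullet> (y - x) + B (y - x) (y - x))"
        using touch[OF y] by simp
    qed
    \<comment> \<open>Contact tested at \<open>z0\<close> and the strict bound \<open>le\<close>
      tested at \<open>x\<close> together give \<open>\<eta> * norm (x - z0) \<le> norm p\<close>.
      So a small tilt keeps the contact point inside \<open>cball z0 (R/8)\<close>.\<close>
    have "u z0 \<le> u x + ereal (- ?h x)" using touch[of z0] R by (simp add: B.zero_left)
    moreover have "u x \<le> u z0 + ereal (?h x - p \<bullet> (x - z0) - \<eta> * (norm (x - z0))\<^sup>2)"
      using le[OF x(1)] by (simp add: inner_add_left)
    ultimately have "\<eta> * (norm (x - z0))\<^sup>2 \<le> - (p \<bullet> (x - z0))"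
      using fin x(2) by (cases "u x"; cases "u z0") auto
    also have "\<dots> \<le> norm p * norm (x - z0)" using Cauchy_Schwarz_ineq2[of p "x - z0"] by linarith
    finally have "(\<eta> * norm (x - z0)) * norm (x - z0) \<le> norm p * norm (x - z0)"
      by (simp add: power2_eq_square)
    then have "\<eta> * norm (x - z0) \<le> norm p \<or> x = z0" by auto
    then have "\<eta> * norm (x - z0) \<le> \<eta> * (R / 16)"
    proof
      assume "\<eta> * norm (x - z0) \<le> norm p" then show ?thesis using p by simp
    qed (use \<eta> R in simp)
    then have "norm (x - z0) \<le> R / 16" using \<eta> by simp
    then have xb: "x \<in> cball z0 (R/8)" using R by (simp add: dist_norm norm_minus_commute)
    then have xK: "x \<in> K" using ctx unfolding K_def by blast
    have "G x = l + p + 2 *\<^sub>R bv (x - z0)" by (rule touches_unique[OF G[OF xK] ctx xb])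
    then have "T x = v" unfolding T_def p_def bv_diff by (simp add: scaleR_diff_right)
    then show "v \<in> T ` K" using xK by blast
  qed
  ultimately have "negligible (cball (l - 2 *\<^sub>R bv z0) (\<eta> * R / 16))"
    by (rule negligible_subset)
  moreover have "ball (l - 2 *\<^sub>R bv z0) (\<eta> * R / 16) \<noteq> {}" using mult_pos_pos[OF \<eta> R] by simp
  ultimately show False using open_not_negligible[OF open_ball] negligible_subset[OF _ ball_subset_cball] by blast
qed

text \<open>Two critical contact points never differ by a nonzero multiple of \<open>e\<close>.
  Hence translates of this set by different multiples of \<open>e\<close> are disjoint, and
  infinitely many of them fit into one ball.\<close>

lemma critical_negligible:
  assumes e: "B e e < 0" and fin: "u z0 \<noteq> - \<infinity>"
  shows "negligible {x \<in> cball z0 (R/8). touches x 0}"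
proof -
  let ?C = "{x \<in> cball z0 (R/8). touches x 0}"
  \<comment> \<open>For fixed \<open>y\<close> the inequality describes a superlevel set of an upper
    semicontinuous function of \<open>x\<close>. This makes the set closed, hence measurable; the
    choice \<open>y = z0\<close> recovers that \<open>u x\<close> is finite.\<close>
  have eq: "?C = (\<Inter>y\<in>cball z0 R. {x \<in> cball z0 (R/8). u y \<le> u x + ereal (B (y - x) (y - x))})"
    (is "_ = ?D")
  proof
    show "?C \<subseteq> ?D" by (auto simp: touches_def)
    show "?D \<subseteq> ?C"
    proof
      fix x assume x: "x \<in> ?D"
      have z: "z0 \<in> cball z0 R" using R by simp
      have xb: "x \<in> cball z0 (R/8)" using x z by blast
      have "u z0 \<le> u x + ereal (B (z0 - x) (z0 - x))" using x z by blast
      then have "u x \<noteq> -\<infinity>" using fin by auto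
      moreover have "u x < \<infinity>" using lt_top[of x] xb R by auto
      ultimately have "\<bar>u x\<bar> \<noteq> \<infinity>" by auto
      then show "x \<in> ?C" unfolding touches_def using x xb by auto
    qed
  qed
  have "closed ?C" unfolding eq
  proof (intro closed_INT ballI)
    fix y
    show "closed {x \<in> cball z0 (R/8). u y \<le> u x + ereal (B (y - x) (y - x))}"
      by (rule usc_on_closed_superlevel[OF usc_on_add])
        (use R in \<open>auto intro!: continuous_intros usc_on_subset[OF usc]\<close>)
  qed
  moreover have "bounded ?C" by (rule bounded_subset[OF bounded_cball[of z0 "R/8"]]) auto
  ultimately have comp: "compact ?C" by (simp add: compact_eq_bounded_closed)
  have cone: "B (x - y) (x - y) \<ge> 0" if "x \<in> ?C" "y \<in> ?C" for x y
  proof -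
    have "x \<in> cball z0 R" "y \<in> cball z0 R" using that R by auto
    then have "u y \<le> u x + ereal (B (y - x) (y - x))" "u x \<le> u y + ereal (B (x - y) (x - y))"
      "\<bar>u x\<bar> \<noteq> \<infinity>" "\<bar>u y\<bar> \<noteq> \<infinity>"
      using that unfolding touches_def by auto
    moreover have "B (y - x) (y - x) = B (x - y) (x - y)" by (simp add: quad_diff sym)
    ultimately show ?thesis by (cases "u x"; cases "u y") auto
  qed
  define t where "t k = (1 / real (Suc k)) *\<^sub>R e" for k :: nat
  have disj: "(+) (t k) ` ?C \<inter> (+) (t l) ` ?C = {}" if "k \<noteq> l" for k l
  proof (rule ccontr)
    assume "\<not> ?thesis"
    then obtain x y where xy: "x \<in> ?C" "y \<in> ?C" "t k + x = t l + y" by blast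
    then have "x - y = (1 / real (Suc l) - 1 / real (Suc k)) *\<^sub>R e"
      by (simp add: t_def scaleR_diff_left algebra_simps)
    then have "B (x - y) (x - y) = (1 / real (Suc l) - 1 / real (Suc k))\<^sup>2 * B e e"
      by (simp add: B.scaleR_left B.scaleR_right power2_eq_square)
    moreover have "(1 / real (Suc l) - 1 / real (Suc k))\<^sup>2 > 0"
      using that by (simp add: frac_eq_eq del: of_nat_Suc)
    ultimately have "B (x - y) (x - y) < 0" using e by (simp add: mult_pos_neg)
    then show False using cone[OF xy(1,2)] by simp
  qed
  have lm: "?C \<in> lmeasurable" using comp by (rule lmeasurable_compact)
  have lmt: "(+) (t k) ` ?C \<in> lmeasurable" for k using lm by (rule measurable_translation)
  let ?U = "cball z0 (R + norm e)"
  have sub: "(+) (t k) ` ?C \<subseteq> ?U" for k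
  proof
    fix v assume "v \<in> (+) (t k) ` ?C"
    then obtain x where x: "x \<in> cball z0 (R/8)" "v = t k + x" by blast
    have "norm (t k) \<le> norm e" unfolding t_def by (simp add: divide_le_eq mult_le_cancel_left1)
    then have "dist x v \<le> norm e" using x by (simp add: dist_norm)
    then show "v \<in> ?U" using x R dist_triangle[of z0 v x] by auto
  qed
  have "real n * measure lebesgue ?C \<le> measure lebesgue ?U" for n :: nat
  proof -
    have "measure lebesgue (\<Union>k<n. (+) (t k) ` ?C) = (\<Sum>k<n. measure lebesgue ((+) (t k) ` ?C))"
      using lmt disj
      by (intro measure_finite_Union) (auto simp: disjoint_family_on_def fmeasurable_def less_top[symmetric] simp del: emeasure_completion)
    also have "\<dots> = real n * measure lebesgue ?C" by (simp add: measure_translation)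
    finally have "real n * measure lebesgue ?C = measure lebesgue (\<Union>k<n. (+) (t k) ` ?C)" by simp
    also have "\<dots> \<le> measure lebesgue ?U"
      by (rule measure_mono_fmeasurable) (use sub lmt in auto)
    finally show ?thesis .
  qed
  then have "measure lebesgue ?C \<le> 0"
    by (meson linorder_not_le reals_Archimedean3)
  then show ?thesis using lm by (simp add: negligible_iff_measure order_antisym)
qed

end

section \<open>Separated sets and a subharmonic kernel\<close>

text \<open>Distance is the maximum over the coordinates in \<open>J\<close>. With
  \<open>J = Basis - {b}\<close> it is seen in the projection along \<open>b\<close>, with
  \<open>J = Basis\<close> in the whole space.\<close>

definition separated :: "'a::euclidean_space set \<Rightarrow> real \<Rightarrow> 'a set \<Rightarrow> bool" where
  "separated J d Y \<longleftrightarrow> (\<forall>x\<in>Y. \<forall>y\<in>Y. x \<noteq> y \<longrightarrow> (\<exists>i\<in>J. d \<le> \<bar>(x - y) \<bullet> i\<bar>))"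

lemma separated_subset: "separated J d Y \<Longrightarrow> Z \<subseteq> Y \<Longrightarrow> separated J d Z"
  unfolding separated_def by blast

text \<open>Pigeonhole on a grid of mesh \<open>d\<close>: separated points lie in different cells,
  and each coordinate meets at most \<open>2 * s / d + 2\<close> values of the floor, which is at
  most \<open>4 * s / d\<close> as \<open>d \<le> s\<close>.\<close>

lemma separated_card:
  fixes Y :: "'a::euclidean_space set"
  assumes sep: "separated J d Y" and J: "finite J" and d: "0 < d" "d \<le> s"
    and bd: "\<And>y i. y \<in> Y \<Longrightarrow> i \<in> J \<Longrightarrow> \<bar>(y - c) \<bullet> i\<bar> \<le> s"
  shows "finite Y" "real (card Y) \<le> (4 * s / d) ^ card J"
proof -
  define f where "f y = (\<lambda>i\<in>J. \<lfloor>((y - c) \<bullet> i) / d\<rfloor>)" for y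
  let ?I = "{\<lfloor>- s / d\<rfloor>..\<lfloor>s / d\<rfloor>}"
  have inj: "inj_on f Y"
  proof (rule inj_onI, rule ccontr)
    fix x y assume xy: "x \<in> Y" "y \<in> Y" "f x = f y" "x \<noteq> y"
    then obtain i where i: "i \<in> J" "d \<le> \<bar>(x - y) \<bullet> i\<bar>" using sep unfolding separated_def by blast
    have "\<lfloor>((x - c) \<bullet> i) / d\<rfloor> = \<lfloor>((y - c) \<bullet> i) / d\<rfloor>"
      using fun_cong[OF xy(3), of i] i(1) by (simp add: f_def)
    then have "\<bar>((x - c) \<bullet> i) / d - ((y - c) \<bullet> i) / d\<bar> < 1" by linarith
    then have "\<bar>(x - y) \<bullet> i / d\<bar> < 1" by (simp add: inner_diff_left diff_divide_distrib)
    then show False using i(2) d(1) by (simp add: abs_divide)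
  qed
  have sub: "f ` Y \<subseteq> PiE J (\<lambda>_. ?I)"
  proof
    fix z assume "z \<in> f ` Y"
    then obtain y where y: "y \<in> Y" "z = f y" by blast
    have "\<lfloor>((y - c) \<bullet> i) / d\<rfloor> \<in> ?I" if "i \<in> J" for i
    proof -
      have "- s \<le> (y - c) \<bullet> i" "(y - c) \<bullet> i \<le> s" using bd[OF y(1) that] by auto
      then have "- s / d \<le> ((y - c) \<bullet> i) / d" "((y - c) \<bullet> i) / d \<le> s / d"
        using d(1) by (intro divide_right_mono; simp)+
      then show ?thesis by (auto intro: floor_mono)
    qed
    then show "z \<in> PiE J (\<lambda>_. ?I)" unfolding y f_def by auto
  qed
  have fin: "finite (PiE J (\<lambda>_. ?I))" using J by (intro finite_PiE) auto
  show "finite Y" using finite_subset[OF sub fin] inj by (rule finite_imageD)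
  have "card Y = card (f ` Y)" using inj by (simp add: card_image)
  also have "\<dots> \<le> card (PiE J (\<lambda>_. ?I))" by (rule card_mono[OF fin sub])
  also have "\<dots> = card ?I ^ card J" using J by (simp add: card_PiE)
  finally have "real (card Y) \<le> real (card ?I) ^ card J" by (metis of_nat_le_iff of_nat_power)
  also have "\<dots> \<le> (4 * s / d) ^ card J"
  proof (intro power_mono)
    have one: "1 \<le> s / d" using d by simp
    have "real (card ?I) = real_of_int (\<lfloor>s / d\<rfloor> - \<lfloor>- s / d\<rfloor> + 1)"
    proof -
      have "- s / d \<le> s / d" using one by simp
      then have "\<lfloor>- s / d\<rfloor> \<le> \<lfloor>s / d\<rfloor>" by (rule floor_mono)
      then show ?thesis by simp
    qed
    also have "\<dots> \<le> s/d + s/d + 2" by (simp, linarith)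
    also have "\<dots> \<le> 4 * s / d" using one by simp
    finally show "real (card ?I) \<le> 4 * s / d" .
  qed simp
  finally show "real (card Y) \<le> (4 * s / d) ^ card J" .
qed

text \<open>\<open>separated_card\<close> bounds the size of separated subsets, so one of largest
  size exists; a point far from all its members could be added.\<close>

lemma maximal_separated:
  fixes A :: "'a::euclidean_space set"
  assumes J: "finite J" "J \<subseteq> Basis" and d: "0 < d" and A: "bounded A"
  obtains Y where "finite Y" "Y \<subseteq> A" "separated J d Y"
    "\<And>x. x \<in> A \<Longrightarrow> \<exists>y\<in>Y. \<forall>i\<in>J. \<bar>(x - y) \<bullet> i\<bar> < d"
proof -
  obtain s where s: "\<And>x. x \<in> A \<Longrightarrow> norm x \<le> s" using A bounded_iff by blast
  define s' where "s' = max s d"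
  have bd: "\<bar>(y - 0) \<bullet> i\<bar> \<le> s'" if "y \<in> A" "i \<in> J" for y i
    using s[OF that(1)] Basis_le_norm[of i y] that J unfolding s'_def by auto
  let ?P = "\<lambda>n. \<exists>Y. Y \<subseteq> A \<and> separated J d Y \<and> finite Y \<and> card Y = n"
  have "n \<le> nat \<lceil>(4 * s' / d) ^ card J\<rceil>" if P: "?P n" for n
  proof -
    from P obtain Y where Y: "Y \<subseteq> A" "separated J d Y" "card Y = n" by blast
    have "real n \<le> (4 * s' / d) ^ card J"
      using separated_card(2)[OF Y(2) J(1) d, of s' 0] bd Y unfolding s'_def by auto
    then show ?thesis by linarith
  qed
  moreover have "?P 0" by (intro exI[of _ "{}"]) (auto simp: separated_def)
  ultimately obtain n where n: "?P n" "\<And>m. ?P m \<Longrightarrow> m \<le> n"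
    using Nat.ex_has_greatest_nat[of ?P 0 "nat \<lceil>(4 * s' / d) ^ card J\<rceil>"] by blast
  obtain Y where Y: "Y \<subseteq> A" "separated J d Y" "finite Y" "card Y = n" using n(1) by blast
  show ?thesis
  proof (rule that[OF Y(3,1,2)])
    fix x assume x: "x \<in> A"
    show "\<exists>y\<in>Y. \<forall>i\<in>J. \<bar>(x - y) \<bullet> i\<bar> < d"
    proof (rule ccontr)
      assume "\<not> ?thesis"
      then have far: "\<And>y. y \<in> Y \<Longrightarrow> \<exists>i\<in>J. d \<le> \<bar>(x - y) \<bullet> i\<bar>" by (meson not_less)
      then have far': "\<And>y. y \<in> Y \<Longrightarrow> \<exists>i\<in>J. d \<le> \<bar>(y - x) \<bullet> i\<bar>"
        by (metis abs_minus_commute inner_diff_left)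
      have "x \<notin> Y" using far[of x] d by auto
      moreover have "separated J d (insert x Y)"
        using Y(2) far far' unfolding separated_def by auto
      ultimately have "?P (Suc n)" using Y x by (intro exI[of _ "insert x Y"]) auto
      then show False using n(2) by fastforce
    qed
  qed
qed

text \<open>
  The exponent \<open>k = N - 3/2\<close> lies in \<open>(N - 2, N - 1)\<close>: above \<open>N - 2\<close> the kernel \<open>norm v powr - k\<close> is
  strictly subharmonic off the origin, and below \<open>N - 1\<close> it is integrable over hyperplanes. The
  separation is measured orthogonally to \<open>b\<close>, so the points imitate a graph over a hyperplane.
\<close>

lemma separated_kernel_sum_dyadic:
  fixes Y :: "'a::euclidean_space set"
  assumes b: "b \<in> Basis" and d: "0 < d" and k: "k = DIM('a) - 3/2" "0 < k"
  shows "separated (Basis - {b}) d Y \<Longrightarrow> (\<And>y. y \<in> Y \<Longrightarrow> d \<le> dist x y \<and> dist x y \<le> 2 ^ n * d) \<Longrightarrow>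
    (\<Sum>y\<in>Y. dist x y powr - k) \<le> 4 * (8 ^ (DIM('a) - 1) * d powr - k) * (sqrt 2) ^ n"
proof (induction n arbitrary: Y)
  case 0
  let ?N = "DIM('a) - 1"
  have card: "real (card Y) \<le> (4 * d / d) ^ card (Basis - {b})"
  proof (rule separated_card(2)[OF 0(1) _ d order_refl])
    fix y i assume "y \<in> Y" "i \<in> Basis - {b}"
    then show "\<bar>(y - x) \<bullet> i\<bar> \<le> d" using 0(2)[of y] Basis_le_norm[of i "y - x"]
      by (auto simp: dist_norm norm_minus_commute)
  qed simp
  have "(\<Sum>y\<in>Y. dist x y powr - k) \<le> real (card Y) * d powr - k"
    using 0(2) d k by (intro sum_bounded_above) (auto intro!: powr_mono2')
  also have "\<dots> \<le> (4 ^ ?N) * d powr - k"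
    using card b d by (intro mult_right_mono) (auto simp: card_Diff_singleton)
  also have "\<dots> \<le> 4 * 8 ^ ?N * d powr - k"
    using power_mono[of 4 "8::real" ?N] zero_le_power[of "8::real" ?N] by (intro mult_right_mono) (linarith, simp)
  finally show ?case by simp
next
  case (Suc n)
  let ?N = "DIM('a) - 1"
  let ?A = "8 ^ ?N * d powr - k"
  \<comment> \<open>The induction hypothesis handles the inner part \<open>Y1\<close>; the outer
    shell \<open>Y2\<close> is estimated by its number of points times the largest kernel
    value.\<close>
  define Y1 where "Y1 = {y\<in>Y. dist x y \<le> 2 ^ n * d}"
  define Y2 where "Y2 = {y\<in>Y. \<not> dist x y \<le> 2 ^ n * d}"
  have d2: "d \<le> 2 ^ Suc n * d" using d one_le_power[of "2::real" "Suc n"] by simp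
  have bd: "\<bar>(y - x) \<bullet> i\<bar> \<le> 2 ^ Suc n * d" if "y \<in> Y" "i \<in> Basis - {b}" for y i
    using Suc(3)[of y] Basis_le_norm[of i "y - x"] that by (auto simp: dist_norm norm_minus_commute)
  have fin: "finite Y"
    by (rule separated_card(1)[OF Suc(2) _ d d2]) (use bd in auto)
  have "real (card Y2) \<le> (4 * (2 ^ Suc n * d) / d) ^ card (Basis - {b})"
    by (rule separated_card(2)[OF separated_subset[OF Suc(2)] _ d d2]) (use bd in \<open>auto simp: Y2_def\<close>)
  also have "\<dots> = (8 * 2 ^ n) ^ ?N" using b d by (simp add: card_Diff_singleton)
  finally have card: "real (card Y2) \<le> (8 * 2 ^ n) ^ ?N" .
  have "(\<Sum>y\<in>Y2. dist x y powr - k) \<le> real (card Y2) * (2 ^ n * d) powr - k"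
    using d k by (intro sum_bounded_above) (auto intro!: powr_mono2' simp: Y2_def)
  also have "\<dots> \<le> (8 * 2 ^ n) ^ ?N * (2 ^ n * d) powr - k"
    by (intro mult_right_mono card) simp
  also have "\<dots> = 8 ^ ?N * d powr - k * ((2 ^ n) ^ ?N * (2 ^ n) powr - k)"
    using d by (simp add: power_mult_distrib powr_mult)
  \<comment> \<open>Here \<open>k < DIM('a) - 1\<close> enters: the number of points in a shell
    outgrows the decay of the kernel by the power \<open>?N - k = 1/2\<close> of its radius.\<close>
  also have "(2 ^ n) ^ ?N * (2 ^ n) powr - k = (sqrt 2) ^ n"
  proof -
    have "((2::real) ^ n) powr real ?N = (2 ^ n) ^ ?N" by (rule powr_realpow) simp
    then have "(2 ^ n) ^ ?N * (2 ^ n) powr - k = ((2::real) ^ n) powr (real ?N - k)"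
      unfolding diff_conv_add_uminus powr_add by simp
    also have "real ?N - k = 1/2" using k DIM_positive[where 'a='a] by (simp add: of_nat_diff)
    also have "((2::real) ^ n) powr (1/2) = (sqrt 2) ^ n"
      by (simp add: powr_half_sqrt real_sqrt_power)
    finally show ?thesis .
  qed
  finally have s2: "(\<Sum>y\<in>Y2. dist x y powr - k) \<le> ?A * (sqrt 2) ^ n" .
  have s1: "(\<Sum>y\<in>Y1. dist x y powr - k) \<le> 4 * ?A * (sqrt 2) ^ n"
    by (rule Suc.IH[OF separated_subset[OF Suc(2)]]) (use Suc(3) in \<open>auto simp: Y1_def\<close>)
  have "(\<Sum>y\<in>Y. dist x y powr - k) = (\<Sum>y\<in>Y1. dist x y powr - k) + (\<Sum>y\<in>Y2. dist x y powr - k)"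
    using fin by (subst sum.union_disjoint[symmetric]) (auto simp: Y1_def Y2_def intro!: sum.cong)
  also have "\<dots> \<le> 5 * (?A * (sqrt 2) ^ n)" using s1 s2 by simp
  \<comment> \<open>The constant 4 of the claim is chosen to close the induction: 4 + 1 \<le> 4 sqrt
    2.\<close>
  also have "\<dots> \<le> 4 * sqrt 2 * (?A * (sqrt 2) ^ n)"
  proof (rule mult_right_mono)
    have "5/4 \<le> sqrt 2" by (rule real_le_rsqrt) (simp add: power2_eq_square)
    then show "5 \<le> 4 * sqrt 2" by simp
  qed simp
  finally show ?case by (simp add: mult_ac)
qed

text \<open>After multiplication by \<open>d ^ (DIM('a) - 1)\<close> the sum resembles a Riemann sum
  of the kernel over a hyperplane disc of radius \<open>D\<close>, whose integral is of order
  \<open>sqrt D\<close>. The bound is uniform in \<open>d\<close>.\<close>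

lemma separated_kernel_sum:
  fixes Y :: "'a::euclidean_space set"
  assumes b: "b \<in> Basis" and d: "0 < d" "d \<le> D" and k: "k = DIM('a) - 3/2" "0 < k"
    and sep: "separated (Basis - {b}) d Y" and Y: "\<And>y. y \<in> Y \<Longrightarrow> d \<le> dist x y \<and> dist x y \<le> D"
  shows "(\<Sum>y\<in>Y. dist x y powr - k) * d ^ (DIM('a) - 1) \<le> 8 ^ DIM('a) * sqrt D"
proof -
  let ?N = "DIM('a) - 1"
  let ?P = "\<lambda>n::nat. D \<le> 2 ^ n * d"
  obtain n0 :: nat where "D / d < 2 ^ n0" using real_arch_pow[of 2 "D/d"] by auto
  then have "?P n0" using d by (simp add: field_simps)
  \<comment> \<open>Minimality gives \<open>2 ^ n * d \<le> 2 * D\<close>, which removes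
    \<open>d\<close> from the dyadic bound.\<close>
  define n where "n = (LEAST n. ?P n)"
  have n: "?P n" unfolding n_def by (rule LeastI[of ?P, OF \<open>?P n0\<close>])
  have n2: "2 ^ n * d \<le> 2 * D"
  proof (cases n)
    case 0 then show ?thesis using d by simp
  next
    case (Suc k)
    then have "\<not> ?P k" using not_less_Least[of k ?P] unfolding n_def by simp
    then show ?thesis using Suc by simp
  qed
  have "(sqrt 2) ^ n * sqrt d = sqrt (2 ^ n * d)" by (simp add: real_sqrt_mult real_sqrt_power)
  also have "\<dots> \<le> sqrt (2 * D)" using n2 by simp
  also have "\<dots> \<le> 2 * sqrt D" 
    using d sqrt2_less_2 by (simp add: real_sqrt_mult mult_right_mono)
  finally have p: "(sqrt 2) ^ n * sqrt d \<le> 2 * sqrt D" .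
  have e: "d powr - k * d ^ ?N = sqrt d"
  proof -
    have "d powr - k * d ^ ?N = d powr (- k + real ?N)"
      using d unfolding powr_add by (simp only: powr_realpow)
    also have "- k + real ?N = 1/2" using k DIM_positive[where 'a='a] by (simp add: of_nat_diff)
    finally show ?thesis using d by (simp add: powr_half_sqrt)
  qed
  have "(\<Sum>y\<in>Y. dist x y powr - k) \<le> 4 * (8 ^ ?N * d powr - k) * (sqrt 2) ^ n"
    by (rule separated_kernel_sum_dyadic[OF b d(1) k sep]) (use Y n in force)
  then have "(\<Sum>y\<in>Y. dist x y powr - k) * d ^ ?N \<le> 4 * (8 ^ ?N * d powr - k) * (sqrt 2) ^ n * d ^ ?N"
    using d by (intro mult_right_mono) auto
  also have "\<dots> = 4 * 8 ^ ?N * ((sqrt 2) ^ n * (d powr - k * d ^ ?N))" by (simp add: mult_ac)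
  also have "\<dots> \<le> 4 * 8 ^ ?N * (2 * sqrt D)"
    unfolding e by (intro mult_left_mono p) simp
  also have "\<dots> = 8 ^ Suc ?N * sqrt D" by (simp only: power_Suc)
  finally show ?thesis using DIM_positive[where 'a='a] by (simp only: Suc_diff_1)
qed

section \<open>Taylor bounds and means of the kernel\<close>

lemma powr_taylor_lower:
  fixes s s0 a :: real
  assumes s: "0 < s" "0 < s0" and a: "0 < a"
  shows "s0 powr - a - a * s0 powr (- a - 1) * (s - s0) + a * (a + 1) / 2 * s0 powr (- a - 2) * (s - s0)\<^sup>2
     - a * (a + 1) * (a + 2) / 6 * s0 powr (- a - 3) * (s - s0) ^ 3 \<le> s powr - a"
proof (cases "s = s0")
  case True then show ?thesis by simp
next
  case False
  define diff where "diff m t = (\<Prod>i<m. - a - real i) * t powr (- a - real m)" for m t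
  have "\<exists>t. (if s < s0 then s < t \<and> t < s0 else s0 < t \<and> t < s) \<and>
      s powr - a = (\<Sum>m<4. diff m s0 / fact m * (s - s0) ^ m) + diff 4 t / fact 4 * (s - s0) ^ 4"
  proof (rule Taylor[where f="\<lambda>t. t powr - a" and a="min s s0" and b="max s s0"])
    show "diff 0 = (\<lambda>t. t powr - a)" by (simp add: diff_def fun_eq_iff)
    show "\<forall>m t. m < 4 \<and> min s s0 \<le> t \<and> t \<le> max s s0 \<longrightarrow> DERIV (diff m) t :> diff (Suc m) t"
    proof (intro allI impI)
      fix m :: nat and t assume "m < 4 \<and> min s s0 \<le> t \<and> t \<le> max s s0"
      then have t: "0 < t" using s by (auto simp: min_def split: if_splits)
      have "((\<lambda>t. t powr (- a - real m)) has_real_derivative (- a - real m) * t powr (- a - real m - 1)) (at t)"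
        using t by (rule has_real_derivative_powr)
      then have "(diff m has_real_derivative (\<Prod>i<m. - a - real i) * ((- a - real m) * t powr (- a - real m - 1))) (at t)"
        unfolding diff_def by (rule DERIV_cmult)
      then show "DERIV (diff m) t :> diff (Suc m) t"
        unfolding diff_def by (simp add: mult.assoc algebra_simps)
    qed
  qed (use False in auto)
  then obtain t where t: "if s < s0 then s < t \<and> t < s0 else s0 < t \<and> t < s"
    "s powr - a = (\<Sum>m<4. diff m s0 / fact m * (s - s0) ^ m) + diff 4 t / fact 4 * (s - s0) ^ 4" by blast
  have "diff 4 t = a * (a+1) * (a+2) * (a+3) * t powr (- a - 4)"
    by (simp add: diff_def eval_nat_numeral algebra_simps)
  then have "0 \<le> diff 4 t" using a by simp
  then have "0 \<le> diff 4 t / fact 4 * (s - s0) ^ 4" by (intro mult_nonneg_nonneg) auto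
  moreover have "(\<Sum>m<4. diff m s0 / fact m * (s - s0) ^ m) = s0 powr - a - a * s0 powr (- a - 1) * (s - s0)
     + a * (a + 1) / 2 * s0 powr (- a - 2) * (s - s0)\<^sup>2
     - a * (a + 1) * (a + 2) / 6 * s0 powr (- a - 3) * (s - s0) ^ 3"
  proof -
    have d: "diff 0 s0 = s0 powr - a" "diff 1 s0 = - a * s0 powr (- a - 1)"
      "diff 2 s0 = a * (a + 1) * s0 powr (- a - 2)" "diff 3 s0 = - (a * (a + 1) * (a + 2)) * s0 powr (- a - 3)"
      by (simp_all add: diff_def eval_nat_numeral algebra_simps)
    have "(\<Sum>m<4. diff m s0 / fact m * (s - s0) ^ m) = diff 0 s0 + diff 1 s0 * (s - s0)
       + diff 2 s0 / 2 * (s - s0)\<^sup>2 + diff 3 s0 / 6 * (s - s0) ^ 3"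
      by (simp add: eval_nat_numeral)
    then show ?thesis unfolding d by simp
  qed
  ultimately show ?thesis using t(2) by linarith
qed

text \<open>
  The fourth derivative of \<open>s powr - a\<close> is positive, so its third Taylor polynomial is a global lower
  bound; with \<open>s\<close> the squared norm of \<open>x + h\<close> it yields the second-order expansion of the kernel.
\<close>

lemma kernel_taylor_lower:
  fixes x :: "'a::real_inner"
  assumes x: "x \<noteq> 0" and k: "0 < k"
  shows "\<exists>C\<ge>0. \<forall>h. norm h \<le> 1 \<longrightarrow> x + h \<noteq> 0 \<longrightarrow>
    norm x powr - k - k * norm x powr (- k - 2) * (x \<bullet> h)
    + k / 2 * norm x powr (- k - 2) * ((k + 2) / (norm x)\<^sup>2 * (x \<bullet> h)\<^sup>2 - (norm h)\<^sup>2) - C * norm h ^ 3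
    \<le> norm (x + h) powr - k"
proof -
  define a where "a = k / 2"
  define s0 where "s0 = (norm x)\<^sup>2"
  have a: "0 < a" and s0: "0 < s0" using x k by (auto simp: a_def s0_def)
  define c2 where "c2 = a * (a + 1) / 2 * s0 powr (- a - 2)"
  define c3 where "c3 = a * (a + 1) * (a + 2) / 6 * s0 powr (- a - 3)"
  have c: "0 \<le> c2" "0 \<le> c3" using a by (auto simp: c2_def c3_def)
  \<comment> \<open>The first summand covers the mixed cubic term of \<open>d\<^sup>2\<close>, the
    second the whole of \<open>d ^ 3\<close>, with \<open>d\<close> the increment of the squared
    norm.\<close>
  define C where "C = c2 * (4 * norm x) + c3 * (2 * norm x + 1) ^ 3"
  have sq: "((norm y)\<^sup>2) powr t = norm y powr (2 * t)" if "y \<noteq> 0" for t and y :: 'a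
  proof -
    have "(norm y)\<^sup>2 = norm y powr 2" using that by simp
    then show ?thesis by (simp only: powr_powr)
  qed
  have pw: "norm y powr - k = ((norm y)\<^sup>2) powr - a" if "y \<noteq> 0" for y :: 'a
    using sq[OF that, of "- a"] by (simp add: a_def)
  have p0: "s0 powr - a = norm x powr - k" "s0 powr (- a - 1) = norm x powr (- k - 2)"
    "s0 powr (- a - 2) = norm x powr (- k - 2) / (norm x)\<^sup>2"
  proof -
    have *: "s0 powr t = norm x powr (2 * t)" for t
      unfolding s0_def by (rule sq[OF x])
    show "s0 powr - a = norm x powr - k" "s0 powr (- a - 1) = norm x powr (- k - 2)"
      unfolding * a_def by (simp_all add: algebra_simps)
    have "s0 powr (- a - 2) = norm x powr ((- k - 2) - 2)" unfolding * a_def by (simp add: algebra_simps)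
    then show "s0 powr (- a - 2) = norm x powr (- k - 2) / (norm x)\<^sup>2"
      using x powr_diff[of "norm x" "- k - 2" 2] by simp
  qed
  show ?thesis
  proof (intro exI[of _ C] conjI allI impI)
    show "0 \<le> C" using c by (auto simp: C_def intro!: add_nonneg_nonneg mult_nonneg_nonneg)
    fix h :: 'a assume h: "norm h \<le> 1" "x + h \<noteq> 0"
    define d where "d = 2 * (x \<bullet> h) + (norm h)\<^sup>2"
    have sd: "(norm (x + h))\<^sup>2 - s0 = d"
      by (simp add: s0_def d_def power2_norm_eq_inner inner_add_left inner_add_right inner_commute)
    have T: "s0 powr - a - a * s0 powr (- a - 1) * d + c2 * d\<^sup>2 - c3 * d ^ 3 \<le> ((norm (x + h))\<^sup>2) powr - a"
      using powr_taylor_lower[of "(norm (x + h))\<^sup>2" s0 a] h s0 a unfolding c2_def c3_def sd by simp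
    have xh: "\<bar>x \<bullet> h\<bar> \<le> norm x * norm h" by (rule Cauchy_Schwarz_ineq2)
    have d2: "4 * (x \<bullet> h)\<^sup>2 - 4 * norm x * norm h ^ 3 \<le> d\<^sup>2"
    proof -
      have "- (norm x * norm h * (norm h)\<^sup>2) \<le> (x \<bullet> h) * (norm h)\<^sup>2"
        using mult_right_mono[of "- (norm x * norm h)" "x \<bullet> h" "(norm h)\<^sup>2"] xh by auto
      moreover have "d\<^sup>2 = 4 * (x \<bullet> h)\<^sup>2 + 4 * ((x \<bullet> h) * (norm h)\<^sup>2) + ((norm h)\<^sup>2)\<^sup>2"
        by (simp add: d_def power2_eq_square algebra_simps)
      moreover have "norm x * norm h ^ 3 = norm x * norm h * (norm h)\<^sup>2"
        by (simp add: power2_eq_square power3_eq_cube)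
      moreover have "0 \<le> ((norm h)\<^sup>2)\<^sup>2" by simp
      ultimately show ?thesis by linarith
    qed
    have "\<bar>d\<bar> \<le> 2 * (norm x * norm h) + norm h * 1"
      unfolding d_def power2_eq_square
      using xh mult_left_mono[OF h(1) norm_ge_zero[of h]] zero_le_square[of "norm h"]
      by linarith
    then have "\<bar>d\<bar> \<le> (2 * norm x + 1) * norm h" by (simp add: algebra_simps)
    then have "\<bar>d\<bar> ^ 3 \<le> ((2 * norm x + 1) * norm h) ^ 3" by (rule power_mono) simp
    moreover have "d ^ 3 \<le> \<bar>d\<bar> ^ 3" by (metis abs_ge_self power_abs)
    ultimately have d3: "d ^ 3 \<le> (2 * norm x + 1) ^ 3 * norm h ^ 3" by (simp add: power_mult_distrib)
    have "c2 * (4 * (x \<bullet> h)\<^sup>2 - 4 * norm x * norm h ^ 3) \<le> c2 * d\<^sup>2" by (rule mult_left_mono[OF d2 c(1)])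
    moreover have "c3 * d ^ 3 \<le> c3 * ((2 * norm x + 1) ^ 3 * norm h ^ 3)" by (rule mult_left_mono[OF d3 c(2)])
    ultimately have *: "s0 powr - a - a * s0 powr (- a - 1) * d + c2 * 4 * (x \<bullet> h)\<^sup>2 - C * norm h ^ 3
        \<le> ((norm (x + h))\<^sup>2) powr - a"
      using T unfolding C_def by (simp add: algebra_simps)
    have "s0 powr - a - a * s0 powr (- a - 1) * d + c2 * 4 * (x \<bullet> h)\<^sup>2
      = norm x powr - k - k * norm x powr (- k - 2) * (x \<bullet> h)
    + k / 2 * norm x powr (- k - 2) * ((k + 2) / (norm x)\<^sup>2 * (x \<bullet> h)\<^sup>2 - (norm h)\<^sup>2)"
    proof -
      have "A - (k/2) * P * (2 * w + hh) + (k/2 * (k/2 + 1) / 2 * (P * i)) * 4 * w2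
          = A - k * P * w + k / 2 * P * ((k + 2) * i * w2 - hh)" for A P w hh i w2 :: real
        by (simp add: field_simps)
      then show ?thesis unfolding c2_def p0 d_def unfolding a_def divide_inverse[of _ "(norm x)\<^sup>2"] by (simp only:)
    qed
    then show "norm x powr - k - k * norm x powr (- k - 2) * (x \<bullet> h)
    + k / 2 * norm x powr (- k - 2) * ((k + 2) / (norm x)\<^sup>2 * (x \<bullet> h)\<^sup>2 - (norm h)\<^sup>2) - C * norm h ^ 3
    \<le> norm (x + h) powr - k"
      using * pw[OF h(2)] by linarith
  qed
qed

lemma kernel_integrable:
  fixes z y :: "'a::euclidean_space"
  assumes "s < dist z y"
  shows "ball_integrable z s (\<lambda>v. norm (v - y) powr - k)"
  by (intro set_integrable_cball_cont continuous_intros) (use assms in \<open>auto simp: dist_commute\<close>)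

text \<open>The second-order term of the kernel has trace
  \<open>k / 2 * P * (k + 2 - DIM('a))\<close> with \<open>P = norm z powr (- k - 2)\<close>, and
  \<open>k + 2 - DIM('a) = 1/2\<close> makes it positive. The cubic error is absorbed by
  \<open>e\<close>, because \<open>msq\<close> is at least of the order of
  \<open>s\<^sup>2\<close>.\<close>

lemma kernel_avg:
  fixes z :: "'a::euclidean_space"
  assumes k: "k = DIM('a) - 3/2" "0 < k" and z: "z \<noteq> 0" and e: "0 < e"
  shows "\<forall>\<^sub>F s in at_right 0. norm z powr - k + msq TYPE('a) s * (k / 4 * norm z powr (- k - 2) - e)
    \<le> avg (\<lambda>v. norm v powr - k) z s"
proof -
  define P where "P = norm z powr (- k - 2)"
  obtain C where C: "0 \<le> C" "\<And>h. norm h \<le> 1 \<Longrightarrow> z + h \<noteq> 0 \<Longrightarrow>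
    norm z powr - k - k * P * (z \<bullet> h)
    + k / 2 * P * ((k + 2) / (norm z)\<^sup>2 * (z \<bullet> h)\<^sup>2 - (norm h)\<^sup>2) - C * norm h ^ 3
    \<le> norm (z + h) powr - k"
    using kernel_taylor_lower[OF z k(2)] unfolding P_def by blast
  define M where "M h v = k / 2 * P * ((k + 2) / (norm z)\<^sup>2 * ((z \<bullet> h) * (z \<bullet> v)) - h \<bullet> v)" for h v
  interpret M: quad M
  proof (rule quad.intro)
    have "bilinear (\<lambda>h v. c * (w * ((z \<bullet> h) * (z \<bullet> v)) - h \<bullet> v))" for c w
      unfolding bilinear_def linear_iff by (simp add: inner_simps algebra_simps)
    moreover have "M = (\<lambda>h v. (k / 2 * P) * ((k + 2) / (norm z)\<^sup>2 * ((z \<bullet> h) * (z \<bullet> v)) - h \<bullet> v))"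
      by (simp add: M_def fun_eq_iff)
    ultimately have "bilinear M" by (simp only:)
    then show "bounded_bilinear M" by (simp only: bilinear_conv_bounded_bilinear)
    show "M x y = M y x" for x y by (simp add: M_def inner_commute mult.commute)
  qed
  have tr: "M.tr = k / 4 * P"
  proof -
    have "M.tr = (\<Sum>i\<in>Basis. k / 2 * P * ((k + 2) / (norm z)\<^sup>2 * ((z \<bullet> i) * (z \<bullet> i)) - 1))"
      unfolding M.tr_def M_def by (intro sum.cong) auto
    also have "\<dots> = k / 2 * P * ((k + 2) / (norm z)\<^sup>2 * (\<Sum>i\<in>Basis. (z \<bullet> i) * (z \<bullet> i)) - DIM('a))"
      unfolding sum_distrib_left[symmetric] sum_subtractf by simp
    also have "(\<Sum>i\<in>Basis. (z \<bullet> i) * (z \<bullet> i)) = (norm z)\<^sup>2"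
      unfolding power2_norm_eq_inner by (rule euclidean_inner[symmetric])
    finally show ?thesis using z k(1) by simp
  qed
  \<comment> \<open>The three bounds keep \<open>h\<close> in the unit ball, keep the origin away
    from the ball around \<open>z\<close>, and make the cubic error at most
    \<open>e * msq TYPE('a) s\<close>.\<close>
  define s1 where "s1 = Min {1, norm z / 2, e / (8 * DIM('a) * (C + 1))}"
  have s1: "0 < s1" "s1 \<le> 1" "s1 \<le> norm z / 2" "s1 \<le> e / (8 * DIM('a) * (C + 1))"
    unfolding s1_def using z e C(1) by (auto simp del: divide_le_eq)
  have main: "norm z powr - k + msq TYPE('a) s * (k / 4 * P - e) \<le> avg (\<lambda>v. norm v powr - k) z s"
    if s: "0 < s" "s < s1" for s
  proof -
    have nz: "z + h \<noteq> 0" if "h \<in> cball 0 s" for h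
    proof
      assume "z + h = 0"
      then have "norm h = norm z" by (metis add_eq_0_iff norm_minus_cancel)
      then show False using that s s1 z by auto
    qed
    have i1: "ball_integrable 0 s (\<lambda>h. norm z powr - k + (- (k * P) *\<^sub>R z) \<bullet> (h - 0) + M (h - 0) (h - 0))"
      by (intro integrable_cball_UNIV continuous_intros M.continuous_quad)
    have i2: "ball_integrable (0::'a) s (\<lambda>h. C * s ^ 3)"
      by (intro integrable_cball_UNIV continuous_intros)
    have "norm z powr - k + msq TYPE('a) s * M.tr - C * s ^ 3 =
        avg (\<lambda>h. (norm z powr - k + (- (k * P) *\<^sub>R z) \<bullet> (h - 0) + M (h - 0) (h - 0)) - C * s ^ 3) 0 s"
      unfolding avg_diff[OF i1 i2] M.avg_quad[OF s(1)] avg_const[OF s(1)] ..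
    also have "\<dots> \<le> avg (\<lambda>h. norm (z + h) powr - k) 0 s"
    proof (rule avg_mono[OF s(1)])
      show "ball_integrable 0 s (\<lambda>h. norm (z + h) powr - k)"
        by (intro set_integrable_cball_cont continuous_intros) (use nz in auto)
      show "ball_integrable 0 s (\<lambda>h. (norm z powr - k + (- (k * P) *\<^sub>R z) \<bullet> (h - 0) + M (h - 0) (h - 0)) - C * s ^ 3)"
        by (rule set_integral_diff(1)[OF i1 i2])
      fix h :: 'a assume h: "h \<in> cball 0 s"
      have h1: "norm h \<le> 1" using h s s1 by auto
      have "C * norm h ^ 3 \<le> C * s ^ 3" using h C(1) by (intro mult_left_mono power_mono) auto
      then show "norm z powr - k + (- (k * P) *\<^sub>R z) \<bullet> (h - 0) + M (h - 0) (h - 0) - C * s ^ 3 \<le> norm (z + h) powr - k"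
        using C(2)[OF h1 nz[OF h]] unfolding M_def
        by (simp add: power2_norm_eq_inner[of h, symmetric] power2_eq_square[of "z \<bullet> h", symmetric])
    qed
    also have "\<dots> = avg (\<lambda>v. norm v powr - k) z s"
    proof (rule avg_trans[symmetric])
      show "ball_integrable z s (\<lambda>v. norm v powr - k)"
        using kernel_integrable[of s z 0 k] s s1 z by simp
    qed
    finally have 1: "norm z powr - k + msq TYPE('a) s * (k / 4 * P) - C * s ^ 3 \<le> avg (\<lambda>v. norm v powr - k) z s"
      unfolding tr .
    have "C * s ^ 3 \<le> ((C + 1) * s) * s\<^sup>2"
      using s C(1) by (simp add: power2_eq_square power3_eq_cube algebra_simps)
    also have "(C + 1) * s \<le> (C + 1) * (e / (8 * DIM('a) * (C + 1)))"
      using s s1 C(1) by (intro mult_left_mono) auto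
    then have "((C + 1) * s) * s\<^sup>2 \<le> ((C + 1) * (e / (8 * DIM('a) * (C + 1)))) * s\<^sup>2"
      by (intro mult_right_mono) auto
    also have "(C + 1) * (e / (8 * DIM('a) * (C + 1))) = e / (8 * DIM('a))"
      using C(1) nonzero_mult_div_cancel_left[of "C + 1" "e / (8 * DIM('a))"]
      unfolding divide_divide_eq_left[symmetric] times_divide_eq_right by linarith
    also have "e / (8 * DIM('a)) * s\<^sup>2 = e * (s\<^sup>2 / (8 * DIM('a)))" by simp
    also have "\<dots> \<le> e * msq TYPE('a) s" using e s by (intro mult_left_mono msq_lower) auto
    finally show ?thesis using 1 by (simp add: algebra_simps)
  qed
  show ?thesis unfolding eventually_at_right_field P_def[symmetric]
    using main s1(1) by blast
qed

section \<open>Kernel barriers below a touching paraboloid\<close>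

context contact
begin

text \<open>
  The defect \<open>par x1 g - u\<close> is nonnegative and almost superharmonic. If it exceeds \<open>l\<close> on balls around
  the points of \<open>Y\<close>, the minimum principle bounds it from below by a multiple of the kernel sum over
  \<open>Y\<close>, which is incompatible with its mean being \<open>O(r\<^sup>2)\<close> unless \<open>Y\<close> is small.
\<close>

lemma kernel_comparison:
  assumes dim: "2 \<le> DIM('a)" and c: "touches x1 g" and r: "0 < r" "cball x1 (8 * r) \<subseteq> cball z0 R"
    and b: "b \<in> Basis" and d: "0 < d" "d \<le> r"
    and Y: "finite Y" "separated (Basis - {b}) d Y" "Y \<subseteq> ball x1 (3 * r)"
    and l: "\<bar>tr\<bar> * r\<^sup>2 < l"
    and above: "\<And>y v. y \<in> Y \<Longrightarrow> v \<in> cball y d \<Longrightarrow>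
      u v \<le> ereal (par x1 g v - l)"
    and k: "k = DIM('a) - 3/2"
  defines "C2 \<equiv> \<bar>tr\<bar> * max (8 / k * 11 powr (k + 2)) (1 / (4 powr - k - 5 powr - k))"
  shows "real (card Y) * d ^ (DIM('a) - 1) * l \<le> 8 ^ DIM('a) * sqrt 11 * C2 * r ^ (DIM('a) + 1)"
proof -
  let ?N = "DIM('a) - 1"
  define m where "m = real (card Y)"
  define q where "q v = par x1 g v" for v
  define F where "F v = (\<Sum>y\<in>Y. norm (v - y) powr - k)" for v
  \<comment> \<open>Points of \<open>cball x1 (8 * r)\<close> are within
    \<open>8 * r + 3 * r\<close> of \<open>Y\<close>, so \<open>L\<close> is the bound of
    \<open>separated_kernel_sum\<close> for \<open>D = 11 * r\<close>. The scale \<open>c0\<close>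
    makes \<open>c0 * F\<close> at most \<open>l\<close> outside the balls around
    \<open>Y\<close>.\<close>
  define L where "L = 8 ^ DIM('a) * sqrt (11 * r)"
  define c0 where "c0 = l * d ^ ?N / L"
  \<comment> \<open>\<open>Y\<close> keeps distance \<open>5 * r\<close> from the sphere of radius
    \<open>8 * r\<close>; the added constant makes \<open>h\<close> at least \<open>q\<close>, hence
    at least \<open>u\<close>, on that sphere.\<close>
  define h where "h v = q v - c0 * (F v - m * (5 * r) powr - k)" for v
  have k0: "0 < k" using k dim by simp
  have l0: "0 < l" by (rule le_less_trans[OF _ l]) simp
  have L: "0 < L" using r by (simp add: L_def)
  have c0: "0 < c0" using L l0 d by (simp add: c0_def)
  have m0: "0 \<le> m" by (simp add: m_def)
  have dY: "dist v y \<le> 11 * r" if "v \<in> cball x1 (8 * r)" "y \<in> Y" for v y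
    using that Y(3) dist_triangle[of v y x1] by (force simp: dist_commute)
  have Fl: "c0 * F v \<le> l" if v: "v \<in> cball x1 (8 * r)" "\<And>y. y \<in> Y \<Longrightarrow> d \<le> dist v y" for v
  proof -
    have "(\<Sum>y\<in>Y. dist v y powr - k) * d ^ ?N \<le> L"
      unfolding L_def by (rule separated_kernel_sum[OF b d(1) _ k k0 Y(2)]) (use v dY d in auto)
    then have "F v * d ^ ?N \<le> L" by (simp add: F_def dist_norm)
    then have "l * (F v * d ^ ?N) / L \<le> l" using L l0 by (simp add: pos_divide_le_eq)
    then show ?thesis by (simp add: c0_def mult_ac)
  qed
  have qc: "continuous_on S q" for S unfolding q_def by (intro continuous_intros)
  define D where "D = cball x1 (8 * r) - (\<Union>y\<in>Y. ball y d)"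
  have Dsub: "D \<subseteq> cball z0 R" using r unfolding D_def by auto
  have compD: "compact D" unfolding D_def
    by (intro compact_diff compact_cball open_UN ballI open_ball)
  have hc: "continuous_on D h" unfolding h_def F_def
    by (intro continuous_intros qc) (use d in \<open>auto simp: D_def\<close>)
  have uq: "u v \<le> ereal (q v)" if "v \<in> cball x1 (8 * r)" for v
    unfolding q_def by (rule touches_le[OF c]) (use that r in auto)
  \<comment> \<open>The maximum in \<open>C2\<close> reflects two cases. If \<open>u \<le> h\<close>
    on \<open>D\<close>, the barrier lowers \<open>u\<close> throughout \<open>cball x1 r\<close>,
    which \<open>touches_avg\<close> limits. Otherwise \<open>u - h\<close> has a positive maximum
    in the interior of \<open>D\<close>, where the strictly subharmonic kernel cannot outweigh
    \<open>tr\<close>.\<close>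
  have c2: "c0 * m \<le> C2 * r powr (k + 2)"
  proof -
    have x1: "x1 \<in> D"
    proof -
      have "x1 \<notin> cball y d" if "y \<in> Y" for y
      proof
        assume "x1 \<in> cball y d"
        from above[OF that this] have "u x1 \<le> ereal (real_of_ereal (u x1) - l)" by (simp add: B.zero_left)
        then show False using c l0 unfolding touches_def by (cases "u x1") auto
      qed
      then show ?thesis using r by (auto simp: D_def intro: less_imp_le)
    qed
    have "\<exists>x\<in>D. \<bar>u x\<bar> \<noteq> \<infinity> \<and> (\<forall>v\<in>D. u v \<le> u x + ereal (h v - h x))"
      using c Dsub lt_top unfolding touches_def
      by (intro usc_touch[OF usc_on_subset[OF usc Dsub] compD hc x1]) auto
    then obtain x where x: "x \<in> D" "\<bar>u x\<bar> \<noteq> \<infinity>" and tch: "\<forall>v\<in>D. u v \<le> u x + ereal (h v - h x)"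
      by (elim bexE conjE)
    obtain U where U: "u x = ereal U" using x(2) by (cases "u x") auto
    show ?thesis
    proof (cases "U \<le> h x")
      case True
      have good: "u v \<le> ereal (h v)" if "v \<in> D" for v
      proof -
        have "u v \<le> ereal (U + (h v - h x))" using tch that U by auto
        also have "\<dots> \<le> ereal (h v)" using True by simp
        finally show ?thesis .
      qed
      define \<theta> where "\<theta> = 4 powr - k - 5 powr - k"
      have \<theta>: "0 < \<theta>" using k0 unfolding \<theta>_def by (simp add: powr_less_mono2_neg)
      \<comment> \<open>Near \<open>Y\<close> the drop below the paraboloid is \<open>l\<close>;
        elsewhere in \<open>cball x1 r\<close> distances to \<open>Y\<close> are at most
        \<open>4 * r\<close> and the barrier gives the other term. Since \<open>l\<close> exceeds
        \<bar>tr\<bar> \<open>r\<^sup>2\<close>, the bound on \<open>a\<close> falls on that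
        term.\<close>
      define a where "a = min l (c0 * (m * (r powr - k * \<theta>)))"
      have "a * (r / r) ^ DIM('a) \<le> \<bar>tr\<bar> * r\<^sup>2"
      proof (rule touches_avg[OF c r(1) _ r(1)])
        show "cball x1 r \<subseteq> cball z0 R"
          by (rule subset_trans[OF _ r(2)]) (use r in auto)
        fix v assume v: "v \<in> cball x1 r"
        then have v8: "v \<in> cball x1 (8 * r)" using r by auto
        have "u v \<le> ereal (q v - a)"
        proof (cases "\<exists>y\<in>Y. v \<in> cball y d")
          case True
          then have "u v \<le> ereal (q v - l)" using above unfolding q_def by blast
          also have "\<dots> \<le> ereal (q v - a)" by (simp add: a_def)
          finally show ?thesis .
        next
          case False
          then have vD: "v \<in> D" using v8 by (auto simp: D_def dist_commute intro: less_imp_le)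
          have "(\<Sum>y\<in>Y. (4 * r) powr - k) \<le> F v" unfolding F_def
          proof (intro sum_mono powr_mono2')
            fix y assume y: "y \<in> Y"
            show "0 < norm (v - y)" using False y d by (metis centre_in_cball right_minus_eq zero_less_norm_iff less_imp_le)
            have "dist v y \<le> dist v x1 + dist x1 y" by (rule dist_triangle)
            then show "norm (v - y) \<le> 4 * r" using v y Y(3) by (force simp: dist_norm norm_minus_commute)
          qed (use k0 in auto)
          then have "m * (4 * r) powr - k \<le> F v" by (simp add: m_def)
          moreover have "m * (r powr - k * \<theta>) = m * (4 * r) powr - k - m * (5 * r) powr - k"
            using r by (simp add: \<theta>_def powr_mult algebra_simps)
          ultimately have "m * (r powr - k * \<theta>) \<le> F v - m * (5 * r) powr - k" by simp
          then have "c0 * (m * (r powr - k * \<theta>)) \<le> c0 * (F v - m * (5 * r) powr - k)"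
            using c0 by (intro mult_left_mono) auto
          then have "h v \<le> q v - a" unfolding h_def a_def by linarith
          then show ?thesis using good[OF vD] by (meson ereal_less_eq(3) order_trans)
        qed
        then show "u v \<le> ereal (par x1 g v - a)"
          unfolding q_def .
      qed auto
      then have "a \<le> \<bar>tr\<bar> * r\<^sup>2" using r by simp
      then have "c0 * (m * (r powr - k * \<theta>)) \<le> \<bar>tr\<bar> * r\<^sup>2" using l unfolding a_def by linarith
      then have "(c0 * (m * (r powr - k * \<theta>))) * (r powr k / \<theta>) \<le> (\<bar>tr\<bar> * r\<^sup>2) * (r powr k / \<theta>)"
        using \<theta> by (intro mult_right_mono) auto
      also have "(c0 * (m * (r powr - k * \<theta>))) * (r powr k / \<theta>) = c0 * m * (r powr - k * r powr k)"
        using \<theta> by simp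
      also have "r powr - k * r powr k = 1" using r by (simp add: powr_add[symmetric])
      also have "(\<bar>tr\<bar> * r\<^sup>2) * (r powr k / \<theta>) = \<bar>tr\<bar> * (1 / \<theta>) * r powr (k + 2)"
        using r by (simp add: powr_add)
      also have "\<dots> \<le> C2 * r powr (k + 2)"
        unfolding C2_def \<theta>_def by (intro mult_right_mono mult_left_mono) auto
      finally show ?thesis by simp
    next
      case False
      \<comment> \<open>Boundary points are excluded: on the outer sphere
        \<open>u \<le> q \<le> h\<close>, and on the spheres around \<open>Y\<close>
        \<open>u \<le> q - l \<le> h\<close>.\<close>
      have "dist x1 x \<noteq> 8 * r"
      proof
        assume d: "dist x1 x = 8 * r"
        have "F x \<le> (\<Sum>y\<in>Y. (5 * r) powr - k)" unfolding F_def
        proof (intro sum_mono powr_mono2')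
          fix y assume "y \<in> Y"
          then show "5 * r \<le> norm (x - y)"
            using Y(3) d dist_triangle[of x1 x y] by (force simp: dist_norm norm_minus_commute)
        qed (use r k0 in auto)
        then have "F x \<le> m * (5 * r) powr - k" by (simp add: m_def)
        then have "c0 * (F x - m * (5 * r) powr - k) \<le> 0" using c0 by (intro mult_nonneg_nonpos) auto
        then have "q x \<le> h x" unfolding h_def by linarith
        moreover have "U \<le> q x" using uq[of x] x U by (auto simp: D_def)
        ultimately show False using False by linarith
      qed
      then have xin: "x \<in> ball x1 (8 * r)" using x(1) by (auto simp: D_def)
      have xY: "d < dist x y" if y: "y \<in> Y" for y
      proof (rule ccontr)
        assume "\<not> d < dist x y"
        then have "u x \<le> ereal (q x - l)" using above[OF y, of x] unfolding q_def by (simp add: dist_commute)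
        then have "U \<le> q x - l" using U by simp
        moreover have "c0 * F x \<le> l"
          by (rule Fl) (use x in \<open>auto simp: D_def dist_commute not_less\<close>)
        moreover have "0 \<le> c0 * (m * (5 * r) powr - k)" using c0 m0 by simp
        ultimately have "U \<le> h x" unfolding h_def by (simp add: algebra_simps)
        then show False using False by simp
      qed
      define V where "V = ball x1 (8 * r) - (\<Union>y\<in>Y. cball y d)"
      have "open V" unfolding V_def using Y(1) by (intro open_Diff closed_UN) auto
      moreover have "x \<in> V" using xin xY by (force simp: V_def dist_commute)
      ultimately obtain s2 where s2: "0 < s2" "cball x s2 \<subseteq> V" using open_contains_cball by blast
      have VD: "V \<subseteq> D" by (auto simp: V_def D_def intro: less_imp_le)
      \<comment> \<open>Half of the trace \<open>k / 4 * (11 * r) powr (- k - 2)\<close> guaranteed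
        at distance at most \<open>11 * r\<close>; the other half pays for the error term of
        \<open>kernel_avg\<close>.\<close>
      define e where "e = k / 8 * (11 * r) powr (- k - 2)"
      have e: "0 < e" using k0 r by (simp add: e_def)
      have ev: "\<forall>\<^sub>F s in at_right 0. \<forall>y\<in>Y. norm (x - y) powr - k + msq TYPE('a) s * e
          \<le> avg (\<lambda>v. norm v powr - k) (x - y) s"
      proof (intro eventually_ball_finite[OF Y(1)] ballI)
        fix y assume y: "y \<in> Y"
        then have "x - y \<noteq> 0" using xY[OF y] d by auto
        from kernel_avg[OF k k0 this e]
        show "\<forall>\<^sub>F s in at_right 0. norm (x - y) powr - k + msq TYPE('a) s * e
          \<le> avg (\<lambda>v. norm v powr - k) (x - y) s"
          using eventually_at_right_less[of "0::real"]
        proof eventually_elim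
          case (elim s)
          have "(11 * r) powr (- k - 2) \<le> norm (x - y) powr (- k - 2)"
            using dY[of x y] xin y k0 xY[OF y] d by (intro powr_mono2') (auto simp: dist_norm)
          then have "k / 4 * (11 * r) powr (- k - 2) \<le> k / 4 * norm (x - y) powr (- k - 2)"
            using k0 by (intro mult_left_mono) auto
          then have "e \<le> k / 4 * norm (x - y) powr (- k - 2) - e" unfolding e_def by simp
          then have "msq TYPE('a) s * e \<le> msq TYPE('a) s * (k / 4 * norm (x - y) powr (- k - 2) - e)"
            using msq_pos[where 'a='a, OF elim(2)] by (intro mult_left_mono) auto
          then show ?case using elim by linarith
        qed
      qed
      have evs: "\<forall>\<^sub>F s in at_right 0. s < s2 \<and> 0 < s" using s2
        by (auto simp: eventually_at_right_field intro!: exI[of _ s2])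
      obtain s where s: "0 < s" "s < s2" and
        kav: "\<And>y. y \<in> Y \<Longrightarrow> norm (x - y) powr - k + msq TYPE('a) s * e \<le> avg (\<lambda>v. norm v powr - k) (x - y) s"
        using eventually_happens'[OF trivial_limit_at_right_real eventually_conj[OF evs ev]] by blast
      have sV: "cball x s \<subseteq> V" using s2 s by (meson subset_cball less_imp_le order_trans)
      have sd: "s < dist x y" if y: "y \<in> Y" for y
      proof (rule ccontr)
        assume "\<not> s < dist x y"
        then have "y \<in> cball x s" by (simp add: dist_commute)
        then have "y \<in> V" using sV by blast
        then show False using y d unfolding V_def by (metis DiffD2 UN_I centre_in_cball less_imp_le)
      qed
      have ki: "ball_integrable x s (\<lambda>v. norm (v - y) powr - k)" if "y \<in> Y" for y
        by (rule kernel_integrable[OF sd[OF that]])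
      have shift: "avg (\<lambda>v. norm (v - y) powr - k) x s = avg (\<lambda>v. norm v powr - k) (x - y) s" if "y \<in> Y" for y
      proof -
        have "s < dist (x - y) 0" using sd[OF that] by (simp add: dist_norm)
        from kernel_integrable[OF this, of k]
        have "avg (\<lambda>v. norm v powr - k) (x - y) s = avg (\<lambda>v. norm (x - y + v) powr - k) 0 s"
          by (intro avg_trans) simp
        moreover have "avg (\<lambda>v. norm (v - y) powr - k) x s = avg (\<lambda>v. norm (x + v - y) powr - k) 0 s"
          by (rule avg_trans[OF ki[OF that]])
        ultimately show ?thesis by (simp add: algebra_simps)
      qed
      have Fi: "ball_integrable x s (\<lambda>v. c0 * F v)"
        unfolding F_def by (intro set_integrable_mult_right set_integrable_sum ki)
      have Favg: "F x + m * (msq TYPE('a) s * e) \<le> avg F x s"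
      proof -
        have "F x + m * (msq TYPE('a) s * e) = (\<Sum>y\<in>Y. norm (x - y) powr - k + msq TYPE('a) s * e)"
          by (simp add: F_def m_def sum.distrib)
        also have "\<dots> \<le> (\<Sum>y\<in>Y. avg (\<lambda>v. norm (v - y) powr - k) x s)"
          by (intro sum_mono) (simp add: shift kav)
        also have "\<dots> = avg F x s" unfolding F_def by (rule avg_sum_integrable[OF Y(1) ki s(1), symmetric])
        finally show ?thesis .
      qed
      \<comment> \<open>\<open>q\<close> up to a constant, recentred at \<open>x\<close> for
        \<open>avg_quad\<close>. Then \<open>G - c0 * F\<close> is the function
        \<open>U + (h v - h x)\<close> touching \<open>u\<close> at \<open>x\<close>.\<close>
      define G where "G v = (U + c0 * F x) + (g + 2 *\<^sub>R bv (x - x1)) \<bullet> (v - x) + B (v - x) (v - x)" for v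
      have Gq: "G v = U + c0 * F x + q v - q x" for v
      proof -
        have "B (v - x1) (v - x1) = B (v - x) (v - x) + 2 * ((v - x) \<bullet> bv (x - x1)) + B (x - x1) (x - x1)"
          using quad_add[of "v - x" "x - x1"] by (simp add: inner_bv)
        then show ?thesis unfolding G_def q_def
          by (simp add: inner_add_left inner_diff_right inner_commute[of _ "bv (x - x1)"])
      qed
      have Gi: "ball_integrable x s G" unfolding G_def
        by (intro integrable_cball_UNIV continuous_intros)
      have "u x \<le> ereal (avg (\<lambda>v. G v - c0 * F v) x s)"
      proof (rule submean_onD[OF submean s(1)])
        show "cball x s \<subseteq> cball z0 R" using sV VD Dsub by blast
        show "ball_integrable x s (\<lambda>v. G v - c0 * F v)" by (rule set_integral_diff(1)[OF Gi Fi])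
        fix v assume "v \<in> cball x s"
        then have "v \<in> D" using sV VD by blast
        then have "u v \<le> ereal (U + (h v - h x))" using tch U by auto
        also have "U + (h v - h x) = G v - c0 * F v" unfolding Gq h_def by (simp add: algebra_simps)
        finally show "u v \<le> ereal (G v - c0 * F v)" .
      qed
      also have "avg (\<lambda>v. G v - c0 * F v) x s = avg G x s - c0 * avg F x s"
        by (simp add: avg_diff[OF Gi Fi] avg_cmult)
      also have "avg G x s = U + c0 * F x + msq TYPE('a) s * tr"
        unfolding G_def by (rule avg_quad[OF s(1)])
      finally have "c0 * avg F x s \<le> c0 * F x + msq TYPE('a) s * tr" using U by simp
      moreover have "c0 * (F x + m * (msq TYPE('a) s * e)) \<le> c0 * avg F x s"
        using Favg c0 by (intro mult_left_mono) auto
      ultimately have "msq TYPE('a) s * (c0 * m * e) \<le> msq TYPE('a) s * tr" by (simp add: algebra_simps)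
      then have "c0 * m * e \<le> \<bar>tr\<bar>" using msq_pos[where 'a='a, OF s(1)] by (simp add: mult_le_cancel_left_pos)
      then have "c0 * m * e / e \<le> \<bar>tr\<bar> / e" using e by (intro divide_right_mono) auto
      then have "c0 * m \<le> \<bar>tr\<bar> / e" using e by simp
      also have "\<bar>tr\<bar> / e = \<bar>tr\<bar> * (8 / k * 11 powr (k + 2)) * r powr (k + 2)"
      proof -
        have "(11 * r) powr (- k - 2) = 1 / (11 * r) powr (k + 2)"
          using powr_minus_divide[of "11 * r" "k + 2"] by simp
        then show ?thesis using k0 r by (simp add: e_def powr_mult)
      qed
      also have "\<dots> \<le> C2 * r powr (k + 2)"
        unfolding C2_def by (intro mult_right_mono mult_left_mono) auto
      finally show ?thesis .
    qed
  qed
  have "m * d ^ ?N * l = L * (c0 * m)" using L by (simp add: c0_def)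
  also have "\<dots> \<le> L * (C2 * r powr (k + 2))" using c2 L by (intro mult_left_mono) auto
  also have "\<dots> = 8 ^ DIM('a) * sqrt 11 * C2 * (sqrt r * r powr (k + 2))"
    by (simp add: L_def real_sqrt_mult)
  also have "sqrt r * r powr (k + 2) = r ^ (DIM('a) + 1)"
  proof -
    have "sqrt r * r powr (k + 2) = r powr (1/2 + (k + 2))"
      using r by (simp only: powr_add powr_half_sqrt)
    also have "1/2 + (k + 2) = real (DIM('a) + 1)" using k by simp
    finally show ?thesis using r by (simp only: powr_realpow)
  qed
  finally show ?thesis unfolding m_def .
qed

end

section \<open>Partial derivatives at contact points\<close>

context contact
begin

text \<open>The constant of \<open>kernel_comparison\<close> for \<open>k = DIM('a) - 3/2\<close>,
  times the power of 2 in the volume \<open>8 * r * (2 * d) ^ (DIM('a) - 1)\<close> of the covering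
  boxes.\<close>

definition sweep_const :: real where
  "sweep_const = 2 ^ (DIM('a) + 2) * (8 ^ DIM('a) * sqrt 11 *
     (\<bar>tr\<bar> * max (8 / (DIM('a) - 3/2) * 11 powr (DIM('a) - 3/2 + 2))
       (1 / (4 powr - (DIM('a) - 3/2) - 5 powr - (DIM('a) - 3/2)))))"

text \<open>
  The separated points of \<open>kernel_comparison\<close> need balls of a common radius inside the open set \<open>A\<close>;
  therefore \<open>A\<close> is exhausted by the sets \<open>Ak k\<close>.
\<close>

lemma sweep_measure:
  assumes dim: "2 \<le> DIM('a)" and c: "touches x1 g" and r: "0 < r" "cball x1 (8 * r) \<subseteq> cball z0 R"
    and b: "b \<in> Basis" and l: "\<bar>tr\<bar> * r\<^sup>2 < l"
  defines "A \<equiv> {v \<in> ball x1 (3 * r). u v < ereal (par x1 g v - l)}"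
  defines "S \<equiv> {x \<in> ball x1 r. \<exists>t. \<bar>t\<bar> \<le> r \<and> x + t *\<^sub>R b \<in> A}"
  shows "S \<in> lmeasurable" "measure lebesgue S \<le> sweep_const * r ^ (DIM('a) + 2) / l"
proof -
  let ?N = "DIM('a) - 1"
  define q where "q v = par x1 g v" for v
  have l0: "0 < l" by (rule le_less_trans[OF _ l]) simp
  have "ball x1 (3 * r) \<subseteq> cball x1 (8 * r)" using r(1) by auto
  then have b3: "ball x1 (3 * r) \<subseteq> cball z0 R" using r(2) by blast
  have openA: "open A"
  proof -
    have "open {v \<in> ball x1 (3 * r). u v + ereal (- (q v - l)) < 0}"
      by (intro usc_on_open_sublevel usc_on_add usc_on_subset[OF usc b3])
        (auto simp: q_def intro!: continuous_intros)
    also have "{v \<in> ball x1 (3 * r). u v + ereal (- (q v - l)) < 0} = A"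
    proof -
      have "(u v + ereal (- (q v - l)) < 0) = (u v < ereal (q v - l))" for v
        by (cases "u v") auto
      then show ?thesis unfolding A_def q_def by simp
    qed
    finally show ?thesis .
  qed
  have sweep_open: "open {x \<in> ball x1 r. \<exists>t. \<bar>t\<bar> \<le> r \<and> x + t *\<^sub>R b \<in> V}" if "open V" for V
  proof -
    have "{x \<in> ball x1 r. \<exists>t. \<bar>t\<bar> \<le> r \<and> x + t *\<^sub>R b \<in> V} = ball x1 r \<inter> (\<Union>t\<in>{t. \<bar>t\<bar> \<le> r}. (\<lambda>x. x + t *\<^sub>R b) -` V)"
      by auto
    also have "open \<dots>"
      by (intro open_Int open_UN ballI open_vimage that continuous_intros open_ball)
    finally show ?thesis .
  qed
  have sweep_lm: "{x \<in> ball x1 r. \<exists>t. \<bar>t\<bar> \<le> r \<and> x + t *\<^sub>R b \<in> V} \<in> lmeasurable" if "open V" for V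
    by (rule lmeasurable_open[OF _ sweep_open[OF that]]) (rule bounded_subset[OF bounded_ball[of x1 r]], auto)
  show "S \<in> lmeasurable" unfolding S_def by (rule sweep_lm[OF openA])
  have A_sub: "A \<subseteq> ball x1 (3 * r)" by (auto simp: A_def)
  have ne: "- A \<noteq> {}"
  proof
    assume "- A = {}"
    then have "UNIV \<subseteq> ball x1 (3 * r)" using A_sub by auto
    then show False using bounded_subset[OF bounded_ball] not_bounded_UNIV by blast
  qed
  define Ak where "Ak k = {v. 1 / real (Suc k) < infdist v (- A)}" for k
  have Ak_cball: "cball v (1 / real (Suc k)) \<subseteq> A" if "v \<in> Ak k" for v k
  proof
    fix w assume w: "w \<in> cball v (1 / real (Suc k))"
    show "w \<in> A"
    proof (rule ccontr)
      assume "w \<notin> A"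
      then have "infdist v (- A) \<le> dist v w" by (intro infdist_le) auto
      then show False using w that unfolding Ak_def by auto
    qed
  qed
  have Ak_A: "Ak k \<subseteq> A" for k using Ak_cball[of _ k] by (meson centre_in_cball divide_nonneg_nonneg of_nat_0_le_iff subsetD subsetI zero_le_one)
  have openAk: "open (Ak k)" for k
    unfolding Ak_def by (intro open_Collect_less continuous_intros)
  have mono: "Ak k \<subseteq> Ak m" if "k \<le> m" for k m
  proof -
    have "1 / real (Suc m) \<le> 1 / real (Suc k)" using that by (simp add: frac_le)
    then show ?thesis unfolding Ak_def by auto
  qed
  have un: "(\<Union>k. Ak k) = A"
  proof
    show "(\<Union>k. Ak k) \<subseteq> A" using Ak_A by blast
    show "A \<subseteq> (\<Union>k. Ak k)"
    proof
      fix v assume "v \<in> A"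
      then have "0 < infdist v (- A)"
        using infdist_pos_not_in_closed[of "- A" v] openA ne by auto
      then obtain n where "1 / real (Suc n) < infdist v (- A)"
        using reals_Archimedean by (metis inverse_eq_divide)
      then show "v \<in> (\<Union>k. Ak k)" unfolding Ak_def by auto
    qed
  qed
  define Sk where "Sk k = {x \<in> ball x1 r. \<exists>t. \<bar>t\<bar> \<le> r \<and> x + t *\<^sub>R b \<in> Ak k}" for k
  have Sk_lm: "Sk k \<in> lmeasurable" for k unfolding Sk_def by (rule sweep_lm[OF openAk])
  have Sun: "(\<Union>k. Sk k) = S" unfolding Sk_def S_def un[symmetric] by blast
  have bound: "measure lebesgue (Sk k) \<le> sweep_const * r ^ (DIM('a) + 2) / l" for k
  proof -
    \<comment> \<open>The first bound keeps balls of radius \<open>d\<close> around points of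
      \<open>Ak k\<close> inside \<open>A\<close>; the second meets the condition
      \<open>d \<le> r\<close> of \<open>kernel_comparison\<close>.\<close>
    define d where "d = min (1 / real (Suc k)) r"
    have d: "0 < d" "d \<le> r" "d \<le> 1 / real (Suc k)" using r by (auto simp: d_def simp del: of_nat_Suc)
    have bA: "bounded (Ak k)" by (rule bounded_subset[OF bounded_ball]) (use Ak_A A_sub in blast)
    obtain Y where Y: "finite Y" "Y \<subseteq> Ak k" "separated (Basis - {b}) d Y"
      "\<And>x. x \<in> Ak k \<Longrightarrow> \<exists>y\<in>Y. \<forall>i\<in>Basis - {b}. \<bar>(x - y) \<bullet> i\<bar> < d"
      using maximal_separated[of "Basis - {b}" d "Ak k"] d(1) bA by (metis Diff_subset finite_Basis finite_Diff)
    have m: "real (card Y) * d ^ ?N * l * 2 ^ (DIM('a) + 2) \<le> sweep_const * r ^ (DIM('a) + 1)"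
    proof -
      have "real (card Y) * d ^ ?N * l \<le> sweep_const / 2 ^ (DIM('a) + 2) * r ^ (DIM('a) + 1)"
      proof -
        have sub: "Y \<subseteq> ball x1 (3 * r)" using Y(2) Ak_A A_sub by blast
        have above: "u v \<le> ereal (par x1 g v - l)"
          if "y \<in> Y" "v \<in> cball y d" for y v
        proof -
          have "v \<in> A" using that Ak_cball[of y k] Y(2) d(3) by (meson subsetD subset_cball)
          then show ?thesis unfolding A_def by auto
        qed
        have "sweep_const / 2 ^ (DIM('a) + 2) = 8 ^ DIM('a) * sqrt 11 *
          (\<bar>tr\<bar> * max (8 / (DIM('a) - 3/2) * 11 powr (DIM('a) - 3/2 + 2))
            (1 / (4 powr - (DIM('a) - 3/2) - 5 powr - (DIM('a) - 3/2))))"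
          unfolding sweep_const_def by (rule nonzero_mult_div_cancel_left) simp
        then show ?thesis
          using kernel_comparison[OF dim c r b d(1,2) Y(1,3) sub l above refl] by (simp only:)
      qed
      then show ?thesis by (simp add: field_simps)
    qed
    \<comment> \<open>Shifting along \<open>b\<close> leaves the other coordinates alone, so they
      stay within \<open>d\<close> of those of \<open>y\<close>. Along \<open>b\<close> the crude
      distance \<open>r + 3 * r\<close> suffices.\<close>
    define w where "w = (\<Sum>i\<in>Basis. (if i = b then 4 * r else d) *\<^sub>R i)"
    have w: "w \<bullet> i = (if i = b then 4 * r else d)" if "i \<in> Basis" for i
      using that by (simp add: w_def)
    have cov: "Sk k \<subseteq> (\<Union>y\<in>Y. cbox (y - w) (y + w))"
    proof
      fix x assume "x \<in> Sk k"
      then obtain t where x: "x \<in> ball x1 r" "\<bar>t\<bar> \<le> r" "x + t *\<^sub>R b \<in> Ak k" unfolding Sk_def by blast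
      obtain y where y: "y \<in> Y" "\<forall>i\<in>Basis - {b}. \<bar>(x + t *\<^sub>R b - y) \<bullet> i\<bar> < d" using Y(4)[OF x(3)] by blast
      have "\<bar>(x - y) \<bullet> i\<bar> \<le> w \<bullet> i" if i: "i \<in> Basis" for i
      proof (cases "i = b")
        case True
        have "y \<in> ball x1 (3 * r)" using y(1) Y(2) Ak_A A_sub by blast
        then have "norm (x - y) \<le> 4 * r" using x(1) dist_triangle3[of x y x1] by (auto simp: dist_norm)
        then show ?thesis using True w[OF i] Basis_le_norm[OF i, of "x - y"] by auto
      next
        case False
        then have "(x + t *\<^sub>R b - y) \<bullet> i = (x - y) \<bullet> i"
          using b i by (simp add: inner_simps inner_not_same_Basis)
        moreover have "\<bar>(x + t *\<^sub>R b - y) \<bullet> i\<bar> < d" using y(2) False i by blast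
        ultimately show ?thesis using False w[OF i] by simp
      qed
      then have "x \<in> cbox (y - w) (y + w)" 
        unfolding mem_box by (force simp: inner_simps abs_le_iff)
      then show "x \<in> (\<Union>y\<in>Y. cbox (y - w) (y + w))" using y(1) by blast
    qed
    have box: "measure lebesgue (cbox (y - w) (y + w)) = 8 * r * (2 * d) ^ ?N" for y
    proof -
      have "measure lebesgue (cbox (y - w) (y + w)) = measure lborel (cbox (y - w) (y + w))"
        by (rule measure_completion) simp
      also have "\<dots> = (\<Prod>i\<in>Basis. 2 * (w \<bullet> i))"
        using w r d by (subst content_cbox') (auto simp: box_ne_empty inner_simps intro!: prod.cong)
      also have "\<dots> = (\<Prod>i\<in>Basis. if i = b then 8 * r else 2 * d)" using w by (intro prod.cong) auto
      also have "\<dots> = 8 * r * (\<Prod>i\<in>Basis - {b}. if i = b then 8 * r else 2 * d)"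
        using b by (subst prod.remove[of _ b]) auto
      also have "(\<Prod>i\<in>Basis - {b}. if i = b then 8 * r else 2 * d) = (\<Prod>i\<in>Basis - {b}. 2 * d)"
        by (intro prod.cong) auto
      also have "\<dots> = (2 * d) ^ ?N" using b by (simp add: card_Diff_singleton)
      finally show ?thesis .
    qed
    have "measure lebesgue (Sk k) \<le> measure lebesgue (\<Union>y\<in>Y. cbox (y - w) (y + w))"
      using Sk_lm[of k] Y(1) by (intro measure_mono_fmeasurable cov) (auto intro!: fmeasurable.finite_UN)
    also have "\<dots> \<le> (\<Sum>y\<in>Y. measure lebesgue (cbox (y - w) (y + w)))"
      using Y(1) by (intro measure_UNION_le) auto
    also have "\<dots> = real (card Y) * (8 * r * (2 * d) ^ ?N)" by (simp add: box)
    also have "\<dots> = (real (card Y) * d ^ ?N * l * 2 ^ (DIM('a) + 2)) * r / l"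
    proof -
      have "DIM('a) + 2 = 3 + ?N" using dim by simp
      then have e: "(2::real) ^ (DIM('a) + 2) = 2 ^ 3 * 2 ^ ?N" by (simp only: power_add)
      show ?thesis unfolding e using l0 by (simp add: power_mult_distrib)
    qed
    also have "\<dots> \<le> (sweep_const * r ^ (DIM('a) + 1)) * r / l"
      using l0 r by (intro divide_right_mono mult_right_mono m) auto
    finally show ?thesis by (simp add: mult_ac)
  qed
  have "(\<lambda>k. measure lebesgue (Sk k)) \<longlonglongrightarrow> measure lebesgue (\<Union>k. Sk k)"
  proof (rule Lim_measure_incseq)
    show "range Sk \<subseteq> sets lebesgue" using Sk_lm by blast
    show "incseq Sk" unfolding incseq_def Sk_def using mono by blast
    show "emeasure lebesgue (\<Union>k. Sk k) \<noteq> \<infinity>"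
      using \<open>S \<in> lmeasurable\<close> unfolding Sun fmeasurable_def by auto
  qed
  then show "measure lebesgue S \<le> sweep_const * r ^ (DIM('a) + 2) / l"
    unfolding Sun by (rule LIMSEQ_le_const2) (use bound in auto)
qed

text \<open>The value of \<open>par x g\<close> at \<open>x + t *\<^sub>R b\<close>, expanded in
  \<open>t\<close>.\<close>

abbreviation ray :: "'a \<Rightarrow> 'a \<Rightarrow> 'a \<Rightarrow> real \<Rightarrow> real" where
  "ray x g b t \<equiv> real_of_ereal (u x) + t * (g \<bullet> b) + t\<^sup>2 * B b b"

text \<open>The number of net points is at most \<open>(4 * R * DIM('a) / r) ^ DIM('a)\<close>, and
  the factor 4 comes from \<open>l = e * r / 4\<close>.\<close>

definition cover_const :: real where "cover_const = 4 * sweep_const * (4 * R * DIM('a)) ^ DIM('a)"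

lemma sweep_const_nonneg: assumes "2 \<le> DIM('a)" shows "0 \<le> sweep_const"
proof -
  have "0 < DIM('a) - 3/2" using assms by simp
  then have "0 \<le> 8 / (DIM('a) - 3/2) * 11 powr (DIM('a) - 3/2 + 2)" by (intro mult_nonneg_nonneg) auto
  then show ?thesis unfolding sweep_const_def by (intro mult_nonneg_nonneg) (auto simp: le_max_iff_disj)
qed

text \<open>Near a net point \<open>x1\<close> its paraboloid replaces that of \<open>x\<close>: it
  lies above \<open>u\<close> at \<open>x\<close>, and the slopes differ by at most
  \<open>lip_const * r\<close>. The exchange costs at most \<open>e * r / 4\<close>, so half of the
  drop \<open>e * r / 2\<close> is left and \<open>x\<close> lies in the sweep belonging to
  \<open>x1\<close>. A number of net points of order \<open>r\<close> to the power
  \<open>- DIM('a)\<close>, with sweeps of measure of order \<open>r ^ (DIM('a) + 1) / e\<close>,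
  leaves one factor \<open>r\<close>.\<close>

lemma bad_cover:
  assumes dim: "2 \<le> DIM('a)" and b: "b \<in> Basis" and r: "0 < r" "r \<le> R / 16"
    and e: "0 < e" "4 * lip_const * r \<le> e" "4 * \<bar>tr\<bar> * r < e"
  shows "\<exists>T\<in>lmeasurable. {x \<in> K. \<exists>g t. touches x g \<and> \<bar>t\<bar> \<le> r \<and>
      u (x + t *\<^sub>R b) < ereal (ray x g b t - e * r / 2)} \<subseteq> T
    \<and> measure lebesgue T \<le> cover_const * r / e"
proof -
  \<comment> \<open>With all coordinates closer than \<open>d\<close>, \<open>norm_le_l1\<close>
    gives a distance below \<open>r\<close>.\<close>
  define d where "d = r / DIM('a)"
  have d: "0 < d" using r by (simp add: d_def)
  have dR: "d \<le> R"
  proof -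
    have "r / DIM('a) \<le> r / 1" using r dim by (intro divide_left_mono) auto
    then show ?thesis using r R by (simp add: d_def)
  qed
  have Ksub: "K \<subseteq> cball z0 (R/8)" by (auto simp: K_def)
  have bK: "bounded K" by (rule bounded_subset[OF bounded_cball Ksub])
  obtain X where X: "finite X" "X \<subseteq> K" "separated Basis d X"
    "\<And>x. x \<in> K \<Longrightarrow> \<exists>y\<in>X. \<forall>i\<in>Basis. \<bar>(x - y) \<bullet> i\<bar> < d"
    using maximal_separated[of Basis d K] d bK by (metis finite_Basis order_refl)
  have cardX: "real (card X) \<le> (4 * R * DIM('a) / r) ^ DIM('a)"
  proof -
    have "real (card X) \<le> (4 * R / d) ^ card (Basis :: 'a set)"
    proof (rule separated_card(2)[OF X(3) finite_Basis d dR])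
      fix y i :: 'a assume "y \<in> X" "i \<in> Basis"
      then show "\<bar>(y - z0) \<bullet> i\<bar> \<le> R" using Basis_le_norm[of i "y - z0"] X(2) Ksub R
        by (force simp: dist_norm norm_minus_commute)
    qed
    then show ?thesis by (simp add: d_def)
  qed
  define l where "l = e * r / 4"
  have l: "\<bar>tr\<bar> * r\<^sup>2 < l" using mult_strict_right_mono[OF e(3) r(1)] by (simp add: l_def power2_eq_square)
  define G where "G x = (SOME g. touches x g)" for x
  have G: "touches x (G x)" if "x \<in> K" for x
    using that unfolding K_def G_def by (auto intro: someI_ex)
  define A where "A x1 = {v \<in> ball x1 (3 * r). u v < ereal (par x1 (G x1) v - l)}" for x1
  define S where "S x1 = {x \<in> ball x1 r. \<exists>t. \<bar>t\<bar> \<le> r \<and> x + t *\<^sub>R b \<in> A x1}" for x1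
  have sub: "cball x1 (8 * r) \<subseteq> cball z0 R" if "x1 \<in> K" for x1
  proof
    fix v assume "v \<in> cball x1 (8 * r)"
    then show "v \<in> cball z0 R" using that Ksub r dist_triangle[of z0 v x1] by force
  qed
  have Sm: "S x1 \<in> lmeasurable" "measure lebesgue (S x1) \<le> sweep_const * r ^ (DIM('a) + 2) / l" if "x1 \<in> K" for x1
    using sweep_measure[OF dim G[OF that] r(1) sub[OF that] b l] unfolding S_def A_def by auto
  show ?thesis
  proof (intro bexI[of _ "\<Union>x1\<in>X. S x1"] conjI subsetI)
    show "(\<Union>x1\<in>X. S x1) \<in> lmeasurable" using X(1,2) Sm(1) by (intro fmeasurable.finite_UN) auto
    have "measure lebesgue (\<Union>x1\<in>X. S x1) \<le> (\<Sum>x1\<in>X. measure lebesgue (S x1))"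
      using X(1,2) Sm(1) by (intro measure_UNION_le) auto
    also have "\<dots> \<le> real (card X) * (sweep_const * r ^ (DIM('a) + 2) / l)"
      using X(2) Sm(2) by (intro sum_bounded_above) auto
    also have "\<dots> \<le> (4 * R * DIM('a) / r) ^ DIM('a) * (sweep_const * r ^ (DIM('a) + 2) / l)"
      using sweep_const_nonneg[OF dim] r e by (intro mult_right_mono cardX) (auto simp: l_def)
    also have "\<dots> = cover_const * r / e"
      using r e(1) by (simp add: cover_const_def l_def power_divide power_add power2_eq_square field_simps)
    finally show "measure lebesgue (\<Union>x1\<in>X. S x1) \<le> cover_const * r / e" .
    fix x assume "x \<in> {x \<in> K. \<exists>g t. touches x g \<and> \<bar>t\<bar> \<le> r \<and>
      u (x + t *\<^sub>R b) < ereal (ray x g b t - e * r / 2)}"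
    then obtain g t where x: "x \<in> K" and g: "touches x g" and t: "\<bar>t\<bar> \<le> r"
      and lt: "u (x + t *\<^sub>R b) < ereal (ray x g b t - e * r / 2)" by blast
    obtain x1 where x1: "x1 \<in> X" "\<forall>i\<in>Basis. \<bar>(x - x1) \<bullet> i\<bar> < d" using X(4)[OF x] by blast
    have x1K: "x1 \<in> K" using x1 X(2) by blast
    have d: "norm (x - x1) < r"
    proof -
      have "norm (x - x1) \<le> (\<Sum>i\<in>Basis. \<bar>(x - x1) \<bullet> i\<bar>)" by (rule norm_le_l1)
      also have "\<dots> < (\<Sum>i\<in>(Basis::'a set). d)" using x1(2) by (intro sum_strict_mono) auto
      also have "\<dots> = r" by (simp add: d_def)
      finally show ?thesis .
    qed
    define y where "y = x + t *\<^sub>R b"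
    have yx: "norm (y - x) \<le> r" using t b by (simp add: y_def)
    have y3: "y \<in> ball x1 (3 * r)"
      using yx d norm_triangle_ineq[of "y - x" "x - x1"] r by (simp add: dist_norm norm_minus_commute)
    define d1 where "d1 = (G x1 - 2 *\<^sub>R bv x1) - (g - 2 *\<^sub>R bv x)"
    have "norm d1 \<le> lip_const * dist x1 x"
      unfolding d1_def by (rule touches_lipschitz[OF G[OF x1K] g]) (use x x1K Ksub in auto)
    also have "\<dots> \<le> lip_const * r" using d lip_const_nonneg by (intro mult_left_mono) (auto simp: dist_norm norm_minus_commute)
    finally have d1: "norm d1 \<le> lip_const * r" .
    have "- (d1 \<bullet> (y - x)) \<le> norm d1 * norm (y - x)" using Cauchy_Schwarz_ineq2[of d1 "y - x"] by linarith
    also have "\<dots> \<le> (lip_const * r) * r" using d1 yx lip_const_nonneg r by (intro mult_mono) auto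
    also have "\<dots> \<le> l" using mult_right_mono[OF e(2), of r] r by (simp add: l_def)
    finally have d1': "- l \<le> d1 \<bullet> (y - x)" by simp
    have xR: "x \<in> cball z0 R" using x Ksub R by force
    have ux: "real_of_ereal (u x) \<le> par x1 (G x1) x"
      using touches_le[OF G[OF x1K] xR] g unfolding touches_def by (cases "u x") auto
    have e1: "B (y - x1) (y - x1) = B (y - x) (y - x) + 2 * B (y - x) (x - x1) + B (x - x1) (x - x1)"
      using quad_add[of "y - x" "x - x1"] by simp
    have e2: "B (y - x) (x - x1) = (y - x) \<bullet> bv x - (y - x) \<bullet> bv x1"
      by (simp add: inner_bv B.diff_right)
    have e3: "d1 \<bullet> (y - x) = G x1 \<bullet> (y - x) - g \<bullet> (y - x) - 2 * ((y - x) \<bullet> bv x1) + 2 * ((y - x) \<bullet> bv x)"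
      unfolding d1_def by (simp add: inner_diff_left inner_commute[of _ "bv _"])
    have e4: "G x1 \<bullet> (y - x1) = G x1 \<bullet> (y - x) + G x1 \<bullet> (x - x1)" by (simp add: inner_diff_right)
    have e5: "t * (g \<bullet> b) + t\<^sup>2 * B b b = g \<bullet> (y - x) + B (y - x) (y - x)"
      by (simp add: y_def B.scaleR_left B.scaleR_right power2_eq_square)
    have "ray x g b t - e * r / 2
      \<le> par x1 (G x1) y - l"
      using ux e1 e2 e3 e4 e5 d1' unfolding l_def by linarith
    then have "u y < ereal (par x1 (G x1) y - l)"
      using lt unfolding y_def[symmetric] by (meson ereal_less_eq(3) less_le_trans)
    then have "y \<in> A x1" using y3 unfolding A_def by blast
    then have "x \<in> S x1" unfolding S_def using d t by (auto simp: y_def dist_norm norm_minus_commute)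
    then show "x \<in> (\<Union>x1\<in>X. S x1)" using x1(1) by blast
  qed
qed

text \<open>A Borel-Cantelli argument over the radii \<open>c / 2 ^ j\<close>: the measures in \<open>bad_cover\<close> are summable.\<close>

lemma bad_negligible:
  assumes dim: "2 \<le> DIM('a)" and b: "b \<in> Basis" and e: "0 < e"
  shows "negligible {x \<in> K. \<exists>g. touches x g \<and> (\<forall>d>0. \<exists>t. 0 < \<bar>t\<bar> \<and> \<bar>t\<bar> < d \<and>
      u (x + t *\<^sub>R b) < ereal (ray x g b t - e * \<bar>t\<bar>))}"
    (is "negligible ?N")
  unfolding negligible_outer_le
proof (intro allI impI)
  fix m :: real assume m: "0 < m"
  \<comment> \<open>The first three entries meet the hypotheses of \<open>bad_cover\<close> at all
    radii up to \<open>c\<close>; the last makes the geometric sum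
    \<open>2 * cover_const * c / e\<close> of the measures at most \<open>m\<close>.\<close>
  define c where "c = Min {R / 16, e / (4 * (lip_const + 1)), e / (8 * (\<bar>tr\<bar> + 1)), m * e / (2 * (cover_const + 1))}"
  have cover_const: "0 \<le> cover_const" using sweep_const_nonneg[OF dim] R unfolding cover_const_def by (intro mult_nonneg_nonneg) auto
  have c: "0 < c" "c \<le> R / 16" "c \<le> e / (4 * (lip_const + 1))" "c \<le> e / (8 * (\<bar>tr\<bar> + 1))" "c \<le> m * e / (2 * (cover_const + 1))"
  proof -
    have "0 < R / 16" "0 < e / (4 * (lip_const + 1))" "0 < e / (8 * (\<bar>tr\<bar> + 1))" "0 < m * e / (2 * (cover_const + 1))"
      using R e m cover_const lip_const_nonneg by (auto intro!: divide_pos_pos)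
    then show "0 < c" unfolding c_def by (subst Min_gr_iff) auto
  qed (simp_all add: c_def min.coboundedI1 min.coboundedI2 del: divide_le_eq le_divide_eq le_divide_eq_numeral1)
  define r where "r j = c * (1/2) ^ j" for j :: nat
  have r: "0 < r j" "r j \<le> c" for j
    using c(1) power_le_one[of "1/2::real" j] by (auto simp: r_def mult_le_cancel_left1)
  define Bd where "Bd j = {x \<in> K. \<exists>g t. touches x g \<and> \<bar>t\<bar> \<le> r j \<and>
      u (x + t *\<^sub>R b) < ereal (ray x g b t - e * r j / 2)}" for j
  have ex: "\<exists>T\<in>lmeasurable. Bd j \<subseteq> T
    \<and> measure lebesgue T \<le> cover_const * r j / e" for j
    unfolding Bd_def
  proof (rule bad_cover[OF dim b r(1) _ e])
    show "r j \<le> R / 16" using r(2)[of j] c by linarith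
    have "(4 * (lip_const + 1)) * r j \<le> (4 * (lip_const + 1)) * (e / (4 * (lip_const + 1)))"
      using r(2)[of j] c lip_const_nonneg by (intro mult_left_mono) auto
    also have "\<dots> = e" using lip_const_nonneg by simp
    finally show "4 * lip_const * r j \<le> e" using r(1)[of j] by (simp add: algebra_simps)
    have "(8 * (\<bar>tr\<bar> + 1)) * r j \<le> (8 * (\<bar>tr\<bar> + 1)) * (e / (8 * (\<bar>tr\<bar> + 1)))"
      using r(2)[of j] c by (intro mult_left_mono) auto
    also have "\<dots> = e" by simp
    finally have "8 * \<bar>tr\<bar> * r j + 8 * r j \<le> e" by (simp add: algebra_simps)
    moreover have "0 \<le> \<bar>tr\<bar> * r j" using r(1)[of j] by simp
    ultimately show "4 * \<bar>tr\<bar> * r j < e" using r(1)[of j] by linarith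
  qed
  define T where "T j = (SOME T. T \<in> lmeasurable \<and> Bd j \<subseteq> T \<and> measure lebesgue T \<le> cover_const * r j / e)" for j
  have "T j \<in> lmeasurable \<and> Bd j \<subseteq> T j \<and> measure lebesgue (T j) \<le> cover_const * r j / e" for j
    unfolding T_def by (rule someI_ex) (use ex[of j] in blast)
  then have T: "\<And>j. T j \<in> lmeasurable" "\<And>j. Bd j \<subseteq> T j" "\<And>j. measure lebesgue (T j) \<le> cover_const * r j / e" by blast+
  have fin: "measure lebesgue (\<Union>j\<in>I. T j) \<le> m" if "finite I" for I
  proof -
    have "measure lebesgue (\<Union>j\<in>I. T j) \<le> (\<Sum>j\<in>I. measure lebesgue (T j))"
      using that T(1) by (intro measure_UNION_le) auto
    also have "\<dots> \<le> (\<Sum>j\<in>I. cover_const * r j / e)" by (intro sum_mono T(3))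
    also have "\<dots> = cover_const * c / e * (\<Sum>j\<in>I. (1/2) ^ j)" by (simp add: r_def sum_distrib_left mult.assoc)
    also have "\<dots> \<le> cover_const * c / e * 2"
    proof (rule mult_left_mono)
      have "(\<Sum>j\<in>I. (1/2::real) ^ j) \<le> (\<Sum>j. (1/2) ^ j)"
        by (rule sum_le_suminf[OF summable_geometric that]) auto
      also have "\<dots> = 2" by (subst suminf_geometric) auto
      finally show "(\<Sum>j\<in>I. (1/2::real) ^ j) \<le> 2" .
      show "0 \<le> cover_const * c / e" using cover_const c e by simp
    qed
    also have "\<dots> \<le> (cover_const + 1) * (m * e / (2 * (cover_const + 1))) / e * 2"
      using cover_const c e by (intro mult_right_mono divide_right_mono mult_mono) auto
    also have "\<dots> = (cover_const + 1) * (m / (cover_const + 1))" using e by (simp add: divide_simps)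
    also have "\<dots> = m" using cover_const by simp
    finally show ?thesis .
  qed
  have "(\<Union>j. T j) \<in> lmeasurable" by (rule fmeasurable_UN_bound[where B=m]) (use T(1) fin in auto)
  moreover have "measure lebesgue (\<Union>j. T j) \<le> m" by (rule measure_UN_bound) (use T(1) fin in auto)
  moreover have "?N \<subseteq> (\<Union>j. T j)"
  proof
    fix x assume "x \<in> ?N"
    then obtain g t where x: "x \<in> K" "touches x g" and t: "0 < \<bar>t\<bar>" "\<bar>t\<bar> < c"
      and lt: "u (x + t *\<^sub>R b) < ereal (ray x g b t - e * \<bar>t\<bar>)"
      using c(1) by blast
    obtain j0 where "(1/2) ^ j0 < \<bar>t\<bar> / c" using real_arch_pow_inv[of "\<bar>t\<bar> / c" "1/2"] t c by auto
    then have j0: "r j0 < \<bar>t\<bar>" using c by (simp add: r_def field_simps)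
    \<comment> \<open>The preceding radius \<open>r i\<close> lies between \<bar>t\<bar> and twice
      \<bar>t\<bar>, so the drop \<open>e * \<bar>t\<bar>\<close> is at least
      \<open>e * r i / 2\<close>. It exists because \<bar>t\<bar> is smaller than
      \<open>c = r 0\<close>.\<close>
    define j where "j = (LEAST j. r j < \<bar>t\<bar>)"
    have j: "r j < \<bar>t\<bar>" unfolding j_def by (rule LeastI[of "\<lambda>j. r j < \<bar>t\<bar>", OF j0])
    have "j \<noteq> 0" using j t(2) unfolding r_def by (cases "j = 0") auto
    then obtain i where i: "j = Suc i" using not0_implies_Suc by blast
    have "\<not> r i < \<bar>t\<bar>" using not_less_Least[of i "\<lambda>j. r j < \<bar>t\<bar>"] i unfolding j_def by simp
    then have ti: "\<bar>t\<bar> \<le> r i" by simp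
    have "r i / 2 \<le> \<bar>t\<bar>" using j i by (simp add: r_def)
    then have "e * r i / 2 \<le> e * \<bar>t\<bar>" using e by simp
    then have "u (x + t *\<^sub>R b) < ereal (ray x g b t - e * r i / 2)"
      by (intro less_le_trans[OF lt]) simp
    then have "x \<in> T i" using T(2)[of i] x ti unfolding Bd_def by blast
    then show "x \<in> (\<Union>j. T j)" by blast
  qed
  ultimately show "\<exists>T. ?N \<subseteq> T \<and> T \<in> lmeasurable \<and> measure lebesgue T \<le> m" by blast
qed

text \<open>The touching paraboloid bounds the increments along each axis from above by the linear
  term plus O(\<open>t\<^sup>2\<close>). Off countably many null sets, one for each axis and each
  rate \<open>1 / real (Suc n)\<close>, they are bounded from below up to o(\<bar>t\<bar>). So the
  partial derivatives exist and form the slope of the paraboloid.\<close>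

lemma has_gradient_ae:
  assumes dim: "2 \<le> DIM('a)"
  shows "negligible {x \<in> K. \<exists>g. touches x g \<and> \<not> has_gradient u x g}"
proof -
  define N where "N b n = {x \<in> K. \<exists>g. touches x g \<and> (\<forall>d>0. \<exists>t. 0 < \<bar>t\<bar> \<and> \<bar>t\<bar> < d \<and>
      u (x + t *\<^sub>R b) < ereal (ray x g b t - 1 / real (Suc n) * \<bar>t\<bar>))}" for b n
  have "negligible (N b n)" if "b \<in> Basis" for b n
    unfolding N_def by (rule bad_negligible[OF dim that]) simp
  then have "negligible (\<Union>b\<in>Basis. \<Union>n. N b n)"
    by (intro negligible_Union finite_imageI finite_Basis) (auto intro!: negligible_Union_nat)
  moreover have "{x \<in> K. \<exists>g. touches x g \<and> \<not> has_gradient u x g} \<subseteq> (\<Union>b\<in>Basis. \<Union>n. N b n)"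
  proof (rule subsetI, rule ccontr)
    fix x assume "x \<in> {x \<in> K. \<exists>g. touches x g \<and> \<not> has_gradient u x g}"
      and xN: "x \<notin> (\<Union>b\<in>Basis. \<Union>n. N b n)"
    then obtain g where x: "x \<in> K" and g: "touches x g" and ng: "\<not> has_gradient u x g" by blast
    obtain a where a: "u x = ereal a" using g unfolding touches_def by (cases "u x") auto
    have "((\<lambda>t. (u (x + t *\<^sub>R b) - u x) / ereal t) \<longlongrightarrow> ereal (g \<bullet> b)) (at 0)" if b: "b \<in> Basis" for b
    proof -
      define U where "U t = real_of_ereal (u (x + t *\<^sub>R b))" for t
      have lower: "\<exists>d>0. \<forall>t. 0 < \<bar>t\<bar> \<and> \<bar>t\<bar> < d \<longrightarrow>
          ereal (a + t * (g \<bullet> b) + t\<^sup>2 * B b b - 1 / real (Suc n) * \<bar>t\<bar>) \<le> u (x + t *\<^sub>R b)" for n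
      proof -
        have "x \<notin> N b n" using xN b by blast
        then have "\<not> (\<forall>d>0. \<exists>t. 0 < \<bar>t\<bar> \<and> \<bar>t\<bar> < d \<and>
          u (x + t *\<^sub>R b) < ereal (a + t * (g \<bullet> b) + t\<^sup>2 * B b b - 1 / real (Suc n) * \<bar>t\<bar>))"
          using x g a unfolding N_def by auto
        then show ?thesis by (metis not_less)
      qed
      have upper: "u (x + t *\<^sub>R b) \<le> ereal (a + t * (g \<bullet> b) + t\<^sup>2 * B b b)" if t: "\<bar>t\<bar> < R / 2" for t
      proof -
        have "x + t *\<^sub>R b \<in> cball z0 R"
        proof -
          have "dist z0 x \<le> R / 8" using x by (auto simp: K_def)
          moreover have "dist x (x + t *\<^sub>R b) \<le> R / 2" using t b by (simp add: dist_norm)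
          ultimately show ?thesis using dist_triangle[of z0 "x + t *\<^sub>R b" x] R by (simp del: dist_add_cancel)
        qed
        from touches_le[OF g this] show ?thesis using a
          by (simp add: B.scaleR_left B.scaleR_right power2_eq_square mult.assoc)
      qed
      \<comment> \<open>Between the two bounds \<open>u\<close> is finite on the axis near
        \<open>x\<close>, so the extended-real quotients are real ones.\<close>
      have fin: "\<forall>\<^sub>F t in at 0. u (x + t *\<^sub>R b) = ereal (U t)"
      proof -
        obtain d where d: "d > 0" "\<And>t. 0 < \<bar>t\<bar> \<Longrightarrow> \<bar>t\<bar> < d \<Longrightarrow>
          ereal (a + t * (g \<bullet> b) + t\<^sup>2 * B b b - 1 / real (Suc 0) * \<bar>t\<bar>) \<le> u (x + t *\<^sub>R b)"
          using lower[of 0] by blast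
        have "u (x + t *\<^sub>R b) = ereal (U t)" if "0 < \<bar>t\<bar>" "\<bar>t\<bar> < min d (R/2)" for t
          using d(2)[of t] upper[of t] that unfolding U_def by (cases "u (x + t *\<^sub>R b)") auto
        then show ?thesis unfolding eventually_at using d(1) R
          by (intro exI[of _ "min d (R/2)"]) auto
      qed
      have "((\<lambda>t. (U t - a) / t) \<longlongrightarrow> g \<bullet> b) (at 0)"
      proof (rule tendstoI)
        fix e :: real assume e: "0 < e"
        obtain n where n: "1 / real (Suc n) < e / 2" using reals_Archimedean[of "e/2"] e by (auto simp: inverse_eq_divide)
        obtain d where d: "d > 0" "\<And>t. 0 < \<bar>t\<bar> \<Longrightarrow> \<bar>t\<bar> < d \<Longrightarrow>
          ereal (a + t * (g \<bullet> b) + t\<^sup>2 * B b b - 1 / real (Suc n) * \<bar>t\<bar>) \<le> u (x + t *\<^sub>R b)"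
          using lower[of n] by blast
        have "((\<lambda>t. \<bar>t * B b b\<bar>) \<longlongrightarrow> \<bar>0 * B b b\<bar>) (at 0)" by (intro tendsto_intros)
        then have evB: "\<forall>\<^sub>F t in at 0. \<bar>t * B b b\<bar> < e / 2"
          using e by (intro order_tendstoD(2)) auto
        have evd: "\<forall>\<^sub>F t in at 0. 0 < \<bar>t\<bar> \<and> \<bar>t\<bar> < min d (R/2)"
          unfolding eventually_at using d(1) R by (intro exI[of _ "min d (R/2)"]) auto
        show "\<forall>\<^sub>F t in at 0. dist ((U t - a) / t) (g \<bullet> b) < e"
          using evd evB fin
        proof eventually_elim
          case (elim t)
          have up: "U t \<le> a + t * (g \<bullet> b) + t\<^sup>2 * B b b" using upper[of t] elim by simp
          have lo: "a + t * (g \<bullet> b) + t\<^sup>2 * B b b - 1 / real (Suc n) * \<bar>t\<bar> \<le> U t"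
            using d(2)[of t] elim by simp
          have "\<bar>t\<^sup>2 * B b b\<bar> = \<bar>t\<bar> * \<bar>t * B b b\<bar>" by (simp add: power2_eq_square abs_mult)
          also have "\<dots> \<le> \<bar>t\<bar> * (e/2)" using elim by (intro mult_left_mono) auto
          finally have q: "\<bar>t\<^sup>2 * B b b\<bar> \<le> \<bar>t\<bar> * (e/2)" .
          have n': "1 / real (Suc n) * \<bar>t\<bar> < (e/2) * \<bar>t\<bar>" using n elim by (intro mult_strict_right_mono) auto
          have te: "0 < \<bar>t\<bar> * e" using elim e by simp
          have "\<bar>U t - a - t * (g \<bullet> b)\<bar> < \<bar>t\<bar> * e"
            unfolding abs_less_iff
          proof
            have "(e/2) * \<bar>t\<bar> + \<bar>t\<bar> * (e/2) = \<bar>t\<bar> * e" by simp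
            then show "U t - a - t * (g \<bullet> b) < \<bar>t\<bar> * e" "- (U t - a - t * (g \<bullet> b)) < \<bar>t\<bar> * e"
              using up lo q n' te by linarith+
          qed
          then have "\<bar>U t - a - t * (g \<bullet> b)\<bar> / \<bar>t\<bar> < e" using elim by (simp add: divide_less_eq mult.commute)
          moreover have "\<bar>(U t - a) / t - g \<bullet> b\<bar> = \<bar>U t - a - t * (g \<bullet> b)\<bar> / \<bar>t\<bar>"
            using elim by (simp add: abs_divide[symmetric] diff_divide_distrib)
          ultimately show ?case by (simp add: dist_real_def)
        qed
      qed
      then have "((\<lambda>t. ereal ((U t - a) / t)) \<longlongrightarrow> ereal (g \<bullet> b)) (at 0)" by (rule tendsto_ereal)
      moreover have "\<forall>\<^sub>F t in at 0. ereal ((U t - a) / t) = (u (x + t *\<^sub>R b) - u x) / ereal t"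
        using fin eventually_at_ball[of 1 0 UNIV, OF zero_less_one]
        by eventually_elim (auto simp: a divide_ereal_def divide_inverse)
      ultimately show ?thesis by (rule Lim_transform_eventually)
    qed
    then have "has_gradient u x g" unfolding has_gradient_def using a by auto
    then show False using ng by blast
  qed
  ultimately show ?thesis by (rule negligible_subset)
qed

end

lemma has_gradient_unique:
  assumes "has_gradient u z g" "has_gradient u z h"
  shows "g = h"
proof (rule euclidean_eqI)
  fix b :: 'a assume "b \<in> Basis"
  then have "ereal (g \<bullet> b) = ereal (h \<bullet> b)"
    using assms tendsto_unique[OF trivial_limit_at[of "0::real"]] unfolding has_gradient_def by blast
  then show "g \<bullet> b = h \<bullet> b" by simp
qed

section \<open>Paraboloids touching on complex lines\<close>

lemma linear_line: "linear (\<lambda>z::complex. z *s (b::complex^'n))"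
  by (simp add: linear_iff vec_eq_iff algebra_simps)

lemma line_eq: "z *s b = Re z *\<^sub>R b + Im z *\<^sub>R (\<i> *s (b::complex^'n))"
  by (simp add: vec_eq_iff complex_eq_iff)

lemma continuous_line [continuous_intros]:
  assumes "continuous_on S f"
  shows "continuous_on S (\<lambda>x. f x *s (b::complex^'n))"
  by (rule continuous_on_compose2[OF linear_continuous_on[OF linear_conv_bounded_linear[THEN iffD1, OF linear_line]] assms]) auto

lemma inner_line: "g \<bullet> (z *s b) = Complex (g \<bullet> b) (g \<bullet> (\<i> *s b)) \<bullet> z" for b :: "complex^'n"
  by (subst line_eq) (simp add: inner_simps inner_complex_def mult.commute)

lemma quad_line:
  fixes b :: "complex^'n"
  assumes "quad B"
  shows "quad (\<lambda>z \<xi>. B (z *s b) (\<xi> *s b))"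
proof -
  interpret quad B by fact
  have lin: "bounded_linear (\<lambda>z::complex. z *s b)" using linear_line linear_conv_bounded_linear by blast
  show ?thesis
    by (rule quad.intro) (auto intro: bounded_bilinear.comp[OF bilinear lin lin] sym)
qed

lemma line_open:
  fixes b :: "complex^'n"
  assumes "open S"
  shows "open {z. a + z *s b \<in> S}"
  using open_vimage[OF assms, of "\<lambda>z. a + z *s b"] by (simp add: vimage_def continuous_intros)

text \<open>On the complex line the paraboloid becomes one over the plane whose form has trace
  \<open>B b b + B (\<i> *s b) (\<i> *s b)\<close>. Its mean over a small disc exceeds the central
  value by \<open>msq\<close> times this trace, and the sub-mean value inequality along the line
  forbids a negative excess.\<close>

lemma plurisubharmonic_touching:
  fixes u :: "complex^'n \<Rightarrow> ereal"
  assumes psh: "u plurisubharmonic_on S" and x: "x \<in> S" "\<bar>u x\<bar> \<noteq> \<infinity>" and B: "quad B" and W: "open W" "x \<in> W"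
    and le: "\<And>y. y \<in> W \<Longrightarrow> u y \<le> u x + ereal (g \<bullet> (y - x) + B (y - x) (y - x))"
  shows "0 \<le> B b b + B (\<i> *s b) (\<i> *s b)"
proof -
  interpret B: quad B by fact
  interpret B': quad "\<lambda>z \<xi>. B (z *s b) (\<xi> *s b)" by (rule quad_line[OF B])
  define V where "V = {z. x + z *s b \<in> S}"
  define C where "C = connected_component_set V 0"
  have V0: "0 \<in> V" using x by (simp add: V_def)
  have openV: "open V" unfolding V_def using psh by (intro line_open) (simp add: plurisubharmonic_on_def)
  have C: "C \<in> components V" unfolding C_def components_def using V0 by blast
  have C0: "0 \<in> C" unfolding C_def using V0 by simp
  have openC: "open C" using openV C by (rule open_components)
  have "(\<forall>z\<in>C. u (x + z *s b) = -\<infinity>) \<or> (\<lambda>z. u (x + z *s b)) subharmonic_on C"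
    using psh C unfolding plurisubharmonic_on_def V_def by blast
  moreover have "\<not> (\<forall>z\<in>C. u (x + z *s b) = -\<infinity>)" using C0 x(2) by force
  ultimately have sm: "submean_on (\<lambda>z. u (x + z *s b)) C" using subharmonic_imp_submean by blast
  define D where "D = C \<inter> {z. x + z *s b \<in> W}"
  have "open D" unfolding D_def by (intro open_Int openC line_open W)
  moreover have "0 \<in> D" unfolding D_def using C0 W(2) by simp
  ultimately obtain s where s: "0 < s" "cball 0 s \<subseteq> D" using open_contains_cball by blast
  obtain a where a: "u x = ereal a" using x(2) by (cases "u x") auto
  let ?q = "\<lambda>z. a + Complex (g \<bullet> b) (g \<bullet> (\<i> *s b)) \<bullet> (z - 0) + B ((z - 0) *s b) ((z - 0) *s b)"
  have "u (x + 0 *s b) \<le> ereal (avg ?q 0 s)"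
  proof (rule submean_onD[OF sm s(1)])
    show "cball 0 s \<subseteq> C" using s unfolding D_def by blast
    show "ball_integrable 0 s ?q"
      by (intro integrable_cball_UNIV continuous_intros)
    fix z :: complex assume "z \<in> cball 0 s"
    then have "x + z *s b \<in> W" using s unfolding D_def by blast
    from le[OF this] have "u (x + z *s b) \<le> ereal a + ereal (g \<bullet> (z *s b) + B (z *s b) (z *s b))"
      unfolding add_diff_cancel_left' a .
    then show "u (x + z *s b) \<le> ereal (?q z)"
      unfolding inner_line[of g z b] plus_ereal.simps add.assoc diff_zero .
  qed
  also have "avg ?q 0 s = a + msq TYPE(complex) s * B'.tr" by (rule B'.avg_quad[OF s(1)])
  finally have "0 \<le> msq TYPE(complex) s * B'.tr" using a by simp
  then have "0 \<le> B'.tr" using msq_pos[OF s(1), where 'a=complex] by (simp add: zero_le_mult_iff)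
  then show ?thesis by (simp add: B'.tr_def Basis_complex_def)
qed

lemma touching_trace:
  fixes u :: "complex^'n \<Rightarrow> ereal"
  assumes \<Omega>: "open \<Omega>" and submean: "submean_on u \<Omega>" and usc: "usc_on \<Omega> u" and lt: "\<And>z. z \<in> \<Omega> \<Longrightarrow> u z < \<infinity>"
    and N: "negligible N"
    and cases: "\<And>z. z \<in> \<Omega> \<Longrightarrow> z \<notin> N \<Longrightarrow> has_gradient u z 0 \<or> \<not> (\<exists>g. has_gradient u z g) \<or>
      (\<exists>S. u plurisubharmonic_on S \<and> z \<in> S)"
    and z0: "\<bar>u z0\<bar> \<noteq> \<infinity>" and rad: "0 < R" "cball z0 R \<subseteq> \<Omega>" and \<eta>: "0 < \<eta>" and B: "quad B"
    and le: "\<And>y. y \<in> cball z0 R \<Longrightarrow>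
      u y \<le> u z0 + ereal (l \<bullet> (y - z0) + B (y - z0) (y - z0) - \<eta> * (norm (y - z0))\<^sup>2)"
  shows "0 \<le> B b b + B (\<i> *s b) (\<i> *s b)"
proof (rule ccontr)
  assume neg: "\<not> ?thesis"
  \<comment> \<open>One of \<open>b\<close> and \<open>\<i> *s b\<close> is a negative direction, as
    \<open>critical_negligible\<close> demands.\<close>
  then obtain e where e: "B e e < 0" by (metis add_nonneg_nonneg not_le)
  interpret quad B by fact
  interpret contact B u z0 R
    by unfold_locales (use submean_on_subset[OF submean rad(2)] usc_on_subset[OF usc rad(2)] lt rad in auto)
  \<comment> \<open>The real dimension is \<open>2 * CARD('n)\<close>; being at least 2, it makes
    the exponent \<open>DIM - 3/2\<close> of the kernel positive.\<close>
  have "2 * 1 \<le> 2 * CARD('n)" by (intro mult_left_mono) (auto simp: Suc_leI)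
  then have dim: "2 \<le> DIM(complex^'n)" by (simp add: mult.commute)
  have z0': "u z0 \<noteq> - \<infinity>" using z0 by auto
  let ?U = "N \<union> {x \<in> K. \<exists>g. touches x g \<and> \<not> has_gradient u x g} \<union> {x \<in> cball z0 (R/8). touches x 0}"
  have "K \<subseteq> ?U"
  proof
    fix x assume xK: "x \<in> K"
    then obtain g where g: "touches x g" and xR: "x \<in> cball z0 (R/8)" unfolding K_def by blast
    have xb: "x \<in> ball z0 R" using xR rad by auto
    then have x\<Omega>: "x \<in> \<Omega>" using rad(2) ball_subset_cball by blast
    show "x \<in> ?U"
    proof (rule ccontr)
      assume nU: "x \<notin> ?U"
      then have hg: "has_gradient u x g" using xK g by blast
      have "\<not> has_gradient u x 0" using has_gradient_unique[OF hg] g xR nU by blast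
      then obtain S where S: "u plurisubharmonic_on S" "x \<in> S" using cases[OF x\<Omega>] nU hg by blast
      have "0 \<le> B b b + B (\<i> *s b) (\<i> *s b)"
        by (rule plurisubharmonic_touching[OF S _ B open_ball xb, of g]) (use g in \<open>auto simp: touches_def\<close>)
      then show False using neg by simp
    qed
  qed
  moreover have "negligible ?U"
    by (intro negligible_Un N has_gradient_ae[OF dim] critical_negligible[OF e z0'])
  ultimately have "negligible K" by (rule negligible_subset[rotated])
  then show False using K_not_negligible[OF z0 \<eta> le] by blast
qed

section \<open>Harmonic majorants on circles\<close>

lemma linear_borel_measurable:
  fixes f :: "'a::euclidean_space \<Rightarrow> 'b::euclidean_space"
  shows "linear f \<Longrightarrow> f \<in> borel_measurable borel"
  by (intro borel_measurable_continuous_onI linear_continuous_on) (simp add: linear_conv_bounded_linear)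

text \<open>The preimage of a box is its image under the inverse \<open>T'\<close>, and orthogonal
  images keep the measure; boxes determine \<open>lborel\<close>.\<close>

lemma orthogonal_distr_real2:
  fixes T T' :: "real^2 \<Rightarrow> real^2"
  assumes T: "orthogonal_transformation T" "orthogonal_transformation T'" "\<And>x. T (T' x) = x" "\<And>x. T' (T x) = x"
  shows "distr lborel borel T = lborel"
proof (rule lborel_eqI[symmetric])
  fix l u :: "real^2" assume le: "\<And>b. b \<in> Basis \<Longrightarrow> l \<bullet> b \<le> u \<bullet> b"
  have lin: "linear T" "linear T'" using T by (simp_all add: orthogonal_transformation_linear)
  have meas: "T \<in> borel_measurable borel"
    using lin(1) by (rule linear_borel_measurable)
  have eq: "T -` box l u = T' ` box l u" proof (intro set_eqI iffI)
    fix x assume "x \<in> T -` box l u"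
    then show "x \<in> T' ` box l u" using T(4)[of x] by (intro image_eqI[of _ _ "T x"]) auto
  qed (use T(3) in auto)
  have op: "open (T -` box l u)"
    using lin by (intro open_vimage open_box linear_continuous_on) (simp add: linear_conv_bounded_linear)
  have lm: "T' ` box l u \<in> lmeasurable" by (rule measurable_orthogonal_image[OF T(2)]) simp
  have "emeasure (distr lborel borel T) (box l u) = emeasure lborel (T -` box l u)"
    using meas by (subst emeasure_distr) auto
  also have "\<dots> = emeasure lebesgue (T' ` box l u)" using op by (simp add: eq)
  also have "\<dots> = ennreal (measure lebesgue (T' ` box l u))"
    using lm by (intro emeasure_eq_ennreal_measure) (auto simp: fmeasurable_def)
  also have "measure lebesgue (T' ` box l u) = measure lebesgue (box l u)"
    by (rule measure_orthogonal_image[OF T(2)]) simp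
  also have "ennreal (measure lebesgue (box l u)) = emeasure lebesgue (box l u)"
    by (rule emeasure_eq_ennreal_measure[symmetric]) (simp add: emeasure_lborel_box_eq)
  also have "\<dots> = ennreal (\<Prod>b\<in>Basis. (u - l) \<bullet> b)"
    using le by (simp add: emeasure_lborel_box_eq)
  finally show "emeasure (distr lborel borel T) (box l u) = ennreal (\<Prod>b\<in>Basis. (u - l) \<bullet> b)" .
qed simp

text \<open>The coordinate map \<phi> carries boxes to boxes of equal measure and conjugates
  multiplication by \<open>c\<close> to the orthogonal map \<open>T c\<close> of
  \<open>real^2\<close>, whose inverse is \<open>T (cnj c)\<close>.\<close>

lemma rotation_distr:
  fixes c :: complex
  assumes c: "norm c = 1"
  shows "distr lborel borel ((*) c) = lborel"
proof -
  define \<phi> where "\<phi> v = Complex (v $ 1) (v $ 2)" for v :: "real^2"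
  define \<psi> where "\<psi> z = (vector [Re z, Im z] :: real^2)" for z
  have inv: "\<phi> (\<psi> z) = z" "\<psi> (\<phi> v) = v" for z v
    by (simp_all add: \<phi>_def \<psi>_def vec_eq_iff forall_2)
  have \<phi>_lin: "linear \<phi>" by (simp add: linear_iff \<phi>_def complex_eq_iff)
  have \<psi>_lin: "linear \<psi>" by (simp add: linear_iff \<psi>_def vec_eq_iff forall_2)
  have \<phi>_norm: "norm (\<phi> v) = norm v" for v
    by (simp add: \<phi>_def norm_vec_def L2_set_def UNIV_2 cmod_def)
  have \<psi>_norm: "norm (\<psi> z) = norm z" for z using \<phi>_norm[of "\<psi> z"] by (simp add: inv)
  have \<phi>_meas: "\<phi> \<in> borel_measurable borel" by (rule linear_borel_measurable[OF \<phi>_lin])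
  have \<phi>_distr: "distr lborel borel \<phi> = lborel"
  proof (rule lborel_eqI[symmetric])
    fix l u :: complex assume le: "\<And>b. b \<in> Basis \<Longrightarrow> l \<bullet> b \<le> u \<bullet> b"
    have lu: "Re l \<le> Re u" "Im l \<le> Im u" using le[of 1] le[of \<i>] by (auto simp: Basis_complex_def)
    have eq: "\<phi> -` box l u = box (\<psi> l) (\<psi> u)"
      by (auto simp: \<phi>_def \<psi>_def mem_box_cart forall_2 in_box_complex_iff)
    have le': "\<psi> l \<bullet> b \<le> \<psi> u \<bullet> b" if "b \<in> Basis" for b
      using that lu by (auto simp: Basis_vec_def \<psi>_def inner_axis' exhaust_2 UNIV_2 inner_axis)
    then have ne: "cbox (\<psi> l) (\<psi> u) \<noteq> {}" by (simp add: box_ne_empty)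
    have "emeasure (distr lborel borel \<phi>) (box l u) = emeasure lborel (box (\<psi> l) (\<psi> u))"
      using \<phi>_meas by (subst emeasure_distr) (auto simp: eq)
    also have "\<dots> = ennreal (\<Prod>b\<in>Basis. (\<psi> u - \<psi> l) \<bullet> b)"
      by (rule emeasure_lborel_box) (use le' in auto)
    also have "(\<Prod>b\<in>Basis. (\<psi> u - \<psi> l) \<bullet> b) = measure lborel (cbox (\<psi> l) (\<psi> u))"
      using le' by (simp add: content_cbox'[OF ne] inner_diff_left)
    also have "\<dots> = (Re u - Re l) * (Im u - Im l)"
      using content_cbox_cart[OF ne] by (simp add: UNIV_2 \<psi>_def)
    also have "\<dots> = (\<Prod>b\<in>Basis. (u - l) \<bullet> b)" by (simp add: Basis_complex_def)
    finally show "emeasure (distr lborel borel \<phi>) (box l u) = ennreal (\<Prod>b\<in>Basis. (u - l) \<bullet> b)" .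
  qed simp
  define T where "T d v = \<psi> (d * \<phi> v)" for d v
  have T_lin: "linear (T d)" for d
    using linear_compose[OF linear_compose[OF \<phi>_lin linear_times[of d]] \<psi>_lin] by (simp add: T_def[abs_def] o_def)
  have T_orth: "orthogonal_transformation (T d)" if "norm d = 1" for d
    unfolding orthogonal_transformation using T_lin that by (simp add: T_def \<psi>_norm \<phi>_norm norm_mult)
  have cc: "c * cnj c = 1" "cnj c * c = 1" using c by (simp_all add: complex_norm_square[symmetric] mult.commute[of "cnj c"])
  have TT: "T c (T (cnj c) v) = v" "T (cnj c) (T c v) = v" for v
    unfolding T_def by (simp_all add: inv mult.assoc[symmetric] cc)
  have "distr lborel borel (T c) = lborel"
    by (rule orthogonal_distr_real2[OF T_orth T_orth TT]) (use c in auto)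
  have T_meas: "T c \<in> borel_measurable borel" by (rule linear_borel_measurable[OF T_lin])
  have c_meas: "(*) c \<in> borel_measurable borel" by simp
  have "distr lborel borel ((*) c) = distr (distr lborel borel \<phi>) borel ((*) c)" by (simp add: \<phi>_distr)
  also have "\<dots> = distr lborel borel ((*) c \<circ> \<phi>)" by (rule distr_distr) (use \<phi>_meas c_meas in auto)
  also have "(*) c \<circ> \<phi> = \<phi> \<circ> T c" by (simp add: fun_eq_iff T_def inv)
  also have "distr lborel borel (\<phi> \<circ> T c) = distr (distr lborel borel (T c)) borel \<phi>"
    by (rule distr_distr[symmetric]) (use \<phi>_meas T_meas in auto)
  also have "\<dots> = lborel" by (simp add: \<open>distr lborel borel (T c) = lborel\<close> \<phi>_distr)
  finally show ?thesis .
qed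

lemma avg_rotation:
  fixes c :: complex
  assumes "norm c = 1" "continuous_on UNIV g"
  shows "avg (\<lambda>w. g (c * w)) 0 r = avg g 0 r"
  by (rule avg_inv[OF _ rotation_distr]) (use assms in \<open>auto simp: norm_mult\<close>)

text \<open>On the circle \<open>w * cnj w\<close> is the constant \<open>t\<^sup>2\<close>, so each
  product of a power of \<open>w\<close> and a power of \<open>cnj w\<close> collapses to a multiple
  of a single power. Conjugating a term that keeps a power of \<open>cnj w\<close> does not change
  its real part.\<close>

lemma Re_mult_cnj_poly_on_circle:
  fixes p q :: "complex poly"
  shows "\<exists>r. degree r \<le> degree p + degree q \<and>
    (\<forall>w. norm w = t \<longrightarrow> Re (poly p w * cnj (poly q w)) = Re (poly r w))"
proof -
  define m where "m j k = (if k \<le> j then monom (coeff p j * cnj (coeff q k) * of_real t ^ (2*k)) (j - k)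
    else monom (cnj (coeff p j) * coeff q k * of_real t ^ (2*j)) (k - j))" for j k
  define r where "r = (\<Sum>j\<le>degree p. \<Sum>k\<le>degree q. m j k)"
  have "degree r \<le> degree p + degree q"
    unfolding r_def
  proof (intro degree_sum_le)
    fix j k assume jk: "j \<in> {..degree p}" "k \<in> {..degree q}"
    show "degree (m j k) \<le> degree p + degree q"
      unfolding m_def using jk degree_monom_le by (auto intro: order_trans[OF degree_monom_le])
  qed auto
  moreover have "Re (poly p w * cnj (poly q w)) = Re (poly r w)" if t: "norm w = t" for w
  proof -
    have sq: "w * cnj w = of_real t ^ 2" using complex_norm_square[of w] t by simp
    have trm: "Re ((coeff p j * w ^ j) * cnj (coeff q k * w ^ k)) = Re (poly (m j k) w)" for j k
    proof (cases "k \<le> j")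
      case True
      then obtain i where i: "j = i + k" using le_iff_add by (metis add.commute)
      have "(coeff p j * w ^ j) * cnj (coeff q k * w ^ k) = coeff p j * cnj (coeff q k) * (w * cnj w) ^ k * w ^ i"
        unfolding i by (simp add: power_add power_mult_distrib mult_ac)
      also have "\<dots> = poly (m j k) w"
        using True unfolding sq m_def i by (simp add: poly_monom power_mult)
      finally show ?thesis by simp
    next
      case False
      then obtain i where i: "k = i + j" using le_iff_add by (metis add.commute nat_le_linear)
      have "cnj ((coeff p j * w ^ j) * cnj (coeff q k * w ^ k)) = cnj (coeff p j) * coeff q k * (w * cnj w) ^ j * w ^ i"
        unfolding i by (simp add: power_add power_mult_distrib mult_ac)
      also have "\<dots> = poly (m j k) w"
        using False unfolding sq m_def i by (simp add: poly_monom power_mult)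
      finally show ?thesis by (metis cnj.simps(1))
    qed
    have "poly p w * cnj (poly q w) = (\<Sum>j\<le>degree p. \<Sum>k\<le>degree q. (coeff p j * w ^ j) * cnj (coeff q k * w ^ k))"
      unfolding poly_altdef cnj_sum by (rule sum_product)
    then have "Re (poly p w * cnj (poly q w)) = (\<Sum>j\<le>degree p. \<Sum>k\<le>degree q. Re (poly (m j k) w))"
      using trm by (simp only: Re_sum)
    also have "\<dots> = Re (poly r w)" unfolding r_def by (simp add: poly_sum Re_sum)
    finally show ?thesis .
  qed
  ultimately show ?thesis by blast
qed

text \<open>For products, \<open>Re z * Re w\<close> is half the sum of \<open>Re (z * w)\<close>
  and \<open>Re (z * cnj w)\<close>. The degree bound is uniform in \<open>t\<close> because the
  number of rotations must be fixed before a radius is chosen.\<close>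

lemma real_polynomial_on_circle:
  assumes "real_polynomial_function (q :: complex \<Rightarrow> real)"
  shows "\<exists>d. \<forall>t. \<exists>p :: complex poly. degree p \<le> d \<and> (\<forall>w. norm w = t \<longrightarrow> q w = Re (poly p w))"
  using assms
proof (induction rule: real_polynomial_function.induct)
  case (linear f)
  then interpret f: bounded_linear f .
  have "f w = Re (poly (monom (Complex (f 1) (- f \<i>)) 1) w)" for w
  proof -
    have "f w = f (Re w *\<^sub>R 1 + Im w *\<^sub>R \<i>)" by (rule arg_cong[where f=f]) (simp add: complex_eq_iff)
    also have "\<dots> = Re w * f 1 + Im w * f \<i>" by (simp only: f.add f.scaleR real_scaleR_def)
    finally show ?thesis by (simp add: poly_monom mult.commute)
  qed
  then show ?case using degree_monom_le by blast
next
  case (const c)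
  have "c = Re (poly [:of_real c:] w)" for w :: complex by simp
  then show ?case by (metis le_refl degree_pCons_0)
next
  case (add f g)
  then obtain d1 d2 where d: "\<And>t. \<exists>p :: complex poly. degree p \<le> d1 \<and> (\<forall>w. norm w = t \<longrightarrow> f w = Re (poly p w))"
    "\<And>t. \<exists>p :: complex poly. degree p \<le> d2 \<and> (\<forall>w. norm w = t \<longrightarrow> g w = Re (poly p w))" by blast
  show ?case
  proof (intro exI[of _ "max d1 d2"] allI)
    fix t
    obtain p1 p2 :: "complex poly" where "degree p1 \<le> d1" "\<forall>w. norm w = t \<longrightarrow> f w = Re (poly p1 w)"
      "degree p2 \<le> d2" "\<forall>w. norm w = t \<longrightarrow> g w = Re (poly p2 w)" using d[of t] by blast
    then show "\<exists>p :: complex poly. degree p \<le> max d1 d2 \<and> (\<forall>w. norm w = t \<longrightarrow> f w + g w = Re (poly p w))"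
      by (intro exI[of _ "p1 + p2"]) (auto intro: degree_add_le order_trans)
  qed
next
  case (mult f g)
  then obtain d1 d2 where d: "\<And>t. \<exists>p :: complex poly. degree p \<le> d1 \<and> (\<forall>w. norm w = t \<longrightarrow> f w = Re (poly p w))"
    "\<And>t. \<exists>p :: complex poly. degree p \<le> d2 \<and> (\<forall>w. norm w = t \<longrightarrow> g w = Re (poly p w))" by blast
  show ?case
  proof (intro exI[of _ "d1 + d2"] allI)
    fix t
    obtain p1 p2 :: "complex poly" where p: "degree p1 \<le> d1" "\<forall>w. norm w = t \<longrightarrow> f w = Re (poly p1 w)"
      "degree p2 \<le> d2" "\<forall>w. norm w = t \<longrightarrow> g w = Re (poly p2 w)" using d[of t] by blast
    obtain r where r: "degree r \<le> degree p1 + degree p2"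
      "\<And>w. norm w = t \<Longrightarrow> Re (poly p1 w * cnj (poly p2 w)) = Re (poly r w)"
      using Re_mult_cnj_poly_on_circle[of p1 p2 t] by blast
    let ?p = "smult (1/2) (p1 * p2 + r)"
    have "degree ?p \<le> d1 + d2"
      using p r(1) degree_mult_le[of p1 p2] by (intro order_trans[OF degree_smult_le] degree_add_le) auto
    moreover have "f w * g w = Re (poly ?p w)" if "norm w = t" for w
    proof -
      have "f w * g w = Re (poly p1 w) * Re (poly p2 w)" using p that by simp
      also have "\<dots> = (Re (poly p1 w * poly p2 w) + Re (poly p1 w * cnj (poly p2 w))) / 2" by simp
      also have "\<dots> = (Re (poly p1 w * poly p2 w) + Re (poly r w)) / 2" unfolding r(2)[OF that] ..
      finally show ?thesis by simp
    qed
    ultimately show "\<exists>p :: complex poly. degree p \<le> d1 + d2 \<and> (\<forall>w. norm w = t \<longrightarrow> f w * g w = Re (poly p w))" by blast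
  qed
qed

text \<open>For \<open>0 < j < n\<close> the \<open>j\<close>-th powers of the \<open>n\<close>-th
  roots of unity form a geometric sum equal to 0, so only the constant coefficient remains.\<close>

lemma sum_poly_roots_of_unity:
  fixes p :: "complex poly"
  assumes n: "degree p < n"
  defines "\<xi> \<equiv> \<lambda>k. exp (2 * of_real pi * \<i> * of_nat k / of_nat n)"
  shows "(\<Sum>k<n. poly p (\<xi> k * w)) = of_nat n * poly p 0"
proof -
  have pw: "\<xi> k ^ j = \<xi> j ^ k" for j k
    unfolding \<xi>_def by (simp add: exp_of_nat_mult[symmetric] mult_ac)
  have s: "(\<Sum>k<n. \<xi> k ^ j) = (if j = 0 then of_nat n else 0)" if j: "j \<le> degree p" for j
  proof (cases "j = 0")
    case False
    have ne: "\<xi> j \<noteq> 1"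
      unfolding \<xi>_def using complex_root_unity_eq_1[of n j] n j False by (auto dest: dvd_imp_le)
    have one: "\<xi> j ^ n = 1"
      unfolding \<xi>_def using complex_root_unity[of n j] n by auto
    have "(\<Sum>k<n. \<xi> k ^ j) = (\<Sum>k<n. \<xi> j ^ k)" by (simp only: pw)
    also have "\<dots> = 0" by (simp add: geometric_sum[OF ne] one)
    finally show ?thesis using False by simp
  qed simp
  have "(\<Sum>k<n. poly p (\<xi> k * w)) = (\<Sum>k<n. \<Sum>j\<le>degree p. coeff p j * w ^ j * \<xi> k ^ j)"
    by (simp add: poly_altdef power_mult_distrib mult_ac)
  also have "\<dots> = (\<Sum>j\<le>degree p. coeff p j * w ^ j * (\<Sum>k<n. \<xi> k ^ j))"
    unfolding sum_distrib_left by (rule sum.swap)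
  also have "\<dots> = (\<Sum>j\<le>degree p. if j = 0 then coeff p 0 * of_nat n else 0)"
    by (intro sum.cong) (auto simp: s)
  also have "\<dots> = of_nat n * poly p 0" by (simp add: poly_0_coeff_0 mult.commute)
  finally show ?thesis .
qed

text \<open>
  Averaging a polynomial approximation of \<open>g\<close> over the rotations by \<open>n\<close>-th roots of unity, \<open>n\<close> larger
  than the degree, replaces it on each circle by the value at 0 of its harmonic extension, without
  changing the mean over the disc.
\<close>

lemma harmonic_majorant_on_circle:
  fixes g :: "complex \<Rightarrow> real"
  assumes g: "continuous_on (cball 0 s) g" and s: "0 < s" and c: "avg g 0 s < c" "c \<le> g 0"
  shows "\<exists>t p. 0 < t \<and> t \<le> s \<and> (\<forall>w. norm w = t \<longrightarrow> g w < Re (poly p w)) \<and> Re (poly p 0) < c"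
proof -
  \<comment> \<open>One third pays for the approximation error in the mean, one for raising
    \<open>p\<close> by \<open>e\<close> to majorize \<open>g\<close> on the circle; the last keeps
    the inequality strict.\<close>
  define e where "e = (c - avg g 0 s) / 3"
  have e: "0 < e" using c by (simp add: e_def)
  obtain q where q: "real_polynomial_function q" "\<And>w. w \<in> cball 0 s \<Longrightarrow> \<bar>g w - q w\<bar> < e"
    using Stone_Weierstrass_real_polynomial_function[OF compact_cball g e] by blast
  have qc: "continuous_on S q" for S
    using q(1) by (intro continuous_on_polymonial_function) (simp add: real_polynomial_function_eq)
  obtain d where d: "\<And>t. \<exists>p :: complex poly. degree p \<le> d \<and> (\<forall>w. norm w = t \<longrightarrow> q w = Re (poly p w))"
    using real_polynomial_on_circle[OF q(1)] by blast
  define n where "n = Suc d"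
  define \<xi> where "\<xi> k = exp (2 * of_real pi * \<i> * of_nat k / of_nat n)" for k
  have \<xi>: "norm (\<xi> k) = 1" for k
  proof -
    have "\<xi> k = cis (2 * pi * k / n)" by (simp add: \<xi>_def cis_conv_exp mult_ac)
    then show ?thesis by simp
  qed
  have contr: "continuous_on UNIV (\<lambda>w. q (\<xi> k * w))" for k
    by (intro continuous_on_compose2[OF qc[of UNIV]] continuous_intros) auto
  define Q where "Q w = 1 / n * (\<Sum>k<n. q (\<xi> k * w))" for w
  have "avg Q 0 s = 1 / n * (\<Sum>k<n. avg (\<lambda>w. q (\<xi> k * w)) 0 s)"
    unfolding Q_def avg_cmult by (subst avg_sum) (use s contr in auto)
  also have "\<dots> = avg q 0 s" by (simp add: avg_rotation[OF \<xi> qc] n_def)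
  also have "\<dots> \<le> avg (\<lambda>w. g w + e) 0 s"
  proof (rule avg_mono[OF s])
    show "ball_integrable 0 s q" "ball_integrable 0 s (\<lambda>w. g w + e)"
      by (intro set_integrable_cball_cont qc continuous_intros g)+
    fix w :: complex assume "w \<in> cball 0 s"
    from q(2)[OF this] show "q w \<le> g w + e" by linarith
  qed
  also have "\<dots> = avg g 0 s + e"
    using avg_const[OF s, of e 0]
    by (subst avg_add) (auto intro!: set_integrable_cball_cont g continuous_intros)
  finally have avgQ: "avg Q 0 s < c - e" using e by (simp add: e_def field_simps)
  have Qc: "continuous_on UNIV Q" unfolding Q_def by (intro continuous_intros contr)
  have "\<exists>w\<in>cball 0 s. Q w < c - e"
  proof (rule ccontr)
    assume "\<not> ?thesis"
    then have "avg (\<lambda>w. c - e) (0::complex) s \<le> avg Q 0 s"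
      by (intro avg_mono s integrable_cball_UNIV continuous_on_const Qc) (auto simp: not_less)
    then show False using avgQ avg_const[OF s, of "c - e" "0::complex"] by simp
  qed
  then obtain w0 where w0: "w0 \<in> cball 0 s" "Q w0 < c - e" by blast
  define t where "t = norm w0"
  obtain p :: "complex poly" where p: "degree p \<le> d" "\<And>w. norm w = t \<Longrightarrow> q w = Re (poly p w)"
    using d[of t] by blast
  have "Q w0 = 1 / n * Re (\<Sum>k<n. poly p (\<xi> k * w0))"
    unfolding Q_def using p(2) \<xi> by (simp add: Re_sum norm_mult t_def)
  also have "(\<Sum>k<n. poly p (\<xi> k * w0)) = of_nat n * poly p 0"
    unfolding \<xi>_def by (rule sum_poly_roots_of_unity) (use p in \<open>simp add: n_def\<close>)
  finally have Q0: "Q w0 = Re (poly p 0)" by (simp add: n_def)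
  \<comment> \<open>A circle of radius 0 would give \<open>q 0 < c - e\<close>, against
    \<open>c \<le> g 0\<close> and the approximation of \<open>g\<close> by \<open>q\<close> up to
    \<open>e\<close>.\<close>
  have "t \<noteq> 0"
  proof
    assume "t = 0"
    then have "q 0 = Q w0" using p(2)[of 0] Q0 by simp
    moreover have "\<bar>g 0 - q 0\<bar> < e" using q(2)[of 0] s by simp
    ultimately show False using w0 c by linarith
  qed
  show ?thesis
  proof (intro exI[of _ t] exI[of _ "p + [:of_real e:]"] conjI allI impI)
    show "0 < t" using \<open>t \<noteq> 0\<close> by (simp add: t_def)
    show "t \<le> s" using w0(1) by (simp add: t_def)
    show "Re (poly (p + [:of_real e:]) 0) < c" using Q0 w0(2) by simp
    fix w :: complex assume "norm w = t"
    then show "g w < Re (poly (p + [:of_real e:]) w)"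
      using q(2)[of w] p(2)[of w] \<open>t \<le> s\<close> by auto
  qed
qed

text \<open>On the ball \<open>u\<close> is a decreasing limit of continuous majorants. Passing to
  the limit in their means leads from comparison with majorants back to the extended-real integral
  of the definition.\<close>

lemma usc_ball_mean_ge:
  fixes u :: "'a::euclidean_space \<Rightarrow> ereal"
  assumes usc: "usc_on (cball x r) u" and r: "0 < r" and lt: "\<And>y. y \<in> cball x r \<Longrightarrow> u y < \<infinity>"
    and ge: "\<And>g. continuous_on UNIV g \<Longrightarrow> (\<And>y. y \<in> cball x r \<Longrightarrow> u y \<le> ereal (g y)) \<Longrightarrow> c \<le> avg g x r"
  shows "ereal c \<le> ball_mean u x r"
proof -
  let ?D = "cball x r"
  have xD: "x \<in> ?D" using r by simp
  obtain z where z: "z \<in> ?D" "\<And>y. y \<in> ?D \<Longrightarrow> u y \<le> u z"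
    using usc_attains_max[OF usc compact_cball] xD by blast
  \<comment> \<open>With \<open>0 \<le> M\<close> the truncations at \<open>- real k\<close> stay
    below \<open>M\<close> too.\<close>
  obtain M where M: "u z \<le> ereal M" "0 \<le> M"
  proof -
    have "u z \<le> ereal (max 0 (real_of_ereal (u z)))" using lt[OF z(1)] by (cases "u z") auto
    then show ?thesis using that[of "max 0 (real_of_ereal (u z))"] by simp
  qed
  have uM: "u y \<le> ereal M" if "y \<in> ?D" for y using z(2)[OF that] M(1) by (rule order_trans)
  define v where "v k y = real_of_ereal (max (u y) (- ereal (real k)))" for k :: nat and y
  have v: "ereal (v k y) = max (u y) (- ereal (real k))" if "y \<in> ?D" for k y
    using lt[OF that] unfolding v_def by (cases "u y") (auto simp: max_def)
  have vM: "v k y \<le> M" if "y \<in> ?D" for k y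
  proof -
    have "ereal (v k y) \<le> ereal M" unfolding v[OF that] using uM[OF that] M(2) by simp
    then show ?thesis by simp
  qed
  have vdec: "v (Suc k) y \<le> v k y" if "y \<in> ?D" for k y
  proof -
    have "ereal (v (Suc k) y) \<le> ereal (v k y)" unfolding v[OF that] by (intro max.mono) auto
    then show ?thesis by simp
  qed
  \<comment> \<open>The sup-convolution: the least majorant of \<open>v k\<close> on the ball that
    has Lipschitz constant \<open>k\<close>.\<close>
  define g where "g k y = (SUP w\<in>?D. v k w - real k * dist y w)" for k y
  have bdd: "bdd_above ((\<lambda>w. v k w - real k * dist y w) ` ?D)" for k y
  proof (rule bdd_aboveI2)
    fix w assume "w \<in> ?D"
    then show "v k w - real k * dist y w \<le> M" using vM[of w k] by (simp add: diff_le_eq add_increasing2)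
  qed
  have g_ge: "v k w - real k * dist y w \<le> g k y" if "w \<in> ?D" for k y w
    unfolding g_def by (rule cSUP_upper[OF that bdd])
  have g_le: "g k y \<le> C" if "\<And>w. w \<in> ?D \<Longrightarrow> v k w - real k * dist y w \<le> C" for k y C
    unfolding g_def using xD that by (intro cSUP_least) auto
  have lip: "g k y \<le> g k y' + real k * dist y y'" for k y y'
  proof (rule g_le)
    fix w assume w: "w \<in> ?D"
    have "real k * dist y' w \<le> real k * dist y w + real k * dist y y'"
      using dist_triangle3[of y' w y] unfolding distrib_left[symmetric]
      by (intro mult_left_mono) (auto simp: dist_commute)
    then show "v k w - real k * dist y w \<le> g k y' + real k * dist y y'" using g_ge[OF w, of k y'] by linarith
  qed
  have gc: "continuous_on UNIV (g k)" for k
  proof (rule continuous_onI)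
    fix y and e :: real assume e: "0 < e"
    have "dist (g k y') (g k y) \<le> e" if d: "dist y' y < e / (real k + 1)" for y'
    proof -
      have "real k * dist y' y \<le> (real k + 1) * (e / (real k + 1))" using d by (intro mult_mono) auto
      then have "real k * dist y' y \<le> e" by simp
      then show ?thesis using lip[of k y y'] lip[of k y' y] by (auto simp: dist_real_def dist_commute abs_le_iff)
    qed
    then show "\<exists>d>0. \<forall>y'\<in>UNIV. dist y' y < d \<longrightarrow> dist (g k y') (g k y) \<le> e"
      using e by (intro exI[of _ "e / (real k + 1)"]) auto
  qed
  have gdec: "g (Suc k) y \<le> g k y" for k y
  proof (rule g_le)
    fix w assume w: "w \<in> ?D"
    have "real k * dist y w \<le> real (Suc k) * dist y w" by (intro mult_right_mono) auto
    then show "v (Suc k) w - real (Suc k) * dist y w \<le> g k y"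
      using vdec[OF w, of k] g_ge[OF w, of k y] by linarith
  qed
  have ug: "u y \<le> ereal (g k y)" if "y \<in> ?D" for k y
  proof -
    have "u y \<le> ereal (v k y)" unfolding v[OF that] by simp
    also have "\<dots> \<le> ereal (g k y)" using g_ge[OF that, of k y] by simp
    finally show ?thesis .
  qed
  have lim: "(\<lambda>k. ereal (g k y)) \<longlonglongrightarrow> u y" if y: "y \<in> ?D" for y
  proof (rule order_tendstoI)
    fix a assume "a < u y"
    then show "\<forall>\<^sub>F k in sequentially. a < ereal (g k y)" using ug[OF y] by (intro always_eventually allI) (rule less_le_trans)
  next
    fix a assume "u y < a"
    then obtain b where b: "u y < ereal b" "ereal b < a" using ereal_dense2 by blast
    obtain d where d: "d > 0" "\<forall>w\<in>?D. dist w y < d \<longrightarrow> u w < ereal b" using usc_onD'[OF usc y b(1)] by blast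
    \<comment> \<open>The first bound puts the truncation level below \<open>b\<close>; the second
      makes the penalty beyond distance \<open>d\<close> outweigh \<open>M - b\<close>.\<close>
    obtain k0 :: nat where k0: "max (- b) ((M - b) / d) \<le> real k0" using real_arch_simple by blast
    have "g k y \<le> b" if k: "k0 \<le> k" for k
    proof (rule g_le)
      fix w assume w: "w \<in> ?D"
      have kk: "- b \<le> real k" "(M - b) / d \<le> real k" using k0 k by auto
      show "v k w - real k * dist y w \<le> b"
      proof (cases "dist w y < d")
        case True
        then have "ereal (v k w) \<le> ereal b" unfolding v[OF w] using d w kk by (auto intro: less_imp_le)
        moreover have "0 \<le> real k * dist y w" by simp
        ultimately show ?thesis by (simp only: ereal_less_eq)
      next
        case False
        have "M - b \<le> real k * d" using kk d by (simp add: field_simps)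
        also have "\<dots> \<le> real k * dist y w" using False by (intro mult_left_mono) (auto simp: dist_commute)
        finally show ?thesis using vM[OF w, of k] by linarith
      qed
    qed
    then show "\<forall>\<^sub>F k in sequentially. ereal (g k y) < a"
      using b(2) by (intro eventually_sequentiallyI[of k0]) (meson ereal_less_eq(3) le_less_trans)
  qed
  let ?P = "\<lambda>f. \<integral>\<^sup>+y\<in>?D. e2ennreal (f y) \<partial>lborel"
  have gm: "g k \<in> borel_measurable borel" for k using gc by (simp add: borel_measurable_continuous_onI)
  have gint: "set_integrable lborel ?D (g k)" for k using gc by (rule integrable_cball_UNIV)
  have Pfin: "?P (\<lambda>y. ereal (g k y)) < \<infinity>" for k
  proof -
    have "?P (\<lambda>y. ereal (g k y)) = (\<integral>\<^sup>+y. ennreal (indicator ?D y *\<^sub>R g k y) \<partial>lborel)"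
      by (intro nn_integral_cong) (auto simp: indicator_def)
    also have "\<dots> < \<infinity>" using gint[of k] unfolding set_integrable_def real_integrable_def by (auto simp: less_top)
    finally show ?thesis .
  qed
  \<comment> \<open>The positive parts decrease, so the integrable first one dominates them; the
    negative parts increase, and monotone convergence applies.\<close>
  have limP: "(\<lambda>k. ?P (\<lambda>y. ereal (g k y))) \<longlonglongrightarrow> ?P u"
  proof -
    define F where "F k y = e2ennreal (ereal (g k y)) * indicator ?D y" for k y
    have pt: "(\<lambda>k. F k y) \<longlonglongrightarrow> e2ennreal (u y) * indicator ?D y" for y
    proof (cases "y \<in> ?D")
      case True
      then show ?thesis unfolding F_def using tendsto_e2ennrealI[OF lim[OF True]] by simp
    qed (simp add: F_def)
    have Fm: "F k \<in> borel_measurable lborel" for k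
      unfolding F_def e2ennreal_ereal using gm[of k]
      by (intro borel_measurable_times_ennreal borel_measurable_indicator measurable_compose[OF _ measurable_ennreal]) auto
    have "(\<lambda>k. integral\<^sup>N lborel (F k)) \<longlonglongrightarrow> (\<integral>\<^sup>+y. e2ennreal (u y) * indicator ?D y \<partial>lborel)"
    proof (rule nn_integral_dominated_convergence[where w="F 0"])
      show "F k \<in> borel_measurable lborel" "F 0 \<in> borel_measurable lborel" for k by (rule Fm)+
      show "(\<lambda>y. e2ennreal (u y) * indicator ?D y) \<in> borel_measurable lborel"
        by (rule borel_measurable_LIMSEQ_order[OF pt Fm])
      have "g k y \<le> g 0 y" for k y by (induction k) (auto intro: order_trans[OF gdec])
      then show "AE y in lborel. F k y \<le> F 0 y" for k
        unfolding F_def by (intro always_eventually allI mult_right_mono e2ennreal_mono) auto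
      show "integral\<^sup>N lborel (F 0) < \<infinity>" using Pfin[of 0] unfolding F_def .
      show "AE y in lborel. (\<lambda>k. F k y) \<longlonglongrightarrow> e2ennreal (u y) * indicator ?D y" using pt by simp
    qed
    then show ?thesis unfolding F_def .
  qed
  have limN: "(\<lambda>k. ?P (\<lambda>y. - ereal (g k y))) \<longlonglongrightarrow> ?P (\<lambda>y. - u y)"
  proof (rule nn_integral_LIMSEQ)
    show "incseq (\<lambda>k y. e2ennreal (- ereal (g k y)) * indicator ?D y)"
      by (rule incseq_SucI) (auto simp: le_fun_def intro!: mult_right_mono ennreal_leI gdec)
    show "(\<lambda>y. e2ennreal (- ereal (g k y)) * indicator ?D y) \<in> borel_measurable lborel" for k
      unfolding uminus_ereal.simps e2ennreal_ereal using borel_measurable_uminus[OF gm[of k]]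
      by (intro borel_measurable_times_ennreal borel_measurable_indicator measurable_compose[OF _ measurable_ennreal]) auto
    fix y show "(\<lambda>k. e2ennreal (- ereal (g k y)) * indicator ?D y) \<longlonglongrightarrow> e2ennreal (- u y) * indicator ?D y"
    proof (cases "y \<in> ?D")
      case True
      have "(\<lambda>k. - ereal (g k y)) \<longlonglongrightarrow> - u y" using lim[OF True] by (rule tendsto_uminus_ereal)
      from tendsto_e2ennrealI[OF this] show ?thesis using True by simp
    qed simp
  qed
  have Pu: "?P u < \<infinity>"
  proof -
    have "?P u \<le> ?P (\<lambda>y. ereal (g 0 y))"
      by (intro nn_integral_mono) (auto simp: indicator_def simp del: e2ennreal_ereal intro!: e2ennreal_mono ug)
    then show ?thesis using Pfin[of 0] by (rule le_less_trans)
  qed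
  have "(\<lambda>k. ereal_integral ?D (\<lambda>y. ereal (g k y))) \<longlonglongrightarrow> ereal_integral ?D u"
    unfolding ereal_integral_def
  proof (rule tendsto_diff_ereal_general)
    show "(\<lambda>k. enn2ereal (?P (\<lambda>y. ereal (g k y)))) \<longlonglongrightarrow> enn2ereal (?P u)" using limP by simp
    show "(\<lambda>k. enn2ereal (?P (\<lambda>y. - ereal (g k y)))) \<longlonglongrightarrow> enn2ereal (?P (\<lambda>y. - u y))" using limN by simp
    \<comment> \<open>The positive part has a finite integral, so no \<infinity> - \<infinity>
      occurs even when the integral of \<open>u\<close> is -\<infinity>.\<close>
    have "enn2ereal (?P u) \<noteq> \<infinity>" using Pu by (metis enn2ereal_eq_top_iff infinity_ennreal_def less_irrefl)
    moreover have "enn2ereal (?P u) \<noteq> - \<infinity>" by simp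
    ultimately show "\<not> (enn2ereal (?P u) = \<infinity> \<and> enn2ereal (?P (\<lambda>y. - u y)) = \<infinity> \<or>
      enn2ereal (?P u) = - \<infinity> \<and> enn2ereal (?P (\<lambda>y. - u y)) = - \<infinity>)" by blast
  qed
  moreover have "ereal (measure lborel ?D) * ereal c \<le> ereal_integral ?D (\<lambda>y. ereal (g k y))" for k
  proof -
    have "c \<le> avg (g k) x r" by (rule ge[OF gc ug])
    then have "measure lborel ?D * c \<le> (LINT y:?D|lborel. g k y)"
      using r unfolding avg_def by (simp add: pos_le_divide_eq mult.commute)
    then show ?thesis by (simp add: ereal_integral_eq[OF gint])
  qed
  ultimately have "ereal (measure lborel ?D) * ereal c \<le> ereal_integral ?D u"
    by (intro LIMSEQ_le_const) auto
  then show ?thesis unfolding ball_mean_def using r by (subst ereal_le_divide_pos) auto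
qed

section \<open>Proof of the theorem\<close>

lemma inner_i_line:
  fixes b :: "complex^'n"
  shows "(\<i> *s b) \<bullet> b = 0" "(\<i> *s b) \<bullet> (\<i> *s b) = b \<bullet> b"
  by (auto simp: inner_vec_def inner_complex_def intro!: sum.neutral sum.cong)

lemma linear_imp_inner:
  fixes L :: "'a::euclidean_space \<Rightarrow> real"
  assumes "linear L"
  obtains l where "\<And>y. L y = l \<bullet> y"
proof -
  have "L y = (\<Sum>i\<in>Basis. L i *\<^sub>R i) \<bullet> y" for y
  proof -
    have "L y = L (\<Sum>i\<in>Basis. (y \<bullet> i) *\<^sub>R i)" by (simp add: euclidean_representation)
    also have "\<dots> = (\<Sum>i\<in>Basis. (y \<bullet> i) * L i)"
      by (simp add: linear_sum[OF assms] linear_scale[OF assms])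
    also have "\<dots> = (\<Sum>i\<in>Basis. L i *\<^sub>R i) \<bullet> y"
      by (simp add: inner_sum_left inner_commute[of y] mult.commute)
    finally show ?thesis .
  qed
  then show ?thesis using that by blast
qed

lemma poly_taylor_2:
  fixes p :: "'a::comm_ring_1 poly"
  obtains c1 c2 r where "\<And>w. poly p (z + w) = poly p z + c1 * w + c2 * (w * w) + w * w * w * poly r w"
proof -
  obtain c0 q where q: "pcompose p [:z, 1:] = pCons c0 q" by (cases "pcompose p [:z, 1:]")
  obtain c1 q' where q': "q = pCons c1 q'" by (cases q)
  obtain c2 r where r: "q' = pCons c2 r" by (cases q')
  have e: "poly p (z + w) = c0 + c1 * w + c2 * (w * w) + w * w * w * poly r w" for w
    using arg_cong[OF q, of "\<lambda>f. poly f w"] unfolding q' r by (simp add: poly_pcompose algebra_simps)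
  show ?thesis by (rule that[of c1 c2 r]) (use e e[of 0] in simp)
qed

text \<open>Plurisubharmonicity in the viscosity sense: \<open>touching\<close> is the conclusion of
  \<open>touching_trace\<close>. From here on the exceptional set and the gradient have
  disappeared.\<close>

locale viscosity =
  fixes u :: "complex^'n \<Rightarrow> ereal" and \<Omega> :: "(complex^'n) set"
  assumes open_dom: "open \<Omega>" and usc: "usc_on \<Omega> u" and lt_top: "z \<in> \<Omega> \<Longrightarrow> u z < \<infinity>"
    and touching: "\<lbrakk>\<bar>u z0\<bar> \<noteq> \<infinity>; 0 < R; cball z0 R \<subseteq> \<Omega>; 0 < \<eta>; quad B;
      \<And>y. y \<in> cball z0 R \<Longrightarrow>
        u y \<le> u z0 + ereal (l \<bullet> (y - z0) + B (y - z0) (y - z0) - \<eta> * (norm (y - z0))\<^sup>2)\<rbrakk>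
      \<Longrightarrow> 0 \<le> B b b + B (\<i> *s b) (\<i> *s b)"
begin

text \<open>
  \<open>f y\<close> is the coordinate of \<open>y\<close> along the complex line and \<open>\<pi> y\<close> the transversal component. The
  penalty \<open>m * (norm (\<pi> y))\<^sup>2\<close> forces the maximum on the tube \<open>T\<close> into the interior, where a second-order
  Taylor expansion of \<open>p\<close> produces the touching paraboloid.
\<close>

lemma harmonic_comparison:
  assumes b: "b \<noteq> 0" and t: "0 < t" and sub: "\<And>z. norm z \<le> t \<Longrightarrow> a + z *s b \<in> \<Omega>"
    and less: "\<And>z. norm z = t \<Longrightarrow> u (a + z *s b) < ereal (Re (poly p z))"
  shows "u a \<le> ereal (Re (poly p 0))"
proof (rule ccontr)
  assume "\<not> ?thesis"
  then have gt: "ereal (Re (poly p 0)) < u a" by simp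
  have a\<Omega>: "a \<in> \<Omega>" using sub[of 0] t by simp
  obtain A where A: "u a = ereal A" using gt lt_top[OF a\<Omega>] by (cases "u a") auto
  have gtA: "Re (poly p 0) < A" using gt A by simp
  \<comment> \<open>\<open>e * t\<^sup>2\<close> is half the excess of \<open>u a\<close> over
    \<open>Re (poly p 0)\<close>. Adding \<open>e * (t\<^sup>2 - (norm z)\<^sup>2)\<close> to
    \<open>Re (poly p z)\<close> gives it a negative Laplacian without changing it on the circle,
    and it stays below \<open>u\<close> at the centre.\<close>
  define e where "e = (A - Re (poly p 0)) / (2 * t\<^sup>2)"
  have e: "0 < e" using gtA t by (simp add: e_def)
  have et: "e * t\<^sup>2 < A - Re (poly p 0)" using gtA t by (simp add: e_def)
  have bb: "0 < b \<bullet> b" using b by simp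
  \<comment> \<open>\<open>b\<close> and \<open>\<i> *s b\<close> are orthogonal and of equal length
    in the real inner product, so \<open>f\<close> is a left inverse of
    \<open>\<lambda>z. z *s b\<close>.\<close>
  define f where "f y = (1 / (b \<bullet> b)) *\<^sub>R Complex (y \<bullet> b) (y \<bullet> (\<i> *s b))" for y
  have f_lin: "linear f" by (simp add: linear_iff f_def complex_eq_iff inner_add_left algebra_simps add_divide_distrib)
  have f_line: "f (z *s b) = z" for z
    using bb unfolding f_def
    by (subst (1 2) line_eq) (simp add: inner_add_left inner_i_line inner_commute[of b "\<i> *s b"] complex_eq_iff)
  define \<pi> where "\<pi> y = y - f y *s b" for y
  have \<pi>_lin: "linear \<pi>"
    unfolding \<pi>_def using linear_compose_sub[OF linear_ident linear_compose[OF f_lin linear_line[of b]]] by (simp add: o_def)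
  have \<pi>_line: "\<pi> (z *s b) = 0" for z by (simp add: \<pi>_def f_line)
  note add = linear_add[OF f_lin] linear_add[OF \<pi>_lin] and scale = linear_scale[OF f_lin] linear_scale[OF \<pi>_lin]
    and zero = linear_0[OF f_lin] linear_0[OF \<pi>_lin]
  have bl: "bounded_linear f" "bounded_linear \<pi>" using f_lin \<pi>_lin linear_conv_bounded_linear by blast+
  have cont: "continuous_on S (\<lambda>v. f (v - a))" "continuous_on S (\<lambda>v. \<pi> (v - a))" for S
    by (intro bounded_linear.continuous_on[OF bl(1)] bounded_linear.continuous_on[OF bl(2)] continuous_intros)+
  have split: "v = (a + f (v - a) *s b) + \<pi> (v - a)" for v by (simp add: \<pi>_def)

  \<comment> \<open>The strict inequality on the circle extends to the open set \<open>W\<close>;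
    compactness gives a tube radius \<delta> for which the side over the circle lies in
    \<open>W\<close> and the whole tube in \<Omega>.\<close>
  define W where "W = {v\<in>\<Omega>. u v + ereal (- Re (poly p (f (v - a)))) < 0}"
  have openW: "open W" unfolding W_def
    by (intro usc_on_open_sublevel usc_on_add usc open_dom continuous_intros cont)
  have line_cont: "continuous_on S (\<lambda>z. a + z *s b)" for S by (intro continuous_intros)
  have disc: "(\<lambda>z. a + z *s b) ` cball 0 t \<subseteq> \<Omega>" using sub by auto
  obtain e1 where e1: "e1 > 0" "(\<Union>x\<in>(\<lambda>z. a + z *s b) ` cball 0 t. ball x e1) \<subseteq> \<Omega>"
    using compact_subset_open_imp_ball_epsilon_subset[OF compact_continuous_image[OF line_cont compact_cball[of 0 t]] open_dom disc]
    by blast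
  have circ: "(\<lambda>z. a + z *s b) ` sphere 0 t \<subseteq> W"
  proof
    fix v assume "v \<in> (\<lambda>z. a + z *s b) ` sphere 0 t"
    then obtain z where z: "norm z = t" "v = a + z *s b" by auto
    have "u v < ereal (Re (poly p z))" using less[OF z(1)] z(2) by simp
    then have "u v + ereal (- Re (poly p z)) < 0" by (cases "u v") auto
    moreover have "f (v - a) = z" using z(2) by (simp add: f_line)
    ultimately show "v \<in> W" using sub[of z] z unfolding W_def by simp
  qed
  obtain e2 where e2: "e2 > 0" "(\<Union>x\<in>(\<lambda>z. a + z *s b) ` sphere 0 t. ball x e2) \<subseteq> W"
    using compact_subset_open_imp_ball_epsilon_subset[OF compact_continuous_image[OF line_cont compact_sphere[of 0 t]] openW circ]
    by blast
  define \<delta> where "\<delta> = min e1 e2 / 2"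
  have \<delta>: "0 < \<delta>" "\<delta> < e1" "\<delta> < e2" using e1 e2 by (auto simp: \<delta>_def)
  define T where "T = {v. norm (f (v - a)) \<le> t \<and> norm (\<pi> (v - a)) \<le> \<delta>}"
  have near: "v \<in> ball (a + f (v - a) *s b) c" if "v \<in> T" "\<delta> < c" for v c
  proof -
    have "v - (a + f (v - a) *s b) = \<pi> (v - a)" by (simp add: \<pi>_def)
    then have "dist (a + f (v - a) *s b) v = norm (\<pi> (v - a))" by (simp add: dist_commute dist_norm)
    then show ?thesis using that by (simp add: T_def)
  qed
  have T\<Omega>: "T \<subseteq> \<Omega>"
  proof
    fix v assume v: "v \<in> T"
    have "f (v - a) \<in> cball 0 t" using v by (simp add: T_def)
    then show "v \<in> \<Omega>" using e1(2) near[OF v \<delta>(2)] by blast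
  qed
  have compT: "compact T"
  proof -
    have "closed T" unfolding T_def by (intro closed_Collect_conj closed_Collect_le continuous_intros cont)
    moreover have "bounded T"
    proof -
      have "bounded ((\<lambda>z. a + z *s b) ` cball 0 t)"
        by (intro compact_imp_bounded compact_continuous_image line_cont compact_cball)
      then obtain C where C: "\<And>z. z \<in> cball 0 t \<Longrightarrow> norm (a + z *s b) \<le> C" unfolding bounded_iff by blast
      have "norm v \<le> C + \<delta>" if "v \<in> T" for v
      proof -
        have "norm v \<le> norm (a + f (v - a) *s b) + norm (\<pi> (v - a))"
          by (subst split[of v]) (rule norm_triangle_ineq)
        also have "\<dots> \<le> C + \<delta>" using that C by (intro add_mono) (auto simp: T_def)
        finally show ?thesis .
      qed
      then show ?thesis unfolding bounded_iff by blast
    qed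
    ultimately show ?thesis by (simp add: compact_eq_bounded_closed)
  qed
  have uscT: "usc_on T u" using usc T\<Omega> by (rule usc_on_subset)
  have aT: "a \<in> T" using t \<delta> by (simp add: T_def zero)
  obtain M where M: "\<And>v. v \<in> T \<Longrightarrow> u v \<le> ereal M"
  proof -
    obtain x where x: "x \<in> T" "\<forall>v\<in>T. u v \<le> u x" using usc_attains_max[OF uscT compT] aT by blast
    have "u x \<le> ereal (real_of_ereal (u x))" using lt_top[of x] x(1) T\<Omega> by (cases "u x") auto
    then show ?thesis using that[of "real_of_ereal (u x)"] x by (meson order_trans)
  qed
  define H where "H z = Re (poly p z) + e * (t\<^sup>2 - (norm z)\<^sup>2)" for z
  have H_cont: "continuous_on S H" for S unfolding H_def by (intro continuous_intros)
  obtain Hb where Hb: "\<And>z. z \<in> cball 0 t \<Longrightarrow> norm (H z) \<le> Hb"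
    using compact_imp_bounded[OF compact_continuous_image[OF H_cont compact_cball[of 0 t]]]
    unfolding bounded_iff by blast
  \<comment> \<open>At transversal distance \<delta> the penalty is \<bar>M\<bar> + \<bar>Hb\<bar> +
    1, so there \<open>h\<close> exceeds every value of \<open>u\<close> on the tube.\<close>
  define m where "m = (\<bar>M\<bar> + \<bar>Hb\<bar> + 1) / \<delta>\<^sup>2"
  have m: "0 < m" using \<delta> by (auto simp: m_def intro!: divide_pos_pos)
  have m\<delta>: "m * \<delta>\<^sup>2 = \<bar>M\<bar> + \<bar>Hb\<bar> + 1" using \<delta> by (simp add: m_def)
  define h where "h v = H (f (v - a)) + m * (norm (\<pi> (v - a)))\<^sup>2" for v
  have h_cont: "continuous_on S h" for S
    unfolding h_def by (intro continuous_intros continuous_on_compose2[OF H_cont cont(1)] cont) auto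
  have "\<exists>x\<in>T. \<bar>u x\<bar> \<noteq> \<infinity> \<and> (\<forall>v\<in>T. u v \<le> u x + ereal (h v - h x))"
    by (rule usc_touch[OF uscT compT h_cont aT]) (use A lt_top T\<Omega> in auto)
  then obtain x where x: "x \<in> T" "\<bar>u x\<bar> \<noteq> \<infinity>" and tch: "\<forall>v\<in>T. u v \<le> u x + ereal (h v - h x)"
    by (elim bexE conjE)
  obtain X where X: "u x = ereal X" using x(2) by (cases "u x") auto
  have "A \<le> X + (h a - h x)" using tch aT A X by fastforce
  moreover have "h a = Re (poly p 0) + e * t\<^sup>2" by (simp add: h_def H_def zero)
  ultimately have Xh: "h x < X" using et by linarith
  define z0 where "z0 = f (x - a)"
  define k0 where "k0 = \<pi> (x - a)"
  have z0: "norm z0 < t"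
  proof (rule ccontr)
    assume "\<not> norm z0 < t"
    then have n: "norm z0 = t" using x(1) by (simp add: T_def z0_def)
    then have "f (x - a) \<in> sphere 0 t" by (simp add: z0_def)
    then have "x \<in> W" using e2(2) near[OF x(1) \<delta>(3)] by blast
    then have "X < Re (poly p z0)" using X unfolding W_def z0_def by simp
    moreover have "Re (poly p z0) \<le> h x" using n m unfolding h_def H_def z0_def by simp
    ultimately show False using Xh by linarith
  qed
  have k0: "norm k0 < \<delta>"
  proof (rule ccontr)
    assume "\<not> norm k0 < \<delta>"
    then have n: "norm k0 = \<delta>" using x(1) by (simp add: T_def k0_def)
    have "X \<le> M" using M[OF x(1)] X by simp
    moreover have "- Hb \<le> H z0" using Hb[of z0] z0 by simp
    moreover have "h x = H z0 + (\<bar>M\<bar> + \<bar>Hb\<bar> + 1)" using n m\<delta> unfolding h_def k0_def z0_def by simp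
    ultimately show False using Xh by linarith
  qed
  have "open {v. norm (f (v - a)) < t \<and> norm (\<pi> (v - a)) < \<delta>}"
    by (intro open_Collect_conj open_Collect_less continuous_intros cont)
  moreover have "x \<in> {v. norm (f (v - a)) < t \<and> norm (\<pi> (v - a)) < \<delta>}"
    using z0 k0 by (simp add: z0_def k0_def)
  ultimately obtain s0 where s0: "0 < s0" "cball x s0 \<subseteq> {v. norm (f (v - a)) < t \<and> norm (\<pi> (v - a)) < \<delta>}"
    using open_contains_cball by blast
  then have sT: "cball x s0 \<subseteq> T" unfolding T_def by force

  obtain c1 c2 r where taylor: "\<And>w. poly p (z0 + w) = poly p z0 + c1 * w + c2 * (w * w) + w * w * w * poly r w"
    using poly_taylor_2 by blast
  have r_cont: "continuous_on (cball 0 1) (\<lambda>w. poly r w)" by (intro continuous_intros)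
  obtain C where C: "\<And>w. w \<in> cball 0 1 \<Longrightarrow> norm (poly r w) \<le> C"
    using compact_imp_bounded[OF compact_continuous_image[OF r_cont compact_cball]]
    unfolding bounded_iff by blast
  have C0: "0 \<le> C" using C[of 0] by (rule order_trans[OF norm_ge_zero]) simp
  obtain E where E: "0 < E" "\<And>y. norm (f y) \<le> norm y * E" using bounded_linear.pos_bounded[OF bl(1)] by blast
  \<comment> \<open>For \<open>norm w \<le> s1\<close> the cubic Taylor remainder is at most a
    quarter of \<open>e * (norm w)\<^sup>2\<close>; this is why \<open>B\<close> keeps only three
    quarters of the concave term.\<close>
  define s1 where "s1 = min 1 (e / (4 * (C + 1)))"
  have s1: "0 < s1" "s1 \<le> 1" "s1 \<le> e / (4 * (C + 1))" using e C0 by (auto simp: s1_def simp del: min_le_iff_disj)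
  define s where "s = min s0 (s1 / E)"
  have s: "0 < s" "s \<le> s0" "s \<le> s1 / E" using s0 s1 E by (auto simp: s_def simp del: min_le_iff_disj)
  define q where "q = e / (4 * (b \<bullet> b))"
  have q: "0 < q" using e bb by (simp add: q_def)
  \<comment> \<open>The summand with \<open>q\<close> offsets the strictness term of
    \<open>touching\<close>. Over \<open>b\<close> and \<open>\<i> *s b\<close> the
    \<open>c2\<close> terms cancel, \<pi> vanishes, and twice \<open>- 3/4 * e\<close> plus twice
    \<open>q * (b \<bullet> b) = e / 4\<close> leaves \<open>- e\<close>.\<close>
  define B where "B y y' = Re (c2 * (f y * f y')) - 3/4 * e * (f y \<bullet> f y') + m * (\<pi> y \<bullet> \<pi> y') + q * (y \<bullet> y')" for y y'
  have quadB: "quad B"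
  proof (rule quad.intro)
    have "bilinear B"
      unfolding bilinear_def linear_iff B_def by (simp add: add scale inner_add_left inner_add_right algebra_simps)
    then show "bounded_bilinear B" by (simp only: bilinear_conv_bounded_bilinear)
    show "B x y = B y x" for x y by (simp add: B_def inner_commute mult.commute)
  qed
  define L where "L y = Re (c1 * f y) - 2 * e * (z0 \<bullet> f y) + 2 * m * (k0 \<bullet> \<pi> y)" for y
  have "linear L" unfolding linear_iff L_def by (simp add: add scale inner_add_right algebra_simps)
  then obtain l where l: "\<And>y. L y = l \<bullet> y" using linear_imp_inner by blast
  have "0 \<le> B b b + B (\<i> *s b) (\<i> *s b)"
  proof (rule touching[OF x(2) s(1) _ q quadB])
    show "cball x s \<subseteq> \<Omega>" using s(2) sT T\<Omega> by (meson order_trans subset_cball)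
    fix v assume v: "v \<in> cball x s"
    define y where "y = v - x"
    define w where "w = f y"
    define k where "k = \<pi> y"
    have vT: "v \<in> T" using v s(2) sT by auto
    have "norm w \<le> norm y * E" unfolding w_def by (rule E(2))
    also have "\<dots> \<le> (s1 / E) * E"
      using v s(3) E(1) by (intro mult_right_mono) (auto simp: y_def dist_norm norm_minus_commute)
    finally have w1: "norm w \<le> s1" using E(1) by simp
    have rem: "Re (w * w * w * poly r w) \<le> e / 4 * (norm w)\<^sup>2"
    proof -
      have "Re (w * w * w * poly r w) \<le> norm (w * w * w * poly r w)" by (rule complex_Re_le_cmod)
      also have "\<dots> = (norm w)\<^sup>2 * (norm w * norm (poly r w))" by (simp add: norm_mult power2_eq_square)
      also have "\<dots> \<le> (norm w)\<^sup>2 * (e / (4 * (C + 1)) * (C + 1))"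
        using w1 s1 C[of w] C0 by (intro mult_left_mono mult_mono) auto
      also have "e / (4 * (C + 1)) * (C + 1) = e / 4" using C0 by (simp add: field_simps)
      finally show ?thesis by (simp add: mult.commute)
    qed
    have va: "v - a = (x - a) + y" by (simp add: y_def)
    have fv: "f (v - a) = z0 + w" "\<pi> (v - a) = k0 + k"
      unfolding va add by (simp_all add: z0_def w_def k0_def k_def)
    have sq: "(norm (c + d))\<^sup>2 = (norm c)\<^sup>2 + 2 * (c \<bullet> d) + (norm d)\<^sup>2" for c d :: "'v::real_inner"
      by (simp add: power2_norm_eq_inner inner_add_left inner_add_right inner_commute)
    have hv: "h v - h x = (Re (c1 * w) + Re (c2 * (w * w)) + Re (w * w * w * poly r w))
        - e * (2 * (z0 \<bullet> w) + (norm w)\<^sup>2) + m * (2 * (k0 \<bullet> k) + (norm k)\<^sup>2)"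
      unfolding h_def H_def fv taylor sq
      unfolding z0_def[symmetric] k0_def[symmetric] by (simp add: algebra_simps)
    have Bv: "B y y - q * (norm y)\<^sup>2 = Re (c2 * (w * w)) - 3/4 * e * (norm w)\<^sup>2 + m * (norm k)\<^sup>2"
      unfolding B_def w_def[symmetric] k_def[symmetric] by (simp add: power2_norm_eq_inner)
    have "h v - h x \<le> l \<bullet> y + B y y - q * (norm y)\<^sup>2"
      using hv Bv rem unfolding l[symmetric] L_def w_def[symmetric] k_def[symmetric] by (simp add: algebra_simps)
    then have "u x + ereal (h v - h x) \<le> u x + ereal (l \<bullet> y + B y y - q * (norm y)\<^sup>2)"
      by (intro add_left_mono) simp
    then show "u v \<le> u x + ereal (l \<bullet> (v - x) + B (v - x) (v - x) - q * (norm (v - x))\<^sup>2)"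
      using tch vT unfolding y_def by (meson order_trans)
  qed
  moreover have "B b b + B (\<i> *s b) (\<i> *s b) = - e"
  proof -
    have e: "f b = 1" "f (\<i> *s b) = \<i>" "\<pi> b = 0" "\<pi> (\<i> *s b) = 0"
      using f_line[of 1] f_line[of \<i>] \<pi>_line[of 1] \<pi>_line[of \<i>] by simp_all
    have "q * (b \<bullet> b) = e / 4" using bb by (simp add: q_def)
    then show ?thesis unfolding B_def e inner_i_line by (simp add: inner_complex_def)
  qed
  ultimately show False using e by simp
qed

text \<open>By \<open>usc_ball_mean_ge\<close> a failure would show in a continuous majorant
  \<open>g\<close> with too small a mean. Then some circle carries a polynomial with
  \<open>g\<close> below its real part although the central value is below that of \<open>u\<close>,
  against \<open>harmonic_comparison\<close>.\<close>

lemma line_submean: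
  assumes s: "0 < s" and sub: "\<And>z. z \<in> cball z0 s \<Longrightarrow> a + z *s b \<in> \<Omega>"
  shows "u (a + z0 *s b) \<le> ball_mean (\<lambda>z. u (a + z *s b)) z0 s"
proof (cases "u (a + z0 *s b) = - \<infinity>")
  case True then show ?thesis by simp
next
  case False
  have in0: "a + z0 *s b \<in> \<Omega>" using sub[of z0] s by simp
  obtain c where c: "u (a + z0 *s b) = ereal c"
    using False lt_top[OF in0] by (cases "u (a + z0 *s b)") auto
  have "ereal c \<le> ball_mean (\<lambda>z. u (a + z *s b)) z0 s"
  proof (rule usc_ball_mean_ge[OF _ s])
    show "usc_on (cball z0 s) (\<lambda>z. u (a + z *s b))"
      by (rule usc_on_compose[OF usc]) (auto intro!: continuous_intros sub)
    show "u (a + z *s b) < \<infinity>" if "z \<in> cball z0 s" for z using lt_top[OF sub[OF that]] .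
    fix g :: "complex \<Rightarrow> real"
    assume g: "continuous_on UNIV g" and ug: "\<And>z. z \<in> cball z0 s \<Longrightarrow> u (a + z *s b) \<le> ereal (g z)"
    show "c \<le> avg g z0 s"
    \<comment> \<open>For \<open>b = 0\<close> the line degenerates to a point and \<open>u\<close>
      is constant along it, so averaging the majorant is enough.\<close>
    proof (cases "b = 0")
      case True
      have "c = avg (\<lambda>_. c) z0 s" by (rule avg_const[OF s, symmetric])
      also have "\<dots> \<le> avg g z0 s"
        by (intro avg_mono s integrable_cball_UNIV g continuous_on_const) (use ug c True in auto)
      finally show ?thesis .
    next
      case False
      show ?thesis
      proof (rule ccontr)
        assume "\<not> c \<le> avg g z0 s"
        then have less: "avg (\<lambda>\<omega>. g (z0 + \<omega>)) 0 s < c"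
          using avg_trans[OF integrable_cball_UNIV[OF g]] by simp
        have ge: "c \<le> g (z0 + 0)" using ug[of z0] s c by simp
        have "continuous_on (cball 0 s) (\<lambda>\<omega>. g (z0 + \<omega>))"
          by (intro continuous_on_compose2[OF g] continuous_intros) auto
        from harmonic_majorant_on_circle[OF this s less ge]
        obtain t p where t: "0 < t" "t \<le> s" and p: "\<And>\<omega>. norm \<omega> = t \<Longrightarrow> g (z0 + \<omega>) < Re (poly p \<omega>)"
          and p0: "Re (poly p 0) < c" by blast
        have e: "(a + z0 *s b) + \<omega> *s b = a + (z0 + \<omega>) *s b" for \<omega>
          by (simp add: linear_add[OF linear_line] add.assoc)
        have "u (a + z0 *s b) \<le> ereal (Re (poly p 0))"
        proof (rule harmonic_comparison[OF False t(1)])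
          fix \<omega> :: complex assume "norm \<omega> \<le> t"
          then show "(a + z0 *s b) + \<omega> *s b \<in> \<Omega>" unfolding e using t by (intro sub) (simp add: dist_norm)
        next
          fix \<omega> :: complex assume \<omega>: "norm \<omega> = t"
          then have "u (a + (z0 + \<omega>) *s b) \<le> ereal (g (z0 + \<omega>))" using t by (intro ug) (simp add: dist_norm)
          also have "\<dots> < ereal (Re (poly p \<omega>))" using p[OF \<omega>] by simp
          finally show "u ((a + z0 *s b) + \<omega> *s b) < ereal (Re (poly p \<omega>))" unfolding e .
        qed
        then show False using c p0 by simp
      qed
    qed
  qed
  then show ?thesis using c by simp
qed

lemma line_subharmonic:
  assumes C: "C \<in> components {z. a + z *s b \<in> \<Omega>}"
  shows "(\<forall>z\<in>C. u (a + z *s b) = -\<infinity>) \<or> (\<lambda>z. u (a + z *s b)) subharmonic_on C"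
proof (rule disjCI)
  assume "\<not> (\<lambda>z. u (a + z *s b)) subharmonic_on C"
  have sub: "a + z *s b \<in> \<Omega>" if "z \<in> C" for z using in_components_subset[OF C] that by blast
  have openC: "open C" using line_open[OF open_dom] C by (rule open_components)
  have comp: "components C = {C}"
    using in_components_connected[OF C] in_components_nonempty[OF C] by (simp add: components_eq_sing_iff)
  show "\<forall>z\<in>C. u (a + z *s b) = -\<infinity>"
  proof (rule ccontr)
    assume ne: "\<not> ?thesis"
    have "(\<lambda>z. u (a + z *s b)) subharmonic_on C"
      unfolding subharmonic_on_def
    proof (intro conjI ballI allI impI openC)
      show "usc_on C (\<lambda>z. u (a + z *s b))"
        by (rule usc_on_compose[OF usc]) (auto intro!: continuous_intros sub)
    next
      fix D assume "D \<in> components C"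
      then show "\<exists>z\<in>D. u (a + z *s b) \<noteq> - \<infinity>" using comp ne by auto
    next
      fix z0 s assume s: "(0::real) < s" "cball z0 s \<subseteq> C"
      show "u (a + z0 *s b) \<le> ball_mean (\<lambda>z. u (a + z *s b)) z0 s"
        by (rule line_submean[OF s(1)]) (use s sub in blast)
    qed (use lt_top sub in auto)
    then show False using \<open>\<not> (\<lambda>z. u (a + z *s b)) subharmonic_on C\<close> by blast
  qed
qed

end

theorem theorem3p1:
  fixes \<Omega> E1 E2 E3 E :: "(complex^'n) set"
    and u :: "complex^'n \<Rightarrow> ereal"
  assumes "open \<Omega>"
    and "u subharmonic_on \<Omega>"
    and "E1 = {z \<in> \<Omega>. has_gradient u z 0}"
    and "E2 = {z \<in> \<Omega>. \<not> (\<exists>g. has_gradient u z g)}"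
    and "E3 \<subseteq> \<Omega>"
    and "E3 \<in> null_sets lebesgue"
    and "E3 \<inter> (E1 \<union> E2) = {}"
    and "E = E1 \<union> E2 \<union> E3"
    and "\<exists>\<Omega>'. open \<Omega>' \<and> \<Omega> - E \<subseteq> \<Omega>' \<and> \<Omega>' \<subseteq> \<Omega> \<and> u plurisubharmonic_on \<Omega>'"
  shows "u plurisubharmonic_on \<Omega>"
proof -
  note sh = assms(2)[unfolded subharmonic_on_def]
  have neg: "negligible E3" using assms(6) by (simp add: negligible_iff_null_sets)
  have cases: "has_gradient u z 0 \<or> \<not> (\<exists>g. has_gradient u z g) \<or> (\<exists>S. u plurisubharmonic_on S \<and> z \<in> S)"
    if "z \<in> \<Omega>" "z \<notin> E3" for z
    using that assms(3,4,8,9) by blast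
  interpret viscosity u \<Omega>
  proof
    show "open \<Omega>" "usc_on \<Omega> u" "z \<in> \<Omega> \<Longrightarrow> u z < \<infinity>" for z using sh by auto
    then show "0 \<le> B b b + B (\<i> *s b) (\<i> *s b)"
      if "\<bar>u z0\<bar> \<noteq> \<infinity>" "0 < R" "cball z0 R \<subseteq> \<Omega>" "0 < \<eta>" "quad B"
        "\<And>y. y \<in> cball z0 R \<Longrightarrow>
          u y \<le> u z0 + ereal (l \<bullet> (y - z0) + B (y - z0) (y - z0) - \<eta> * (norm (y - z0))\<^sup>2)"
      for z0 R \<eta> B l b
      using touching_trace[OF _ subharmonic_imp_submean[OF assms(2)] _ _ neg cases that] by blast
  qed
  \<comment> \<open>The conditions on \<Omega> itself are shared with subharmonicity; only the one
    on complex lines is new.\<close>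
  show ?thesis unfolding plurisubharmonic_on_def using sh line_subharmonic by blast
qed

end
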